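(* Let $R$ be a commutative ring with unit and let $\mathbb{A}=\mathbf{Lie}_R$ be the category of Lie algebras over $R$. Let $(\mu\colon M\to L,\xi_M)$ and $(\nu\colon N\to L,\xi_N)$ be crossed modules of $R$-Lie algebras. Then the (general, categorical) non-abelian tensor product $M\otimes N$ of these two $L$-crossed modules, computed in the semi-abelian category $\mathbf{Lie}_R$, coincides (up to isomorphism) with the non-abelian tensor product of Lie algebras $M\otimes_{\mathit{Lie}}N$ defined by generators and relations, where $M$ and $N$ act on each other via $\mu$ and $\nu$.
   Context: Lie tensor product (Ellis). $M$ acts on $N$ via ${}^mn={}^{\mu(m)}n$ and $N$ acts on $M$ via ${}^nm={}^{\nu(n)}m$. The Lie algebra $M\otimes_{\mathit{Lie}}N$ is generated by symbols $m\otimes n$ ($m\in M$, $n\in N$) subject to the relations, for all $\lambda\in R$, $m,m'\in M$, $n,n'\in N$: - $(\lambda m)\otimes n=\lambda(m\otimes n)=m\otimes(\lambda n)$; - $(m+m')\otimes n=m\otimes n+m'\otimes n$ and $m\otimes(n+n')=m\otimes n+m\otimes n'$; - $[m,m']\otimes n=m\otimes({}^{m'}n)-m'\otimes({}^mn)$ and $m\otimes[n,n']=({}^{n'}m)\otimes n-({}^nm)\otimes n'$; - $[m\otimes n,m'\otimes n']=-({}^nm)\otimes({}^{m'}n')$. A crossed module of Lie algebras is a morphism $\mu\colon M\to L$ with a Lie action of $L$ on $M$ such that $\mu({}^lm)=[l,\mu(m)]$ and ${}^{\mu(m)}m'=[m,m']$. General tensor product (in a semi-abelian category with the Smith is Huq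 condition, such as $\mathbf{Lie}_R$). $K_f$ denotes the kernel of $f$; the Higgins commutator $[A,B]\leq X$ of two subobjects of $X$ is the image in $X$ of the kernel of the canonical morphism $A+B\to A\times B$ ($+$ is the coproduct), and the Huq commutator $[A,B]^{\mathcal Q}_X$ is its normal closure in $X$. Let $(M\rtimes L,L,d_M,c_M,e_M)$ and $(N\rtimes L,L,d_N,c_N,e_N)$ be the internal groupoids (domain, codomain, identities) corresponding to the two crossed modules: $d_M$ is the semidirect product projection, $e_M$ its canonical splitting, and $c_M$ is determined by being $1_L$ on $L$ and $\mu$ on $M$ (similarly for $N$). Let $Q$ be the pushout of $e_M$ and $e_N$, with canonical morphisms $e_U\colon M\rtimes L\to Q$ and $e_L\colon N\rtimes L\to Q$; let $d_U,c_U\colon Q\to M\rtimes L$ be determined by $d_Ue_U=1=c_Ue_U$, $d_Ue_L=e_Md_N$, $c_Ue_L=e_Mc_N$, and $d_L,c_L\colon Q\to N\rtimes L$ by $d_Le_L=1=c_Le_L$, $d_Le_U=e_Nd_M$, $c_Le_U=e_Nc_M$. Put $Q_{M\otimes N}=Q/\bigl([K_{d_L},K_{c_L}]^{\mathcal Q}_Q\vee[K_{d_U},K_{c_U}]^{\mathcal Q}_Q\bigr)$, with induced morphisms $\overline{d_U}\colon Q_{M\otimes N}\to M\rtimes L$ and $\overline{d_L}\colon Q_{M\otimes N}\to N\rtimes L$. Then $M\otimes N:=K_{\overline{d_U}}\wedge K_{\overline{d_L}}$. *)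

theory Defs
  imports "HOL-Algebra.QuotRing" "HOL-Algebra.Module"
begin

section \<open>Lie algebras over a commutative ring\<close>

text \<open>
  Lie algebras are carried by the record \<open>module\<close> of HOL-Algebra: its field \<open>mult\<close> holds the Lie
  bracket and its field \<open>one\<close> is ignored everywhere.  The bracket is alternating, not merely
  antisymmetric (2 need not be invertible in R).
\<close>

locale lie_algebra = module R A for R (structure) and A (structure) +
  assumes bracket_closed [simp, intro]:
      "\<lbrakk>x \<in> carrier A; y \<in> carrier A\<rbrakk> \<Longrightarrow> x \<otimes>\<^bsub>A\<^esub> y \<in> carrier A"
    and bracket_add_l:
      "\<lbrakk>x \<in> carrier A; y \<in> carrier A; z \<in> carrier A\<rbrakk> \<Longrightarrow>
        (x \<oplus>\<^bsub>A\<^esub> y) \<otimes>\<^bsub>A\<^esub> z = (x \<otimes>\<^bsub>A\<^esub> z) \<oplus>\<^bsub>A\<^esub> (y \<otimes>\<^bsub>A\<^esub> z)"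
    and bracket_add_r:
      "\<lbrakk>x \<in> carrier A; y \<in> carrier A; z \<in> carrier A\<rbrakk> \<Longrightarrow>
        x \<otimes>\<^bsub>A\<^esub> (y \<oplus>\<^bsub>A\<^esub> z) = (x \<otimes>\<^bsub>A\<^esub> y) \<oplus>\<^bsub>A\<^esub> (x \<otimes>\<^bsub>A\<^esub> z)"
    and bracket_smult_l:
      "\<lbrakk>r \<in> carrier R; x \<in> carrier A; y \<in> carrier A\<rbrakk> \<Longrightarrow>
        (r \<odot>\<^bsub>A\<^esub> x) \<otimes>\<^bsub>A\<^esub> y = r \<odot>\<^bsub>A\<^esub> (x \<otimes>\<^bsub>A\<^esub> y)"
    and bracket_smult_r:
      "\<lbrakk>r \<in> carrier R; x \<in> carrier A; y \<in> carrier A\<rbrakk> \<Longrightarrow>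
        x \<otimes>\<^bsub>A\<^esub> (r \<odot>\<^bsub>A\<^esub> y) = r \<odot>\<^bsub>A\<^esub> (x \<otimes>\<^bsub>A\<^esub> y)"
    and bracket_alternating: "x \<in> carrier A \<Longrightarrow> x \<otimes>\<^bsub>A\<^esub> x = \<zero>\<^bsub>A\<^esub>"
    and jacobi:
      "\<lbrakk>x \<in> carrier A; y \<in> carrier A; z \<in> carrier A\<rbrakk> \<Longrightarrow>
        (x \<otimes>\<^bsub>A\<^esub> (y \<otimes>\<^bsub>A\<^esub> z)) \<oplus>\<^bsub>A\<^esub> (y \<otimes>\<^bsub>A\<^esub> (z \<otimes>\<^bsub>A\<^esub> x)) \<oplus>\<^bsub>A\<^esub> (z \<otimes>\<^bsub>A\<^esub> (x \<otimes>\<^bsub>A\<^esub> y)) = \<zero>\<^bsub>A\<^esub>"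

definition lie_hom ::
  "('r, 'x) ring_scheme \<Rightarrow> ('r, 'a, 'y) module_scheme \<Rightarrow> ('r, 'b, 'z) module_scheme \<Rightarrow> ('a \<Rightarrow> 'b) set"
  where "lie_hom R A B = {f. f \<in> carrier A \<rightarrow> carrier B \<and>
    (\<forall>x\<in>carrier A. \<forall>y\<in>carrier A. f (x \<oplus>\<^bsub>A\<^esub> y) = f x \<oplus>\<^bsub>B\<^esub> f y) \<and>
    (\<forall>r\<in>carrier R. \<forall>x\<in>carrier A. f (r \<odot>\<^bsub>A\<^esub> x) = r \<odot>\<^bsub>B\<^esub> f x) \<and>
    (\<forall>x\<in>carrier A. \<forall>y\<in>carrier A. f (x \<otimes>\<^bsub>A\<^esub> y) = f x \<otimes>\<^bsub>B\<^esub> f y)}"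

definition lie_isomorphic ::
  "('r, 'x) ring_scheme \<Rightarrow> ('r, 'a, 'y) module_scheme \<Rightarrow> ('r, 'b, 'z) module_scheme \<Rightarrow> bool"
  where "lie_isomorphic R A B \<longleftrightarrow> (\<exists>f\<in>lie_hom R A B. bij_betw f (carrier A) (carrier B))"

definition lie_subalgebra :: "'a set \<Rightarrow> ('r, 'x) ring_scheme \<Rightarrow> ('r, 'a, 'y) module_scheme \<Rightarrow> bool"
  where "lie_subalgebra S R A \<longleftrightarrow> submodule S R A \<and> (\<forall>x\<in>S. \<forall>y\<in>S. x \<otimes>\<^bsub>A\<^esub> y \<in> S)"

definition lie_ideal :: "'a set \<Rightarrow> ('r, 'x) ring_scheme \<Rightarrow> ('r, 'a, 'y) module_scheme \<Rightarrow> bool"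
  where "lie_ideal I R A \<longleftrightarrow> submodule I R A \<and> (\<forall>x\<in>carrier A. \<forall>y\<in>I. x \<otimes>\<^bsub>A\<^esub> y \<in> I)"

text \<open>Join in the lattice of subobjects.\<close>

definition lie_join :: "('r, 'x) ring_scheme \<Rightarrow> ('r, 'a, 'y) module_scheme \<Rightarrow> 'a set \<Rightarrow> 'a set \<Rightarrow> 'a set"
  where "lie_join R A S T = \<Inter>{U. lie_subalgebra U R A \<and> S \<union> T \<subseteq> U}"

text \<open>The normal subobjects (kernels) in the category of Lie algebras are the ideals; see
  \<open>a_kernel_lie_ideal\<close> and \<open>lie_ideal_quot\<close> below.\<close>

definition lie_normal_closure :: "('r, 'x) ring_scheme \<Rightarrow> ('r, 'a, 'y) module_scheme \<Rightarrow> 'a set \<Rightarrow> 'a set"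
  where "lie_normal_closure R A S = \<Inter>{I. lie_ideal I R A \<and> S \<subseteq> I}"

definition lie_quot :: "('r, 'a, 'y) module_scheme \<Rightarrow> 'a set \<Rightarrow> ('r, 'a set) module"
  where "lie_quot A I =
    \<lparr>carrier = a_rcosets\<^bsub>A\<^esub> I, mult = rcoset_mult A I, one = I, zero = I, add = set_add A,
     smult = (\<lambda>r C. \<Union>c\<in>C. I +>\<^bsub>A\<^esub> (r \<odot>\<^bsub>A\<^esub> c))\<rparr>"

text \<open>The morphism on \<open>lie_quot A I\<close> induced by a morphism \<open>f\<close> vanishing on \<open>I\<close>; such an \<open>f\<close> is
  constant on cosets.\<close>

definition lie_quot_lift :: "('a \<Rightarrow> 'b) \<Rightarrow> 'a set \<Rightarrow> 'b"
  where "lie_quot_lift f C = the_elem (f ` C)"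

definition lie_prod :: "('r, 'a, 'y) module_scheme \<Rightarrow> ('r, 'b, 'z) module_scheme \<Rightarrow> ('r, 'a \<times> 'b) module"
  where "lie_prod A B =
    \<lparr>carrier = carrier A \<times> carrier B,
     mult = (\<lambda>(a, b) (a', b'). (a \<otimes>\<^bsub>A\<^esub> a', b \<otimes>\<^bsub>B\<^esub> b')),
     one = (\<zero>\<^bsub>A\<^esub>, \<zero>\<^bsub>B\<^esub>),
     zero = (\<zero>\<^bsub>A\<^esub>, \<zero>\<^bsub>B\<^esub>),
     add = (\<lambda>(a, b) (a', b'). (a \<oplus>\<^bsub>A\<^esub> a', b \<oplus>\<^bsub>B\<^esub> b')),
     smult = (\<lambda>r (a, b). (r \<odot>\<^bsub>A\<^esub> a, r \<odot>\<^bsub>B\<^esub> b))\<rparr>"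


section \<open>Generators and relations\<close>

datatype ('r, 'g) lie_term =
    LGen 'g
  | LZero
  | LAdd "('r, 'g) lie_term" "('r, 'g) lie_term"
  | LSmult 'r "('r, 'g) lie_term"
  | LBracket "('r, 'g) lie_term" "('r, 'g) lie_term"

primrec lie_wf :: "('r, 'x) ring_scheme \<Rightarrow> 'g set \<Rightarrow> ('r, 'g) lie_term \<Rightarrow> bool" where
  "lie_wf R G (LGen g) \<longleftrightarrow> g \<in> G"
| "lie_wf R G LZero \<longleftrightarrow> True"
| "lie_wf R G (LAdd s t) \<longleftrightarrow> lie_wf R G s \<and> lie_wf R G t"
| "lie_wf R G (LSmult r t) \<longleftrightarrow> r \<in> carrier R \<and> lie_wf R G t"
| "lie_wf R G (LBracket s t) \<longleftrightarrow> lie_wf R G s \<and> lie_wf R G t"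

definition LNeg :: "('r, 'x) ring_scheme \<Rightarrow> ('r, 'g) lie_term \<Rightarrow> ('r, 'g) lie_term"
  where "LNeg R t = LSmult (\<ominus>\<^bsub>R\<^esub> \<one>\<^bsub>R\<^esub>) t"

definition LMinus :: "('r, 'x) ring_scheme \<Rightarrow> ('r, 'g) lie_term \<Rightarrow> ('r, 'g) lie_term \<Rightarrow> ('r, 'g) lie_term"
  where "LMinus R s t = LAdd s (LNeg R t)"

text \<open>The least congruence on the terms over the generators \<open>G\<close> that contains the relations \<open>E\<close> and
  the axioms of Lie algebras over \<open>R\<close>.\<close>

inductive lie_eq ::
  "('r, 'x) ring_scheme \<Rightarrow> 'g set \<Rightarrow> (('r, 'g) lie_term \<times> ('r, 'g) lie_term) set \<Rightarrow>
    ('r, 'g) lie_term \<Rightarrow> ('r, 'g) lie_term \<Rightarrow> bool"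
  for R :: "('r, 'x) ring_scheme" and G :: "'g set"
    and E :: "(('r, 'g) lie_term \<times> ('r, 'g) lie_term) set"
where
  rel: "\<lbrakk>(s, t) \<in> E; lie_wf R G s; lie_wf R G t\<rbrakk> \<Longrightarrow> lie_eq R G E s t"
| refl: "lie_wf R G t \<Longrightarrow> lie_eq R G E t t"
| sym: "lie_eq R G E s t \<Longrightarrow> lie_eq R G E t s"
| trans: "\<lbrakk>lie_eq R G E s t; lie_eq R G E t u\<rbrakk> \<Longrightarrow> lie_eq R G E s u"
| add_cong: "\<lbrakk>lie_eq R G E s s'; lie_eq R G E t t'\<rbrakk> \<Longrightarrow> lie_eq R G E (LAdd s t) (LAdd s' t')"
| smult_cong: "\<lbrakk>r \<in> carrier R; lie_eq R G E t t'\<rbrakk> \<Longrightarrow> lie_eq R G E (LSmult r t) (LSmult r t')"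
| bracket_cong:
    "\<lbrakk>lie_eq R G E s s'; lie_eq R G E t t'\<rbrakk> \<Longrightarrow> lie_eq R G E (LBracket s t) (LBracket s' t')"
| add_assoc: "\<lbrakk>lie_wf R G s; lie_wf R G t; lie_wf R G u\<rbrakk> \<Longrightarrow>
    lie_eq R G E (LAdd (LAdd s t) u) (LAdd s (LAdd t u))"
| add_comm: "\<lbrakk>lie_wf R G s; lie_wf R G t\<rbrakk> \<Longrightarrow> lie_eq R G E (LAdd s t) (LAdd t s)"
| add_zero: "lie_wf R G t \<Longrightarrow> lie_eq R G E (LAdd LZero t) t"
| add_neg: "lie_wf R G t \<Longrightarrow> lie_eq R G E (LAdd (LNeg R t) t) LZero"
| smult_add_l: "\<lbrakk>r \<in> carrier R; q \<in> carrier R; lie_wf R G t\<rbrakk> \<Longrightarrow>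
    lie_eq R G E (LSmult (r \<oplus>\<^bsub>R\<^esub> q) t) (LAdd (LSmult r t) (LSmult q t))"
| smult_add_r: "\<lbrakk>r \<in> carrier R; lie_wf R G s; lie_wf R G t\<rbrakk> \<Longrightarrow>
    lie_eq R G E (LSmult r (LAdd s t)) (LAdd (LSmult r s) (LSmult r t))"
| smult_assoc: "\<lbrakk>r \<in> carrier R; q \<in> carrier R; lie_wf R G t\<rbrakk> \<Longrightarrow>
    lie_eq R G E (LSmult (r \<otimes>\<^bsub>R\<^esub> q) t) (LSmult r (LSmult q t))"
| smult_one: "lie_wf R G t \<Longrightarrow> lie_eq R G E (LSmult \<one>\<^bsub>R\<^esub> t) t"
| bracket_add_l: "\<lbrakk>lie_wf R G s; lie_wf R G t; lie_wf R G u\<rbrakk> \<Longrightarrow>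
    lie_eq R G E (LBracket (LAdd s t) u) (LAdd (LBracket s u) (LBracket t u))"
| bracket_add_r: "\<lbrakk>lie_wf R G s; lie_wf R G t; lie_wf R G u\<rbrakk> \<Longrightarrow>
    lie_eq R G E (LBracket s (LAdd t u)) (LAdd (LBracket s t) (LBracket s u))"
| bracket_smult_l: "\<lbrakk>r \<in> carrier R; lie_wf R G s; lie_wf R G t\<rbrakk> \<Longrightarrow>
    lie_eq R G E (LBracket (LSmult r s) t) (LSmult r (LBracket s t))"
| bracket_smult_r: "\<lbrakk>r \<in> carrier R; lie_wf R G s; lie_wf R G t\<rbrakk> \<Longrightarrow>
    lie_eq R G E (LBracket s (LSmult r t)) (LSmult r (LBracket s t))"
| bracket_alternating: "lie_wf R G t \<Longrightarrow> lie_eq R G E (LBracket t t) LZero"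
| jacobi: "\<lbrakk>lie_wf R G s; lie_wf R G t; lie_wf R G u\<rbrakk> \<Longrightarrow>
    lie_eq R G E
      (LAdd (LAdd (LBracket s (LBracket t u)) (LBracket t (LBracket u s))) (LBracket u (LBracket s t)))
      LZero"

definition lie_class ::
  "('r, 'x) ring_scheme \<Rightarrow> 'g set \<Rightarrow> (('r, 'g) lie_term \<times> ('r, 'g) lie_term) set \<Rightarrow>
    ('r, 'g) lie_term \<Rightarrow> ('r, 'g) lie_term set"
  where "lie_class R G E t = {s. lie_eq R G E t s}"

definition lie_pres ::
  "('r, 'x) ring_scheme \<Rightarrow> 'g set \<Rightarrow> (('r, 'g) lie_term \<times> ('r, 'g) lie_term) set \<Rightarrow>
    ('r, ('r, 'g) lie_term set) module"
  where "lie_pres R G E =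
    \<lparr>carrier = lie_class R G E ` {t. lie_wf R G t},
     mult = (\<lambda>C D. \<Union>s\<in>C. \<Union>t\<in>D. lie_class R G E (LBracket s t)),
     one = lie_class R G E LZero,
     zero = lie_class R G E LZero,
     add = (\<lambda>C D. \<Union>s\<in>C. \<Union>t\<in>D. lie_class R G E (LAdd s t)),
     smult = (\<lambda>r C. \<Union>t\<in>C. lie_class R G E (LSmult r t))\<rparr>"

primrec lie_eval :: "('r, 'b, 'z) module_scheme \<Rightarrow> ('g \<Rightarrow> 'b) \<Rightarrow> ('r, 'g) lie_term \<Rightarrow> 'b" where
  "lie_eval B \<phi> (LGen g) = \<phi> g"
| "lie_eval B \<phi> LZero = \<zero>\<^bsub>B\<^esub>"
| "lie_eval B \<phi> (LAdd s t) = lie_eval B \<phi> s \<oplus>\<^bsub>B\<^esub> lie_eval B \<phi> t"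
| "lie_eval B \<phi> (LSmult r t) = r \<odot>\<^bsub>B\<^esub> lie_eval B \<phi> t"
| "lie_eval B \<phi> (LBracket s t) = lie_eval B \<phi> s \<otimes>\<^bsub>B\<^esub> lie_eval B \<phi> t"

text \<open>The morphism from a presented Lie algebra to \<open>B\<close> determined by its values on generators (which
  must respect the relations, so that evaluation is constant on classes).\<close>

definition lie_pres_lift ::
  "('r, 'b, 'z) module_scheme \<Rightarrow> ('g \<Rightarrow> 'b) \<Rightarrow> ('r, 'g) lie_term set \<Rightarrow> 'b"
  where "lie_pres_lift B \<phi> C = the_elem (lie_eval B \<phi> ` C)"


section \<open>Coproducts and pushouts\<close>

definition lie_coprod_rels ::
  "('r, 'x) ring_scheme \<Rightarrow> ('r, 'a, 'y) module_scheme \<Rightarrow> ('r, 'b, 'z) module_scheme \<Rightarrow>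
    (('r, 'a + 'b) lie_term \<times> ('r, 'a + 'b) lie_term) set"
  where "lie_coprod_rels R A B =
     {(LGen (Inl (x \<oplus>\<^bsub>A\<^esub> y)), LAdd (LGen (Inl x)) (LGen (Inl y))) | x y.
        x \<in> carrier A \<and> y \<in> carrier A}
   \<union> {(LGen (Inl (r \<odot>\<^bsub>A\<^esub> x)), LSmult r (LGen (Inl x))) | r x.
        r \<in> carrier R \<and> x \<in> carrier A}
   \<union> {(LGen (Inl (x \<otimes>\<^bsub>A\<^esub> y)), LBracket (LGen (Inl x)) (LGen (Inl y))) | x y.
        x \<in> carrier A \<and> y \<in> carrier A}
   \<union> {(LGen (Inr (x \<oplus>\<^bsub>B\<^esub> y)), LAdd (LGen (Inr x)) (LGen (Inr y))) | x y.
        x \<in> carrier B \<and> y \<in> carrier B}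
   \<union> {(LGen (Inr (r \<odot>\<^bsub>B\<^esub> x)), LSmult r (LGen (Inr x))) | r x.
        r \<in> carrier R \<and> x \<in> carrier B}
   \<union> {(LGen (Inr (x \<otimes>\<^bsub>B\<^esub> y)), LBracket (LGen (Inr x)) (LGen (Inr y))) | x y.
        x \<in> carrier B \<and> y \<in> carrier B}"

definition lie_coprod ::
  "('r, 'x) ring_scheme \<Rightarrow> ('r, 'a, 'y) module_scheme \<Rightarrow> ('r, 'b, 'z) module_scheme \<Rightarrow>
    ('r, ('r, 'a + 'b) lie_term set) module"
  where "lie_coprod R A B = lie_pres R (carrier A <+> carrier B) (lie_coprod_rels R A B)"

definition lie_pushout_rels ::
  "('r, 'x) ring_scheme \<Rightarrow> ('r, 'c, 'w) module_scheme \<Rightarrow> ('r, 'a, 'y) module_scheme \<Rightarrow>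
    ('r, 'b, 'z) module_scheme \<Rightarrow> ('c \<Rightarrow> 'a) \<Rightarrow> ('c \<Rightarrow> 'b) \<Rightarrow>
    (('r, 'a + 'b) lie_term \<times> ('r, 'a + 'b) lie_term) set"
  where "lie_pushout_rels R C A B f g =
    lie_coprod_rels R A B \<union> {(LGen (Inl (f c)), LGen (Inr (g c))) | c. c \<in> carrier C}"

text \<open>The pushout of \<open>f : C \<rightarrow> A\<close> and \<open>g : C \<rightarrow> B\<close> and its canonical morphisms.\<close>

definition lie_pushout ::
  "('r, 'x) ring_scheme \<Rightarrow> ('r, 'c, 'w) module_scheme \<Rightarrow> ('r, 'a, 'y) module_scheme \<Rightarrow>
    ('r, 'b, 'z) module_scheme \<Rightarrow> ('c \<Rightarrow> 'a) \<Rightarrow> ('c \<Rightarrow> 'b) \<Rightarrow> ('r, ('r, 'a + 'b) lie_term set) module"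
  where "lie_pushout R C A B f g =
    lie_pres R (carrier A <+> carrier B) (lie_pushout_rels R C A B f g)"

definition lie_pushout_inl ::
  "('r, 'x) ring_scheme \<Rightarrow> ('r, 'c, 'w) module_scheme \<Rightarrow> ('r, 'a, 'y) module_scheme \<Rightarrow>
    ('r, 'b, 'z) module_scheme \<Rightarrow> ('c \<Rightarrow> 'a) \<Rightarrow> ('c \<Rightarrow> 'b) \<Rightarrow> 'a \<Rightarrow> ('r, 'a + 'b) lie_term set"
  where "lie_pushout_inl R C A B f g a =
    lie_class R (carrier A <+> carrier B) (lie_pushout_rels R C A B f g) (LGen (Inl a))"

definition lie_pushout_inr ::
  "('r, 'x) ring_scheme \<Rightarrow> ('r, 'c, 'w) module_scheme \<Rightarrow> ('r, 'a, 'y) module_scheme \<Rightarrow>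
    ('r, 'b, 'z) module_scheme \<Rightarrow> ('c \<Rightarrow> 'a) \<Rightarrow> ('c \<Rightarrow> 'b) \<Rightarrow> 'b \<Rightarrow> ('r, 'a + 'b) lie_term set"
  where "lie_pushout_inr R C A B f g b =
    lie_class R (carrier A <+> carrier B) (lie_pushout_rels R C A B f g) (LGen (Inr b))"

text \<open>The morphism into \<open>D\<close> determined by its restrictions \<open>h\<close> and \<open>k\<close> to the two summands, both
  for coproducts and for pushouts.\<close>

definition lie_copair ::
  "('r, 'd, 'z) module_scheme \<Rightarrow> ('a \<Rightarrow> 'd) \<Rightarrow> ('b \<Rightarrow> 'd) \<Rightarrow> ('r, 'a + 'b) lie_term set \<Rightarrow> 'd"
  where "lie_copair D h k = lie_pres_lift D (case_sum h k)"


section \<open>Commutators\<close>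

definition lie_coprod_to_prod ::
  "('r, 'a, 'y) module_scheme \<Rightarrow> ('r, 'b, 'z) module_scheme \<Rightarrow> ('r, 'a + 'b) lie_term set \<Rightarrow> 'a \<times> 'b"
  where "lie_coprod_to_prod A B =
    lie_copair (lie_prod A B) (\<lambda>a. (a, \<zero>\<^bsub>B\<^esub>)) (\<lambda>b. (\<zero>\<^bsub>A\<^esub>, b))"

text \<open>The Higgins commutator of the subalgebras of \<open>X\<close> with carriers \<open>S\<close> and \<open>T\<close>.\<close>

definition higgins_commutator ::
  "('r, 'x) ring_scheme \<Rightarrow> ('r, 'a, 'y) module_scheme \<Rightarrow> 'a set \<Rightarrow> 'a set \<Rightarrow> 'a set"
  where "higgins_commutator R X S T =
    (let A = X\<lparr>carrier := S\<rparr>; B = X\<lparr>carrier := T\<rparr> in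
      lie_copair X (\<lambda>a. a) (\<lambda>b. b) `
        a_kernel (lie_coprod R A B) (lie_prod A B) (lie_coprod_to_prod A B))"

definition huq_commutator ::
  "('r, 'x) ring_scheme \<Rightarrow> ('r, 'a, 'y) module_scheme \<Rightarrow> 'a set \<Rightarrow> 'a set \<Rightarrow> 'a set"
  where "huq_commutator R X S T = lie_normal_closure R X (higgins_commutator R X S T)"


section \<open>Actions, crossed modules and their internal groupoids\<close>

locale lie_action = L?: lie_algebra R L + M?: lie_algebra R M
  for R (structure) and L (structure) and M (structure) and act :: "'l \<Rightarrow> 'm \<Rightarrow> 'm" +
  assumes act_closed: "\<lbrakk>l \<in> carrier L; m \<in> carrier M\<rbrakk> \<Longrightarrow> act l m \<in> carrier M"
    and act_add_l: "\<lbrakk>l \<in> carrier L; l' \<in> carrier L; m \<in> carrier M\<rbrakk> \<Longrightarrow>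
      act (l \<oplus>\<^bsub>L\<^esub> l') m = act l m \<oplus>\<^bsub>M\<^esub> act l' m"
    and act_add_r: "\<lbrakk>l \<in> carrier L; m \<in> carrier M; m' \<in> carrier M\<rbrakk> \<Longrightarrow>
      act l (m \<oplus>\<^bsub>M\<^esub> m') = act l m \<oplus>\<^bsub>M\<^esub> act l m'"
    and act_smult_l: "\<lbrakk>r \<in> carrier R; l \<in> carrier L; m \<in> carrier M\<rbrakk> \<Longrightarrow>
      act (r \<odot>\<^bsub>L\<^esub> l) m = r \<odot>\<^bsub>M\<^esub> act l m"
    and act_smult_r: "\<lbrakk>r \<in> carrier R; l \<in> carrier L; m \<in> carrier M\<rbrakk> \<Longrightarrow>
      act l (r \<odot>\<^bsub>M\<^esub> m) = r \<odot>\<^bsub>M\<^esub> act l m"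
    and act_bracket_l: "\<lbrakk>l \<in> carrier L; l' \<in> carrier L; m \<in> carrier M\<rbrakk> \<Longrightarrow>
      act (l \<otimes>\<^bsub>L\<^esub> l') m = act l (act l' m) \<ominus>\<^bsub>M\<^esub> act l' (act l m)"
    and act_bracket_r: "\<lbrakk>l \<in> carrier L; m \<in> carrier M; m' \<in> carrier M\<rbrakk> \<Longrightarrow>
      act l (m \<otimes>\<^bsub>M\<^esub> m') = (act l m \<otimes>\<^bsub>M\<^esub> m') \<oplus>\<^bsub>M\<^esub> (m \<otimes>\<^bsub>M\<^esub> act l m')"

locale lie_crossed_module = lie_action R L M act
  for R (structure) and L (structure) and M (structure) and act :: "'l \<Rightarrow> 'm \<Rightarrow> 'm" +
  fixes \<mu> :: "'m \<Rightarrow> 'l"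
  assumes boundary_hom: "\<mu> \<in> lie_hom R M L"
    and equivariance: "\<lbrakk>l \<in> carrier L; m \<in> carrier M\<rbrakk> \<Longrightarrow> \<mu> (act l m) = l \<otimes>\<^bsub>L\<^esub> \<mu> m"
    and peiffer: "\<lbrakk>m \<in> carrier M; m' \<in> carrier M\<rbrakk> \<Longrightarrow> act (\<mu> m) m' = m \<otimes>\<^bsub>M\<^esub> m'"

definition lie_semidirect ::
  "('r, 'm, 'y) module_scheme \<Rightarrow> ('r, 'l, 'z) module_scheme \<Rightarrow> ('l \<Rightarrow> 'm \<Rightarrow> 'm) \<Rightarrow> ('r, 'm \<times> 'l) module"
  where "lie_semidirect M L act =
    \<lparr>carrier = carrier M \<times> carrier L,
     mult = (\<lambda>(m, l) (m', l').
       ((m \<otimes>\<^bsub>M\<^esub> m') \<oplus>\<^bsub>M\<^esub> (act l m' \<ominus>\<^bsub>M\<^esub> act l' m), l \<otimes>\<^bsub>L\<^esub> l')),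
     one = (\<zero>\<^bsub>M\<^esub>, \<zero>\<^bsub>L\<^esub>),
     zero = (\<zero>\<^bsub>M\<^esub>, \<zero>\<^bsub>L\<^esub>),
     add = (\<lambda>(m, l) (m', l'). (m \<oplus>\<^bsub>M\<^esub> m', l \<oplus>\<^bsub>L\<^esub> l')),
     smult = (\<lambda>r (m, l). (r \<odot>\<^bsub>M\<^esub> m, r \<odot>\<^bsub>L\<^esub> l))\<rparr>"

definition gpd_dom :: "'m \<times> 'l \<Rightarrow> 'l"
  where "gpd_dom = snd"

definition gpd_cod :: "('r, 'l, 'z) module_scheme \<Rightarrow> ('m \<Rightarrow> 'l) \<Rightarrow> 'm \<times> 'l \<Rightarrow> 'l"
  where "gpd_cod L \<mu> = (\<lambda>(m, l). \<mu> m \<oplus>\<^bsub>L\<^esub> l)"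

definition gpd_id :: "('r, 'm, 'y) module_scheme \<Rightarrow> 'l \<Rightarrow> 'm \<times> 'l"
  where "gpd_id M l = (\<zero>\<^bsub>M\<^esub>, l)"


section \<open>The two tensor products\<close>

text \<open>Ellis' tensor product; \<open>actMN m n\<close> is the action of \<open>m\<close> on \<open>n\<close>, and \<open>actNM n m\<close> that of
  \<open>n\<close> on \<open>m\<close>.\<close>

definition lie_tensor_rels ::
  "('r, 'x) ring_scheme \<Rightarrow> ('r, 'm, 'y) module_scheme \<Rightarrow> ('r, 'n, 'z) module_scheme \<Rightarrow>
    ('m \<Rightarrow> 'n \<Rightarrow> 'n) \<Rightarrow> ('n \<Rightarrow> 'm \<Rightarrow> 'm) \<Rightarrow>
    (('r, 'm \<times> 'n) lie_term \<times> ('r, 'm \<times> 'n) lie_term) set"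
  where "lie_tensor_rels R M N actMN actNM =
     {(LGen (r \<odot>\<^bsub>M\<^esub> m, n), LSmult r (LGen (m, n))) | r m n.
        r \<in> carrier R \<and> m \<in> carrier M \<and> n \<in> carrier N}
   \<union> {(LGen (m, r \<odot>\<^bsub>N\<^esub> n), LSmult r (LGen (m, n))) | r m n.
        r \<in> carrier R \<and> m \<in> carrier M \<and> n \<in> carrier N}
   \<union> {(LGen (m \<oplus>\<^bsub>M\<^esub> m', n), LAdd (LGen (m, n)) (LGen (m', n))) | m m' n.
        m \<in> carrier M \<and> m' \<in> carrier M \<and> n \<in> carrier N}
   \<union> {(LGen (m, n \<oplus>\<^bsub>N\<^esub> n'), LAdd (LGen (m, n)) (LGen (m, n'))) | m n n'.
        m \<in> carrier M \<and> n \<in> carrier N \<and> n' \<in> carrier N}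
   \<union> {(LGen (m \<otimes>\<^bsub>M\<^esub> m', n), LMinus R (LGen (m, actMN m' n)) (LGen (m', actMN m n))) | m m' n.
        m \<in> carrier M \<and> m' \<in> carrier M \<and> n \<in> carrier N}
   \<union> {(LGen (m, n \<otimes>\<^bsub>N\<^esub> n'), LMinus R (LGen (actNM n' m, n)) (LGen (actNM n m, n'))) | m n n'.
        m \<in> carrier M \<and> n \<in> carrier N \<and> n' \<in> carrier N}
   \<union> {(LBracket (LGen (m, n)) (LGen (m', n')), LNeg R (LGen (actNM n m, actMN m' n'))) | m n m' n'.
        m \<in> carrier M \<and> n \<in> carrier N \<and> m' \<in> carrier M \<and> n' \<in> carrier N}"

definition lie_tensor ::
  "('r, 'x) ring_scheme \<Rightarrow> ('r, 'm, 'y) module_scheme \<Rightarrow> ('r, 'n, 'z) module_scheme \<Rightarrow>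
    ('m \<Rightarrow> 'n \<Rightarrow> 'n) \<Rightarrow> ('n \<Rightarrow> 'm \<Rightarrow> 'm) \<Rightarrow> ('r, ('r, 'm \<times> 'n) lie_term set) module"
  where "lie_tensor R M N actMN actNM =
    lie_pres R (carrier M \<times> carrier N) (lie_tensor_rels R M N actMN actNM)"

text \<open>In the following, \<open>actM\<close> and \<open>actN\<close> are the actions of \<open>L\<close> on \<open>M\<close> and on \<open>N\<close>.  The canonical
  morphisms into the pushout \<open>Q\<close> are \<open>lie_pushout_inl\<close> (the paper's \<open>e\<^sub>U\<close>) and \<open>lie_pushout_inr\<close>
  (the paper's \<open>e\<^sub>L\<close>), so that \<open>lie_copair\<close> takes first the composite with \<open>e\<^sub>U\<close>, then the one with
  \<open>e\<^sub>L\<close>.\<close>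

definition tensor_Q ::
  "('r, 'x) ring_scheme \<Rightarrow> ('r, 'l, 'w) module_scheme \<Rightarrow>
    ('r, 'm, 'y) module_scheme \<Rightarrow> ('l \<Rightarrow> 'm \<Rightarrow> 'm) \<Rightarrow> ('r, 'n, 'z) module_scheme \<Rightarrow> ('l \<Rightarrow> 'n \<Rightarrow> 'n) \<Rightarrow>
    ('r, ('r, 'm \<times> 'l + 'n \<times> 'l) lie_term set) module"
  where "tensor_Q R L M actM N actN =
    lie_pushout R L (lie_semidirect M L actM) (lie_semidirect N L actN) (gpd_id M) (gpd_id N)"

definition tensor_dU ::
  "('r, 'l, 'w) module_scheme \<Rightarrow> ('r, 'm, 'y) module_scheme \<Rightarrow> ('l \<Rightarrow> 'm \<Rightarrow> 'm) \<Rightarrow>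
    ('r, 'm \<times> 'l + 'n \<times> 'l) lie_term set \<Rightarrow> 'm \<times> 'l"
  where "tensor_dU L M actM =
    lie_copair (lie_semidirect M L actM) (\<lambda>u. u) (\<lambda>v. gpd_id M (gpd_dom v))"

definition tensor_cU ::
  "('r, 'l, 'w) module_scheme \<Rightarrow> ('r, 'm, 'y) module_scheme \<Rightarrow> ('l \<Rightarrow> 'm \<Rightarrow> 'm) \<Rightarrow> ('n \<Rightarrow> 'l) \<Rightarrow>
    ('r, 'm \<times> 'l + 'n \<times> 'l) lie_term set \<Rightarrow> 'm \<times> 'l"
  where "tensor_cU L M actM \<nu> =
    lie_copair (lie_semidirect M L actM) (\<lambda>u. u) (\<lambda>v. gpd_id M (gpd_cod L \<nu> v))"

definition tensor_dL ::
  "('r, 'l, 'w) module_scheme \<Rightarrow> ('r, 'n, 'z) module_scheme \<Rightarrow> ('l \<Rightarrow> 'n \<Rightarrow> 'n) \<Rightarrow>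
    ('r, 'm \<times> 'l + 'n \<times> 'l) lie_term set \<Rightarrow> 'n \<times> 'l"
  where "tensor_dL L N actN =
    lie_copair (lie_semidirect N L actN) (\<lambda>u. gpd_id N (gpd_dom u)) (\<lambda>v. v)"

definition tensor_cL ::
  "('r, 'l, 'w) module_scheme \<Rightarrow> ('r, 'n, 'z) module_scheme \<Rightarrow> ('l \<Rightarrow> 'n \<Rightarrow> 'n) \<Rightarrow> ('m \<Rightarrow> 'l) \<Rightarrow>
    ('r, 'm \<times> 'l + 'n \<times> 'l) lie_term set \<Rightarrow> 'n \<times> 'l"
  where "tensor_cL L N actN \<mu> =
    lie_copair (lie_semidirect N L actN) (\<lambda>u. gpd_id N (gpd_cod L \<mu> u)) (\<lambda>v. v)"

definition tensor_commutator ::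
  "('r, 'x) ring_scheme \<Rightarrow> ('r, 'l, 'w) module_scheme \<Rightarrow>
    ('r, 'm, 'y) module_scheme \<Rightarrow> ('l \<Rightarrow> 'm \<Rightarrow> 'm) \<Rightarrow> ('m \<Rightarrow> 'l) \<Rightarrow>
    ('r, 'n, 'z) module_scheme \<Rightarrow> ('l \<Rightarrow> 'n \<Rightarrow> 'n) \<Rightarrow> ('n \<Rightarrow> 'l) \<Rightarrow>
    ('r, 'm \<times> 'l + 'n \<times> 'l) lie_term set set"
  where "tensor_commutator R L M actM \<mu> N actN \<nu> =
    (let Q = tensor_Q R L M actM N actN;
         ML = lie_semidirect M L actM;
         NL = lie_semidirect N L actN in
      lie_join R Q
        (huq_commutator R Q (a_kernel Q NL (tensor_dL L N actN)) (a_kernel Q NL (tensor_cL L N actN \<mu>)))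
        (huq_commutator R Q (a_kernel Q ML (tensor_dU L M actM)) (a_kernel Q ML (tensor_cU L M actM \<nu>))))"

definition tensor_QMN ::
  "('r, 'x) ring_scheme \<Rightarrow> ('r, 'l, 'w) module_scheme \<Rightarrow>
    ('r, 'm, 'y) module_scheme \<Rightarrow> ('l \<Rightarrow> 'm \<Rightarrow> 'm) \<Rightarrow> ('m \<Rightarrow> 'l) \<Rightarrow>
    ('r, 'n, 'z) module_scheme \<Rightarrow> ('l \<Rightarrow> 'n \<Rightarrow> 'n) \<Rightarrow> ('n \<Rightarrow> 'l) \<Rightarrow>
    ('r, ('r, 'm \<times> 'l + 'n \<times> 'l) lie_term set set) module"
  where "tensor_QMN R L M actM \<mu> N actN \<nu> =
    lie_quot (tensor_Q R L M actM N actN) (tensor_commutator R L M actM \<mu> N actN \<nu>)"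

definition general_tensor ::
  "('r, 'x) ring_scheme \<Rightarrow> ('r, 'l, 'w) module_scheme \<Rightarrow>
    ('r, 'm, 'y) module_scheme \<Rightarrow> ('l \<Rightarrow> 'm \<Rightarrow> 'm) \<Rightarrow> ('m \<Rightarrow> 'l) \<Rightarrow>
    ('r, 'n, 'z) module_scheme \<Rightarrow> ('l \<Rightarrow> 'n \<Rightarrow> 'n) \<Rightarrow> ('n \<Rightarrow> 'l) \<Rightarrow>
    ('r, ('r, 'm \<times> 'l + 'n \<times> 'l) lie_term set set) module"
  where "general_tensor R L M actM \<mu> N actN \<nu> =
    (let QMN = tensor_QMN R L M actM \<mu> N actN \<nu> in
      QMN\<lparr>carrier :=
        a_kernel QMN (lie_semidirect M L actM) (lie_quot_lift (tensor_dU L M actM)) \<inter>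
        a_kernel QMN (lie_semidirect N L actN) (lie_quot_lift (tensor_dL L N actN))\<rparr>)"


section \<open>Universal properties of the constructions\<close>

lemma lie_homD:
  assumes "h \<in> lie_hom R A B"
  shows "h \<in> carrier A \<rightarrow> carrier B"
    "x \<in> carrier A \<Longrightarrow> y \<in> carrier A \<Longrightarrow> h (x \<oplus>\<^bsub>A\<^esub> y) = h x \<oplus>\<^bsub>B\<^esub> h y"
    "r \<in> carrier R \<Longrightarrow> x \<in> carrier A \<Longrightarrow> h (r \<odot>\<^bsub>A\<^esub> x) = r \<odot>\<^bsub>B\<^esub> h x"
    "x \<in> carrier A \<Longrightarrow> y \<in> carrier A \<Longrightarrow> h (x \<otimes>\<^bsub>A\<^esub> y) = h x \<otimes>\<^bsub>B\<^esub> h y"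
  using assms by (auto simp: lie_hom_def)

lemma lie_hom_zero:
  assumes "lie_algebra R A" "lie_algebra R B" "h \<in> lie_hom R A B"
  shows "h \<zero>\<^bsub>A\<^esub> = \<zero>\<^bsub>B\<^esub>"
proof -
  interpret A: lie_algebra R A by fact
  interpret B: lie_algebra R B by fact
  have "h (\<zero>\<^bsub>R\<^esub> \<odot>\<^bsub>A\<^esub> \<zero>\<^bsub>A\<^esub>) = \<zero>\<^bsub>R\<^esub> \<odot>\<^bsub>B\<^esub> h \<zero>\<^bsub>A\<^esub>"
    by (rule lie_homD[OF assms(3)]) auto
  moreover have "h \<zero>\<^bsub>A\<^esub> \<in> carrier B" using lie_homD(1)[OF assms(3)] by auto
  ultimately show ?thesis by simp
qed

lemma UN2_const:
  "\<lbrakk>x \<in> A; y \<in> B; \<And>x y. \<lbrakk>x \<in> A; y \<in> B\<rbrakk> \<Longrightarrow> f x y = c\<rbrakk> \<Longrightarrow> (\<Union>x\<in>A. \<Union>y\<in>B. f x y) = c"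
  by blast

lemma image_const: "\<lbrakk>x \<in> A; \<And>c. c \<in> A \<Longrightarrow> h c = d\<rbrakk> \<Longrightarrow> h ` A = {d}"
  by blast

lemma lie_eq_wf:
  assumes "lie_eq R G E s t" "cring R"
  shows "lie_wf R G s \<and> lie_wf R G t"
proof -
  interpret cring R by fact
  show ?thesis using assms(1) by (induction) (auto simp: LNeg_def)
qed

lemma lie_class_cong:
  assumes "lie_eq R G E s t"
  shows "lie_class R G E s = lie_class R G E t"
proof -
  have "lie_eq R G E s u \<longleftrightarrow> lie_eq R G E t u" for u
    using lie_eq.trans[OF assms, of u] lie_eq.trans[OF lie_eq.sym[OF assms], of u] by blast
  then show ?thesis by (simp add: lie_class_def)
qed

lemma lie_class_eq_iff:
  assumes "lie_wf R G t"
  shows "lie_class R G E s = lie_class R G E t \<longleftrightarrow> lie_eq R G E s t"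
proof
  assume "lie_class R G E s = lie_class R G E t"
  then show "lie_eq R G E s t"
    using lie_eq.refl[OF assms, of E] by (simp add: lie_class_def set_eq_iff)
qed (rule lie_class_cong)

lemma lie_class_self: "lie_wf R G t \<Longrightarrow> t \<in> lie_class R G E t"
  by (simp add: lie_class_def lie_eq.refl)

context
  fixes R :: "('r, 'x) ring_scheme" and G :: "'g set"
    and E :: "(('r, 'g) lie_term \<times> ('r, 'g) lie_term) set"
  assumes R: "cring R"
begin

lemma lie_pres_add:
  assumes "lie_wf R G s" "lie_wf R G t"
  shows "lie_class R G E s \<oplus>\<^bsub>lie_pres R G E\<^esub> lie_class R G E t = lie_class R G E (LAdd s t)"
proof -
  have "lie_class R G E (LAdd s' t') = lie_class R G E (LAdd s t)" if "s' \<in> lie_class R G E s" "t' \<in> lie_class R G E t" for s' t'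
    using that assms
    by (intro lie_class_cong[OF lie_eq.sym] lie_eq.add_cong) (simp_all add: lie_class_def)
  then have "(\<Union>s'\<in>lie_class R G E s. \<Union>t'\<in>lie_class R G E t. lie_class R G E (LAdd s' t')) = lie_class R G E (LAdd s t)"
    by (intro UN2_const[of s _ t] lie_class_self assms)
  then show ?thesis by (simp add: lie_pres_def)
qed

lemma lie_pres_bracket:
  assumes "lie_wf R G s" "lie_wf R G t"
  shows "lie_class R G E s \<otimes>\<^bsub>lie_pres R G E\<^esub> lie_class R G E t = lie_class R G E (LBracket s t)"
proof -
  have "lie_class R G E (LBracket s' t') = lie_class R G E (LBracket s t)" if "s' \<in> lie_class R G E s" "t' \<in> lie_class R G E t" for s' t'
    using that assms
    by (intro lie_class_cong[OF lie_eq.sym] lie_eq.bracket_cong) (simp_all add: lie_class_def)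
  then have "(\<Union>s'\<in>lie_class R G E s. \<Union>t'\<in>lie_class R G E t. lie_class R G E (LBracket s' t')) = lie_class R G E (LBracket s t)"
    by (intro UN2_const[of s _ t] lie_class_self assms)
  then show ?thesis by (simp add: lie_pres_def)
qed

lemma lie_pres_smult:
  assumes "r \<in> carrier R" "lie_wf R G t"
  shows "r \<odot>\<^bsub>lie_pres R G E\<^esub> lie_class R G E t = lie_class R G E (LSmult r t)"
proof -
  have "lie_class R G E (LSmult r t') = lie_class R G E (LSmult r t)" if "t' \<in> lie_class R G E t" for t'
    using that assms
    by (intro lie_class_cong[OF lie_eq.sym] lie_eq.smult_cong) (simp_all add: lie_class_def)
  moreover have "t \<in> lie_class R G E t" by (rule lie_class_self) (rule assms)
  ultimately have "(\<Union>t'\<in>lie_class R G E t. lie_class R G E (LSmult r t')) = lie_class R G E (LSmult r t)"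
    by blast
  then show ?thesis by (simp add: lie_pres_def)
qed

lemma lie_pres_zero: "\<zero>\<^bsub>lie_pres R G E\<^esub> = lie_class R G E LZero"
  by (simp add: lie_pres_def)

lemma lie_pres_carrier: "carrier (lie_pres R G E) = lie_class R G E ` {t. lie_wf R G t}"
  by (simp add: lie_pres_def)

lemma lie_pres_lie_algebra: "lie_algebra R (lie_pres R G E)"
proof -
  interpret R: cring R by (rule R)
  let ?P = "lie_pres R G E"
  note ops = lie_pres_add lie_pres_bracket lie_pres_smult lie_pres_zero
  have ab: "abelian_group ?P"
  proof (rule abelian_groupI)
    fix x y assume "x \<in> carrier ?P" "y \<in> carrier ?P"
    then obtain s t where "lie_wf R G s" "x = lie_class R G E s" "lie_wf R G t" "y = lie_class R G E t"
      by (auto simp: lie_pres_carrier)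
    then show "x \<oplus>\<^bsub>?P\<^esub> y = y \<oplus>\<^bsub>?P\<^esub> x"
      by (simp add: ops lie_class_cong[OF lie_eq.add_comm[of R G s t]])
  next
    fix x assume "x \<in> carrier ?P"
    then obtain t where t: "lie_wf R G t" "x = lie_class R G E t" by (auto simp: lie_pres_carrier)
    have w: "lie_wf R G (LNeg R t)" using t by (simp add: LNeg_def)
    then show "\<exists>y\<in>carrier ?P. y \<oplus>\<^bsub>?P\<^esub> x = \<zero>\<^bsub>?P\<^esub>"
      by (intro bexI[of _ "lie_class R G E (LNeg R t)"])
         (auto simp: lie_pres_carrier t ops intro!: lie_class_cong intro: lie_eq.add_neg)
  qed (auto simp: lie_pres_carrier ops
      lie_class_cong[OF lie_eq.add_assoc] lie_class_cong[OF lie_eq.add_zero])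
  note [simp] = lie_eq.smult_add_l[THEN lie_class_cong] lie_eq.smult_add_r[THEN lie_class_cong]
    lie_eq.smult_assoc[THEN lie_class_cong] lie_eq.smult_one[THEN lie_class_cong]
    lie_eq.bracket_add_l[THEN lie_class_cong] lie_eq.bracket_add_r[THEN lie_class_cong]
    lie_eq.bracket_smult_l[THEN lie_class_cong] lie_eq.bracket_smult_r[THEN lie_class_cong]
    lie_eq.bracket_alternating[THEN lie_class_cong] lie_eq.jacobi[THEN lie_class_cong]
  have "module R ?P"
    by (rule moduleI[OF R ab]) (auto simp: lie_pres_carrier ops)
  then show ?thesis
    by (intro lie_algebra.intro lie_algebra_axioms.intro) (auto simp: lie_pres_carrier ops)
qed

lemma lie_pres_rel:
  assumes "(s, t) \<in> E" "lie_wf R G s" "lie_wf R G t"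
  shows "lie_class R G E s = lie_class R G E t"
  using assms by (simp add: lie_class_eq_iff lie_eq.rel)

context
  fixes B :: "('r, 'b, 'z) module_scheme" and \<phi> :: "'g \<Rightarrow> 'b"
  assumes B: "lie_algebra R B"
    and gen: "\<And>g. g \<in> G \<Longrightarrow> \<phi> g \<in> carrier B"
begin

lemma lie_eval_closed: "lie_wf R G t \<Longrightarrow> lie_eval B \<phi> t \<in> carrier B"
proof -
  interpret B: lie_algebra R B by (rule B)
  show "lie_wf R G t \<Longrightarrow> lie_eval B \<phi> t \<in> carrier B"
    by (induction t) (auto simp: gen)
qed

context
  assumes rels: "\<And>s t. \<lbrakk>(s, t) \<in> E; lie_wf R G s; lie_wf R G t\<rbrakk> \<Longrightarrow> lie_eval B \<phi> s = lie_eval B \<phi> t"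
begin

lemma lie_eval_eq:
  assumes "lie_eq R G E s t"
  shows "lie_eval B \<phi> s = lie_eval B \<phi> t"
proof -
  interpret B: lie_algebra R B by (rule B)
  note ev = lie_eval_closed
  show ?thesis using assms
  proof induction
    case (add_neg t)
    then show ?case
      using ev[of t] by (simp add: LNeg_def B.smult_l_minus B.M.l_neg)
  next
    case (add_assoc s t u)
    then show ?case using ev by (simp add: B.M.a_assoc)
  next
    case (jacobi s t u)
    then show ?case using ev by (simp add: B.jacobi)
  qed (auto simp: rels ev B.M.a_comm B.smult_l_distr B.smult_r_distr
      B.smult_assoc1 B.bracket_add_l B.bracket_add_r B.bracket_smult_l B.bracket_smult_r
      B.bracket_alternating)
qed

lemma lie_pres_lift_class:
  assumes "lie_wf R G t"
  shows "lie_pres_lift B \<phi> (lie_class R G E t) = lie_eval B \<phi> t"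
proof -
  have "lie_eval B \<phi> ` lie_class R G E t = {lie_eval B \<phi> t}"
  proof
    show "lie_eval B \<phi> ` lie_class R G E t \<subseteq> {lie_eval B \<phi> t}"
      using lie_eval_eq[of t] by (auto simp: lie_class_def)
    show "{lie_eval B \<phi> t} \<subseteq> lie_eval B \<phi> ` lie_class R G E t"
      using lie_class_self[OF assms, of E] by blast
  qed
  then show ?thesis by (simp add: lie_pres_lift_def)
qed

lemma lie_pres_lift_hom: "lie_pres_lift B \<phi> \<in> lie_hom R (lie_pres R G E) B"
  unfolding lie_hom_def
  by (auto simp: lie_pres_carrier lie_pres_add lie_pres_bracket lie_pres_smult
      lie_pres_lift_class lie_eval_closed)

lemma lie_pres_lift_gen: "g \<in> G \<Longrightarrow> lie_pres_lift B \<phi> (lie_class R G E (LGen g)) = \<phi> g"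
  by (simp add: lie_pres_lift_class)

lemma lie_pres_lift_unique:
  assumes h: "h \<in> lie_hom R (lie_pres R G E) B"
    and g: "\<And>g. g \<in> G \<Longrightarrow> h (lie_class R G E (LGen g)) = \<phi> g"
    and C: "C \<in> carrier (lie_pres R G E)"
  shows "h C = lie_pres_lift B \<phi> C"
proof -
  interpret B: lie_algebra R B by (rule B)
  interpret P: lie_algebra R "lie_pres R G E" by (rule lie_pres_lie_algebra)
  have h0: "h (lie_class R G E LZero) = \<zero>\<^bsub>B\<^esub>"
    using lie_hom_zero[OF lie_pres_lie_algebra B h] by (simp add: lie_pres_zero)
  have "h (lie_class R G E t) = lie_eval B \<phi> t" if "lie_wf R G t" for t
    using that
  proof (induction t)
    case (LAdd s t)
    then have "h (lie_class R G E s \<oplus>\<^bsub>lie_pres R G E\<^esub> lie_class R G E t) = h (lie_class R G E s) \<oplus>\<^bsub>B\<^esub> h (lie_class R G E t)"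
      using h by (auto simp: lie_hom_def lie_pres_carrier)
    then show ?case using LAdd by (simp add: lie_pres_add)
  next
    case (LSmult r t)
    then have "h (r \<odot>\<^bsub>lie_pres R G E\<^esub> lie_class R G E t) = r \<odot>\<^bsub>B\<^esub> h (lie_class R G E t)"
      using h by (auto simp: lie_hom_def lie_pres_carrier)
    then show ?case using LSmult by (simp add: lie_pres_smult)
  next
    case (LBracket s t)
    then have "h (lie_class R G E s \<otimes>\<^bsub>lie_pres R G E\<^esub> lie_class R G E t) = h (lie_class R G E s) \<otimes>\<^bsub>B\<^esub> h (lie_class R G E t)"
      using h by (auto simp: lie_hom_def lie_pres_carrier)
    then show ?case using LBracket by (simp add: lie_pres_bracket)
  qed (auto simp: g h0)
  then show ?thesis using C by (auto simp: lie_pres_carrier lie_pres_lift_class)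
qed

end
end
end


theorem lie_pushout_universal:
  assumes A: "lie_algebra R A" and B: "lie_algebra R B"
    and f: "f \<in> carrier C \<rightarrow> carrier A" and g: "g \<in> carrier C \<rightarrow> carrier B"
  defines "Q \<equiv> lie_pushout R C A B f g"
    and "i \<equiv> lie_pushout_inl R C A B f g" and "j \<equiv> lie_pushout_inr R C A B f g"
  shows "lie_algebra R Q" "i \<in> lie_hom R A Q" "j \<in> lie_hom R B Q"
    and "c \<in> carrier C \<Longrightarrow> i (f c) = j (g c)"
    and "\<And>D h k. \<lbrakk>lie_algebra R D; h \<in> lie_hom R A D; k \<in> lie_hom R B D;
        \<And>c. c \<in> carrier C \<Longrightarrow> h (f c) = k (g c)\<rbrakk> \<Longrightarrow>
      lie_copair D h k \<in> lie_hom R Q D \<and>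
      (\<forall>a\<in>carrier A. lie_copair D h k (i a) = h a) \<and> (\<forall>b\<in>carrier B. lie_copair D h k (j b) = k b) \<and>
      (\<forall>u\<in>lie_hom R Q D. (\<forall>a\<in>carrier A. u (i a) = h a) \<and> (\<forall>b\<in>carrier B. u (j b) = k b) \<longrightarrow>
        (\<forall>x\<in>carrier Q. u x = lie_copair D h k x))"
proof -
  interpret A: lie_algebra R A by (rule A)
  interpret B: lie_algebra R B by (rule B)
  have R: "cring R" by (rule A.is_cring)
  let ?G = "carrier A <+> carrier B" and ?E = "lie_pushout_rels R C A B f g"
  have Q: "Q = lie_pres R ?G ?E" by (simp add: Q_def lie_pushout_def)
  show "lie_algebra R Q" unfolding Q by (rule lie_pres_lie_algebra[OF R])
  note ops = lie_pres_add[OF R] lie_pres_bracket[OF R] lie_pres_smult[OF R] lie_pres_carrier[OF R]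
  have Ei: "(LGen (Inl (x \<oplus>\<^bsub>A\<^esub> y)), LAdd (LGen (Inl x)) (LGen (Inl y))) \<in> ?E"
      "(LGen (Inl (x \<otimes>\<^bsub>A\<^esub> y)), LBracket (LGen (Inl x)) (LGen (Inl y))) \<in> ?E"
    if "x \<in> carrier A" "y \<in> carrier A" for x y
    using that unfolding lie_pushout_rels_def lie_coprod_rels_def by blast+
  have Ei': "(LGen (Inl (r \<odot>\<^bsub>A\<^esub> x)), LSmult r (LGen (Inl x))) \<in> ?E"
    if "r \<in> carrier R" "x \<in> carrier A" for r x
    using that unfolding lie_pushout_rels_def lie_coprod_rels_def by blast
  show "i \<in> lie_hom R A Q"
    unfolding lie_hom_def Q i_def lie_pushout_inl_def
    by (auto simp: ops InlI InrI Ei[THEN lie_pres_rel[OF R]] Ei'[THEN lie_pres_rel[OF R]])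
  have Ej: "(LGen (Inr (x \<oplus>\<^bsub>B\<^esub> y)), LAdd (LGen (Inr x)) (LGen (Inr y))) \<in> ?E"
      "(LGen (Inr (x \<otimes>\<^bsub>B\<^esub> y)), LBracket (LGen (Inr x)) (LGen (Inr y))) \<in> ?E"
    if "x \<in> carrier B" "y \<in> carrier B" for x y
    using that unfolding lie_pushout_rels_def lie_coprod_rels_def by blast+
  have Ej': "(LGen (Inr (r \<odot>\<^bsub>B\<^esub> x)), LSmult r (LGen (Inr x))) \<in> ?E"
    if "r \<in> carrier R" "x \<in> carrier B" for r x
    using that unfolding lie_pushout_rels_def lie_coprod_rels_def by blast
  show "j \<in> lie_hom R B Q"
    unfolding lie_hom_def Q j_def lie_pushout_inr_def
    by (auto simp: ops InlI InrI Ej[THEN lie_pres_rel[OF R]] Ej'[THEN lie_pres_rel[OF R]])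
  show "c \<in> carrier C \<Longrightarrow> i (f c) = j (g c)"
    using f g unfolding i_def j_def lie_pushout_inl_def lie_pushout_inr_def
    by (intro lie_pres_rel[OF R]) (auto simp: lie_pushout_rels_def)
  fix D :: "('a, 'z, 'zz) module_scheme" and h k
  assume D: "lie_algebra R D" and h: "h \<in> lie_hom R A D" and k: "k \<in> lie_hom R B D"
    and hk: "\<And>c. c \<in> carrier C \<Longrightarrow> h (f c) = k (g c)"
  have gen: "case_sum h k x \<in> carrier D" if "x \<in> ?G" for x
    using that h k by (auto simp: lie_hom_def)
  have rels: "lie_eval D (case_sum h k) s = lie_eval D (case_sum h k) t" if "(s, t) \<in> ?E" for s t
    using that hk
    by (auto simp: lie_pushout_rels_def lie_coprod_rels_def lie_homD[OF h] lie_homD[OF k])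
  have 1: "lie_copair D h k \<in> lie_hom R Q D"
    unfolding Q lie_copair_def by (rule lie_pres_lift_hom[OF R D gen rels])
  have 2: "lie_copair D h k (i a) = h a" if "a \<in> carrier A" for a
    unfolding i_def lie_pushout_inl_def lie_copair_def
    using lie_pres_lift_gen[OF R D gen rels, where g = "Inl a"] that by auto
  have 3: "lie_copair D h k (j b) = k b" if "b \<in> carrier B" for b
    unfolding j_def lie_pushout_inr_def lie_copair_def
    using lie_pres_lift_gen[OF R D gen rels, where g = "Inr b"] that by auto
  have 4: "u x = lie_copair D h k x" if "u \<in> lie_hom R Q D" "x \<in> carrier Q"
      "\<forall>a\<in>carrier A. u (i a) = h a" "\<forall>b\<in>carrier B. u (j b) = k b" for u x
    unfolding lie_copair_def
    using that unfolding Q i_def j_def lie_pushout_inl_def lie_pushout_inr_def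
    by (intro lie_pres_lift_unique[OF R D gen rels]) auto
  show "lie_copair D h k \<in> lie_hom R Q D \<and>
      (\<forall>a\<in>carrier A. lie_copair D h k (i a) = h a) \<and> (\<forall>b\<in>carrier B. lie_copair D h k (j b) = k b) \<and>
      (\<forall>u\<in>lie_hom R Q D. (\<forall>a\<in>carrier A. u (i a) = h a) \<and> (\<forall>b\<in>carrier B. u (j b) = k b) \<longrightarrow>
        (\<forall>x\<in>carrier Q. u x = lie_copair D h k x))"
    using 1 2 3 4 by blast
qed


lemma a_kernel_lie_ideal:
  assumes "lie_algebra R A" "lie_algebra R B" "h \<in> lie_hom R A B"
  shows "lie_ideal (a_kernel A B h) R A"
proof -
  interpret A: lie_algebra R A by fact
  interpret B: lie_algebra R B by fact
  note h = lie_homD[OF assms(3)]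
  have hc: "h x \<in> carrier B" if "x \<in> carrier A" for x using h(1) that by auto
  have br0: "y \<otimes>\<^bsub>B\<^esub> \<zero>\<^bsub>B\<^esub> = \<zero>\<^bsub>B\<^esub>" if "y \<in> carrier B" for y
    using B.bracket_smult_r[of "\<zero>\<^bsub>R\<^esub>" y "\<zero>\<^bsub>B\<^esub>"] that by simp
  have neg: "h (\<ominus>\<^bsub>A\<^esub> x) = \<zero>\<^bsub>B\<^esub>" if "x \<in> carrier A" "h x = \<zero>\<^bsub>B\<^esub>" for x
    using h(2)[of "\<ominus>\<^bsub>A\<^esub> x" x] that lie_hom_zero[OF assms] hc[of "\<ominus>\<^bsub>A\<^esub> x"]
    by (simp add: A.M.l_neg)
  have "submodule (a_kernel A B h) R A"
    by (rule A.submoduleI) (auto simp: a_kernel_def kernel_def h(2,3) lie_hom_zero[OF assms] neg)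
  then show ?thesis
    by (auto simp: lie_ideal_def a_kernel_def kernel_def h(4) hc br0)
qed

lemma lie_ideal_quot:
  assumes A: "lie_algebra R A" and I: "lie_ideal I R A"
  shows "lie_algebra R (lie_quot A I)"
    and "(+>\<^bsub>A\<^esub>) I \<in> lie_hom R A (lie_quot A I)"
    and "a_kernel A (lie_quot A I) ((+>\<^bsub>A\<^esub>) I) = I"
    and "\<And>B h. \<lbrakk>lie_algebra R B; h \<in> lie_hom R A B; \<And>x. x \<in> I \<Longrightarrow> h x = \<zero>\<^bsub>B\<^esub>\<rbrakk> \<Longrightarrow>
      lie_quot_lift h \<in> lie_hom R (lie_quot A I) B \<and>
      (\<forall>x\<in>carrier A. lie_quot_lift h (I +>\<^bsub>A\<^esub> x) = h x)"
proof -
  interpret A: lie_algebra R A by fact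
  let ?Q = "lie_quot A I"
  have sub: "submodule I R A" using I by (simp add: lie_ideal_def)
  interpret S: submodule I R A by (rule sub)
  have AI: "x \<otimes>\<^bsub>A\<^esub> y \<in> I" if "x \<in> carrier A" "y \<in> I" for x y using that I by (simp add: lie_ideal_def)
  have Ic: "x \<in> carrier A" if "x \<in> I" for x using that S.subset by auto
  have anti: "x \<otimes>\<^bsub>A\<^esub> y = \<ominus>\<^bsub>A\<^esub> (y \<otimes>\<^bsub>A\<^esub> x)" if "x \<in> carrier A" "y \<in> carrier A" for x y
  proof -
    have "(x \<oplus>\<^bsub>A\<^esub> y) \<otimes>\<^bsub>A\<^esub> (x \<oplus>\<^bsub>A\<^esub> y) = \<zero>\<^bsub>A\<^esub>" using that by (intro A.bracket_alternating) auto
    moreover have "(x \<oplus>\<^bsub>A\<^esub> y) \<otimes>\<^bsub>A\<^esub> (x \<oplus>\<^bsub>A\<^esub> y) = (x \<otimes>\<^bsub>A\<^esub> y) \<oplus>\<^bsub>A\<^esub> (y \<otimes>\<^bsub>A\<^esub> x)"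
      using that A.bracket_alternating[of x] A.bracket_alternating[of y]
      by (simp add: A.bracket_add_l A.bracket_add_r A.M.a_comm)
    ultimately have "(x \<otimes>\<^bsub>A\<^esub> y) \<oplus>\<^bsub>A\<^esub> (y \<otimes>\<^bsub>A\<^esub> x) = \<zero>\<^bsub>A\<^esub>" by simp
    then show ?thesis using that by (metis A.M.minus_equality A.bracket_closed A.M.a_comm)
  qed
  have IA: "y \<otimes>\<^bsub>A\<^esub> x \<in> I" if "x \<in> carrier A" "y \<in> I" for x y
    using that AI Ic A.submoduleE(3)[OF sub] by (subst anti) auto
  interpret AS: abelian_subgroup I A
    by (rule abelian_subgroupI3)
       (use S.subgroup_axioms A.M.abelian_group_axioms in \<open>auto simp: additive_subgroup_def\<close>)
  have brx: "rcoset_mult A I (I +>\<^bsub>A\<^esub> x) (I +>\<^bsub>A\<^esub> y) = I +>\<^bsub>A\<^esub> (x \<otimes>\<^bsub>A\<^esub> y)"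
    if xy: "x \<in> carrier A" "y \<in> carrier A" for x y
  proof -
    have "I +>\<^bsub>A\<^esub> (a \<otimes>\<^bsub>A\<^esub> b) = I +>\<^bsub>A\<^esub> (x \<otimes>\<^bsub>A\<^esub> y)" if a: "a \<in> I +>\<^bsub>A\<^esub> x" and b: "b \<in> I +>\<^bsub>A\<^esub> y" for a b
    proof -
      obtain i where i: "i \<in> I" "a = i \<oplus>\<^bsub>A\<^esub> x" using a by (auto simp: a_r_coset_def r_coset_def)
      obtain j where j: "j \<in> I" "b = j \<oplus>\<^bsub>A\<^esub> y" using b by (auto simp: a_r_coset_def r_coset_def)
      have c: "i \<in> carrier A" "j \<in> carrier A" using i j Ic by auto
      have "a \<otimes>\<^bsub>A\<^esub> b = (i \<otimes>\<^bsub>A\<^esub> b \<oplus>\<^bsub>A\<^esub> x \<otimes>\<^bsub>A\<^esub> j) \<oplus>\<^bsub>A\<^esub> x \<otimes>\<^bsub>A\<^esub> y"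
        using c xy by (simp add: i j A.bracket_add_l A.bracket_add_r A.M.a_ac)
      moreover have "i \<otimes>\<^bsub>A\<^esub> b \<oplus>\<^bsub>A\<^esub> x \<otimes>\<^bsub>A\<^esub> j \<in> I"
        using i(1) j(1) xy c by (intro A.submoduleE(5)[OF sub] IA AI) (auto simp: j)
      ultimately have "a \<otimes>\<^bsub>A\<^esub> b \<in> I +>\<^bsub>A\<^esub> (x \<otimes>\<^bsub>A\<^esub> y)"
        by (auto simp: a_r_coset_def r_coset_def)
      then show ?thesis using xy by (intro AS.a_repr_independence'[symmetric]) auto
    qed
    moreover have "x \<in> I +>\<^bsub>A\<^esub> x" "y \<in> I +>\<^bsub>A\<^esub> y" using xy AS.a_rcos_self by auto
    ultimately show ?thesis unfolding rcoset_mult_def by blast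
  qed
  have sm: "(\<Union>c\<in>I +>\<^bsub>A\<^esub> x. I +>\<^bsub>A\<^esub> (r \<odot>\<^bsub>A\<^esub> c)) = I +>\<^bsub>A\<^esub> (r \<odot>\<^bsub>A\<^esub> x)"
    if r: "r \<in> carrier R" "x \<in> carrier A" for r x
  proof -
    have "I +>\<^bsub>A\<^esub> (r \<odot>\<^bsub>A\<^esub> c) = I +>\<^bsub>A\<^esub> (r \<odot>\<^bsub>A\<^esub> x)" if c: "c \<in> I +>\<^bsub>A\<^esub> x" for c
    proof -
      obtain i where i: "i \<in> I" "c = i \<oplus>\<^bsub>A\<^esub> x" using c by (auto simp: a_r_coset_def r_coset_def)
      have "r \<odot>\<^bsub>A\<^esub> c = r \<odot>\<^bsub>A\<^esub> i \<oplus>\<^bsub>A\<^esub> r \<odot>\<^bsub>A\<^esub> x" using r i Ic by (simp add: A.smult_r_distr)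
      moreover have "r \<odot>\<^bsub>A\<^esub> i \<in> I" using r i by simp
      ultimately have "r \<odot>\<^bsub>A\<^esub> c \<in> I +>\<^bsub>A\<^esub> (r \<odot>\<^bsub>A\<^esub> x)"
        by (auto simp: a_r_coset_def r_coset_def)
      then show ?thesis using r by (intro AS.a_repr_independence'[symmetric]) auto
    qed
    moreover have "x \<in> I +>\<^bsub>A\<^esub> x" using r AS.a_rcos_self by auto
    ultimately show ?thesis by blast
  qed
  have Q: "carrier ?Q = (+>\<^bsub>A\<^esub>) I ` carrier A" "\<zero>\<^bsub>?Q\<^esub> = I"
    "\<And>x y. x \<in> carrier A \<Longrightarrow> y \<in> carrier A \<Longrightarrow> (I +>\<^bsub>A\<^esub> x) \<oplus>\<^bsub>?Q\<^esub> (I +>\<^bsub>A\<^esub> y) = I +>\<^bsub>A\<^esub> (x \<oplus>\<^bsub>A\<^esub> y)"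
    "\<And>x y. x \<in> carrier A \<Longrightarrow> y \<in> carrier A \<Longrightarrow> (I +>\<^bsub>A\<^esub> x) \<otimes>\<^bsub>?Q\<^esub> (I +>\<^bsub>A\<^esub> y) = I +>\<^bsub>A\<^esub> (x \<otimes>\<^bsub>A\<^esub> y)"
    "\<And>r x. r \<in> carrier R \<Longrightarrow> x \<in> carrier A \<Longrightarrow> r \<odot>\<^bsub>?Q\<^esub> (I +>\<^bsub>A\<^esub> x) = I +>\<^bsub>A\<^esub> (r \<odot>\<^bsub>A\<^esub> x)"
    by (auto simp: lie_quot_def A_RCOSETS_def RCOSETS_def a_r_coset_def[symmetric] brx sm AS.a_rcos_sum)
  have I0: "I = I +>\<^bsub>A\<^esub> \<zero>\<^bsub>A\<^esub>" using S.subset by simp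
  have Q0: "\<zero>\<^bsub>?Q\<^esub> = I +>\<^bsub>A\<^esub> \<zero>\<^bsub>A\<^esub>" using I0 Q(2) by simp
  note ops = Q(1) Q0 Q(3-5)
  have ab: "abelian_group ?Q"
  proof (rule abelian_groupI)
    fix X assume "X \<in> carrier ?Q"
    then obtain x where x: "x \<in> carrier A" "X = I +>\<^bsub>A\<^esub> x" by (auto simp: Q)
    then show "\<exists>Y\<in>carrier ?Q. Y \<oplus>\<^bsub>?Q\<^esub> X = \<zero>\<^bsub>?Q\<^esub>"
      by (intro bexI[of _ "I +>\<^bsub>A\<^esub> (\<ominus>\<^bsub>A\<^esub> x)"]) (simp_all add: ops A.M.l_neg del: A.M.a_coset_add_zero)
  qed (auto simp add: ops A.M.a_ac simp del: A.M.a_coset_add_zero)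
  have md: "module R ?Q"
    by (rule moduleI[OF A.is_cring ab])
       (auto simp: ops A.smult_l_distr A.smult_r_distr A.smult_assoc1)
  show LQ: "lie_algebra R ?Q"
    by (intro lie_algebra.intro[OF md] lie_algebra_axioms.intro)
       (auto simp: ops A.bracket_add_l A.bracket_add_r A.bracket_smult_l A.bracket_smult_r
          A.bracket_alternating A.jacobi simp del: A.M.a_coset_add_zero)
  show "(+>\<^bsub>A\<^esub>) I \<in> lie_hom R A ?Q"
    by (auto simp: lie_hom_def ops)
  show "a_kernel A ?Q ((+>\<^bsub>A\<^esub>) I) = I"
    using Ic by (auto simp: a_kernel_def kernel_def Q(2) AS.a_rcos_const dest: AS.a_rcos_self)
  fix B :: "('a, 'zz, 'yy) module_scheme" and h
  assume B: "lie_algebra R B" and h: "h \<in> lie_hom R A B" and h0: "\<And>x. x \<in> I \<Longrightarrow> h x = \<zero>\<^bsub>B\<^esub>"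
  interpret B: lie_algebra R B by (rule B)
  note hh = lie_homD[OF h]
  have lift: "lie_quot_lift h (I +>\<^bsub>A\<^esub> x) = h x" if x: "x \<in> carrier A" for x
  proof -
    have "h c = h x" if "c \<in> I +>\<^bsub>A\<^esub> x" for c
      using that x h0 Ic funcset_mem[OF hh(1) x] by (auto simp: a_r_coset_def r_coset_def hh(2))
    then have "h ` (I +>\<^bsub>A\<^esub> x) = {h x}" by (intro image_const[OF AS.a_rcos_self[OF x]])
    then show ?thesis by (simp add: lie_quot_lift_def)
  qed
  have "lie_quot_lift h \<in> lie_hom R ?Q B"
    unfolding lie_hom_def using hh by (auto simp: ops lift)
  then show "lie_quot_lift h \<in> lie_hom R ?Q B \<and> (\<forall>x\<in>carrier A. lie_quot_lift h (I +>\<^bsub>A\<^esub> x) = h x)"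
    using lift by blast
qed


lemma lie_coprod_eq_pushout:
  "lie_coprod R A B = lie_pushout R (C\<lparr>carrier := {}\<rparr>) A B f g"
  by (simp add: lie_coprod_def lie_pushout_def lie_pushout_rels_def)

lemma (in lie_algebra) bracket_anti:
  assumes "x \<in> carrier A" "y \<in> carrier A"
  shows "x \<otimes>\<^bsub>A\<^esub> y = \<ominus>\<^bsub>A\<^esub> (y \<otimes>\<^bsub>A\<^esub> x)"
proof -
  have "(x \<oplus>\<^bsub>A\<^esub> y) \<otimes>\<^bsub>A\<^esub> (x \<oplus>\<^bsub>A\<^esub> y) = \<zero>\<^bsub>A\<^esub>" using assms by (intro bracket_alternating) auto
  moreover have "(x \<oplus>\<^bsub>A\<^esub> y) \<otimes>\<^bsub>A\<^esub> (x \<oplus>\<^bsub>A\<^esub> y) = (x \<otimes>\<^bsub>A\<^esub> y) \<oplus>\<^bsub>A\<^esub> (y \<otimes>\<^bsub>A\<^esub> x)"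
    using assms bracket_alternating[of x] bracket_alternating[of y]
    by (simp add: bracket_add_l bracket_add_r M.a_comm)
  ultimately have "(x \<otimes>\<^bsub>A\<^esub> y) \<oplus>\<^bsub>A\<^esub> (y \<otimes>\<^bsub>A\<^esub> x) = \<zero>\<^bsub>A\<^esub>" by simp
  then show ?thesis using assms by (metis M.minus_equality bracket_closed M.a_comm)
qed

lemma lie_semidirect_ops:
  "carrier (lie_semidirect M L act) = carrier M \<times> carrier L"
  "(m, l) \<otimes>\<^bsub>lie_semidirect M L act\<^esub> (m', l') =
    ((m \<otimes>\<^bsub>M\<^esub> m') \<oplus>\<^bsub>M\<^esub> (act l m' \<ominus>\<^bsub>M\<^esub> act l' m), l \<otimes>\<^bsub>L\<^esub> l')"
  "(m, l) \<oplus>\<^bsub>lie_semidirect M L act\<^esub> (m', l') = (m \<oplus>\<^bsub>M\<^esub> m', l \<oplus>\<^bsub>L\<^esub> l')"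
  "r \<odot>\<^bsub>lie_semidirect M L act\<^esub> (m, l) = (r \<odot>\<^bsub>M\<^esub> m, r \<odot>\<^bsub>L\<^esub> l)"
  "\<zero>\<^bsub>lie_semidirect M L act\<^esub> = (\<zero>\<^bsub>M\<^esub>, \<zero>\<^bsub>L\<^esub>)"
  by (auto simp: lie_semidirect_def)

context lie_action
begin

lemma act_minus_r: "\<lbrakk>l \<in> carrier L; m \<in> carrier M\<rbrakk> \<Longrightarrow> act l (\<ominus>\<^bsub>M\<^esub> m) = \<ominus>\<^bsub>M\<^esub> act l m"
  using act_smult_r[of "\<ominus>\<^bsub>R\<^esub> \<one>\<^bsub>R\<^esub>" l m] act_closed[of l m]
  by (simp add: M.smult_l_minus)

lemma act_zero_r: "l \<in> carrier L \<Longrightarrow> act l \<zero>\<^bsub>M\<^esub> = \<zero>\<^bsub>M\<^esub>"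
  using act_smult_r[of "\<zero>\<^bsub>R\<^esub>" l "\<zero>\<^bsub>M\<^esub>"] act_closed[of l "\<zero>\<^bsub>M\<^esub>"] by simp

lemma bracket_zero: "m \<in> carrier M \<Longrightarrow> m \<otimes>\<^bsub>M\<^esub> \<zero>\<^bsub>M\<^esub> = \<zero>\<^bsub>M\<^esub>"
  using M.bracket_smult_r[of "\<zero>\<^bsub>R\<^esub>" m "\<zero>\<^bsub>M\<^esub>"] by simp

lemma bracket_minus_r:
  "\<lbrakk>m \<in> carrier M; m' \<in> carrier M\<rbrakk> \<Longrightarrow> m \<otimes>\<^bsub>M\<^esub> (\<ominus>\<^bsub>M\<^esub> m') = \<ominus>\<^bsub>M\<^esub> (m \<otimes>\<^bsub>M\<^esub> m')"
  using M.bracket_smult_r[of "\<ominus>\<^bsub>R\<^esub> \<one>\<^bsub>R\<^esub>" m m'] by (simp add: M.smult_l_minus)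

end

lemma (in lie_crossed_module) groupoid_homs:
  "gpd_dom \<in> lie_hom R (lie_semidirect M L act) L"
  "gpd_cod L \<mu> \<in> lie_hom R (lie_semidirect M L act) L"
  "gpd_id M \<in> lie_hom R L (lie_semidirect M L act)"
proof -
  note ops = lie_semidirect_ops gpd_dom_def gpd_cod_def gpd_id_def
  note h = lie_homD[OF boundary_hom]
  have mc: "\<mu> m \<in> carrier L" if "m \<in> carrier M" for m using that h(1) by auto
  have mm: "\<mu> (\<ominus>\<^bsub>M\<^esub> m) = \<ominus>\<^bsub>L\<^esub> \<mu> m" if "m \<in> carrier M" for m
    using h(3)[of "\<ominus>\<^bsub>R\<^esub> \<one>\<^bsub>R\<^esub>" m] that mc[of m] by (simp add: M.smult_l_minus L.smult_l_minus)
  have mz: "\<ominus>\<^bsub>M\<^esub> \<zero>\<^bsub>M\<^esub> = \<zero>\<^bsub>M\<^esub>"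
    using M.M.r_neg[OF M.M.zero_closed] by simp
  show "gpd_dom \<in> lie_hom R (lie_semidirect M L act) L"
    by (auto simp: lie_hom_def ops)
  show "gpd_id M \<in> lie_hom R L (lie_semidirect M L act)"
    by (auto simp: lie_hom_def ops bracket_zero act_zero_r a_minus_def mz)
  show "gpd_cod L \<mu> \<in> lie_hom R (lie_semidirect M L act) L"
    unfolding lie_hom_def
  proof (intro CollectI conjI ballI)
    fix x y assume "x \<in> carrier (lie_semidirect M L act)" "y \<in> carrier (lie_semidirect M L act)"
    then obtain m l m' l' where [simp]: "x = (m, l)" "y = (m', l')" 
      and c [simp]: "m \<in> carrier M" "m' \<in> carrier M" "l \<in> carrier L" "l' \<in> carrier L"
      by (auto simp: ops)
    have "\<mu> m \<otimes>\<^bsub>L\<^esub> l' = \<ominus>\<^bsub>L\<^esub> (l' \<otimes>\<^bsub>L\<^esub> \<mu> m)"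
      by (rule L.bracket_anti) (simp_all add: mc)
    then show "gpd_cod L \<mu> (x \<otimes>\<^bsub>lie_semidirect M L act\<^esub> y) = gpd_cod L \<mu> x \<otimes>\<^bsub>L\<^esub> gpd_cod L \<mu> y"
      by (simp add: ops h mm mc act_closed equivariance a_minus_def L.bracket_add_l L.bracket_add_r L.M.a_ac)
  qed (auto simp: ops h mc L.smult_r_distr L.M.a_ac)
qed

end

theory Submission
  imports Defs
begin

text \<open>
  Write \<open>T\<close> for Ellis' tensor product and \<open>P\<close> for the quotient of the pushout \<open>Q\<close>.  The images of \<open>M\<close>,
  \<open>N\<close> and \<open>L\<close> generate \<open>P\<close>, and \<open>(m, n) \<mapsto> [m, n]\<close> satisfies Ellis' relations in \<open>P\<close>: since the kernels
  of domain and codomain commute there, a \<open>z\<close> in both domain kernels has \<open>[m, z] = [\<mu> m, z]\<close> and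
  \<open>[n, z] = [\<nu> n, z]\<close>.  This gives a morphism \<open>\<phi>\<close> from \<open>T\<close> into the general tensor product.

  For the converse, \<open>L\<close> acts on \<open>T\<close> diagonally and \<open>M \<rtimes> L\<close> acts on \<open>T \<rtimes> N\<close> by
  \<open>(m, l)(t, n) = ((\<mu> m + l) t + m \<otimes> n, l n)\<close>.  In \<open>E = (T \<rtimes> N) \<rtimes> (M \<rtimes> L)\<close> the bracket of \<open>m\<close> and \<open>n\<close>
  is \<open>m \<otimes> n\<close>, and the domain and codomain maps of \<open>Q\<close> factor through \<open>E\<close>, where their kernels commute.
  Hence \<open>Q \<rightarrow> E\<close> factors through \<open>P\<close>; the resulting map \<open>P \<rightarrow> E\<close> is inverted by the map \<open>E \<rightarrow> P\<close> built
  from \<open>\<phi>\<close>, and the intersection of the two domain kernels in \<open>E\<close> is \<open>T\<close>.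
\<close>

section \<open>Lie algebras, actions and semidirect products\<close>

context abelian_group begin

text \<open>Used together with \<open>a_ac\<close>: all differences are moved outwards and across the equation, which leaves
  two sums that agree up to permutation.\<close>

lemma diff_simps:
  "\<lbrakk>a \<in> carrier G; b \<in> carrier G; c \<in> carrier G\<rbrakk> \<Longrightarrow> a \<oplus> (b \<ominus> c) = (a \<oplus> b) \<ominus> c"
  "\<lbrakk>a \<in> carrier G; b \<in> carrier G; c \<in> carrier G\<rbrakk> \<Longrightarrow> (a \<ominus> b) \<oplus> c = (a \<oplus> c) \<ominus> b"
  "\<lbrakk>a \<in> carrier G; b \<in> carrier G; c \<in> carrier G\<rbrakk> \<Longrightarrow> a \<ominus> (b \<ominus> c) = (a \<oplus> c) \<ominus> b"
  "\<lbrakk>a \<in> carrier G; b \<in> carrier G; c \<in> carrier G\<rbrakk> \<Longrightarrow> (a \<ominus> b) \<ominus> c = a \<ominus> (b \<oplus> c)"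
  "\<lbrakk>a \<in> carrier G; b \<in> carrier G; c \<in> carrier G\<rbrakk> \<Longrightarrow> a \<ominus> b = c \<longleftrightarrow> a = c \<oplus> b"
  "\<lbrakk>a \<in> carrier G; b \<in> carrier G; c \<in> carrier G\<rbrakk> \<Longrightarrow> c = a \<ominus> b \<longleftrightarrow> c \<oplus> b = a"
  "a \<in> carrier G \<Longrightarrow> \<ominus> a = \<zero> \<ominus> a"
proof -
  assume a: "a \<in> carrier G"
  then show "\<ominus> a = \<zero> \<ominus> a" by (simp add: a_minus_def)
  assume b: "b \<in> carrier G" and c: "c \<in> carrier G"
  note [simp] = a b c
  show "a \<oplus> (b \<ominus> c) = (a \<oplus> b) \<ominus> c" "(a \<ominus> b) \<oplus> c = (a \<oplus> c) \<ominus> b"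
    "a \<ominus> (b \<ominus> c) = (a \<oplus> c) \<ominus> b" "(a \<ominus> b) \<ominus> c = a \<ominus> (b \<oplus> c)"
    by (simp_all add: a_minus_def minus_add a_ac)
  show 1: "a \<ominus> b = c \<longleftrightarrow> a = c \<oplus> b"
    by (auto simp: a_minus_def a_assoc l_neg r_neg)
  then show "c = a \<ominus> b \<longleftrightarrow> c \<oplus> b = a" by auto
qed

end

lemma (in abelian_group) add_diff_cancel:
  "\<lbrakk>a \<in> carrier G; b \<in> carrier G\<rbrakk> \<Longrightarrow> (a \<ominus> b) \<oplus> b = a"
  by (simp add: a_minus_def a_assoc l_neg)

lemma (in abelian_group) diff_zero: "a \<in> carrier G \<Longrightarrow> a \<ominus> \<zero> = a"
  by (simp add: diff_simps(5))

context lie_algebra begin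

lemma bracket_zero_r [simp]: "x \<in> carrier A \<Longrightarrow> x \<otimes>\<^bsub>A\<^esub> \<zero>\<^bsub>A\<^esub> = \<zero>\<^bsub>A\<^esub>"
  using bracket_smult_r[of "\<zero>\<^bsub>R\<^esub>" x "\<zero>\<^bsub>A\<^esub>"] by simp

lemma bracket_zero_l [simp]: "x \<in> carrier A \<Longrightarrow> \<zero>\<^bsub>A\<^esub> \<otimes>\<^bsub>A\<^esub> x = \<zero>\<^bsub>A\<^esub>"
  using bracket_smult_l[of "\<zero>\<^bsub>R\<^esub>" "\<zero>\<^bsub>A\<^esub>" x] by simp

lemma smult_diff:
  assumes "r \<in> carrier R" "x \<in> carrier A" "y \<in> carrier A"
  shows "r \<odot>\<^bsub>A\<^esub> (x \<ominus>\<^bsub>A\<^esub> y) = r \<odot>\<^bsub>A\<^esub> x \<ominus>\<^bsub>A\<^esub> r \<odot>\<^bsub>A\<^esub> y"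
  using assms by (simp add: a_minus_def smult_r_distr smult_r_minus)

lemma bracket_diff_l:
  assumes "x \<in> carrier A" "y \<in> carrier A" "z \<in> carrier A"
  shows "(x \<ominus>\<^bsub>A\<^esub> y) \<otimes>\<^bsub>A\<^esub> z = x \<otimes>\<^bsub>A\<^esub> z \<ominus>\<^bsub>A\<^esub> y \<otimes>\<^bsub>A\<^esub> z"
  using bracket_add_l[of "x \<ominus>\<^bsub>A\<^esub> y" y z] assms by (simp add: M.add_diff_cancel M.diff_simps(6))

lemma bracket_diff_r:
  assumes "x \<in> carrier A" "y \<in> carrier A" "z \<in> carrier A"
  shows "z \<otimes>\<^bsub>A\<^esub> (x \<ominus>\<^bsub>A\<^esub> y) = z \<otimes>\<^bsub>A\<^esub> x \<ominus>\<^bsub>A\<^esub> z \<otimes>\<^bsub>A\<^esub> y"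
  using bracket_add_r[of z "x \<ominus>\<^bsub>A\<^esub> y" y] assms by (simp add: M.add_diff_cancel M.diff_simps(6))

lemmas bracket_bilinear = bracket_add_l bracket_add_r bracket_diff_l bracket_diff_r bracket_smult_l bracket_smult_r

lemma bracket_swap:
  assumes "x \<in> carrier A" "y \<in> carrier A"
  shows "x \<otimes>\<^bsub>A\<^esub> y = \<zero>\<^bsub>A\<^esub> \<ominus>\<^bsub>A\<^esub> y \<otimes>\<^bsub>A\<^esub> x"
  using assms bracket_anti[OF assms] by (simp add: M.diff_simps(7))

text \<open>The Jacobi identity solved for one term with the help of antisymmetry: bracketing with x
  is a derivation. Iterated brackets in \<open>P\<close> are rearranged below in this form.\<close>

lemma bracket_leibniz:
  assumes "x \<in> carrier A" "y \<in> carrier A" "z \<in> carrier A"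
  shows "x \<otimes>\<^bsub>A\<^esub> (y \<otimes>\<^bsub>A\<^esub> z) = (x \<otimes>\<^bsub>A\<^esub> y) \<otimes>\<^bsub>A\<^esub> z \<oplus>\<^bsub>A\<^esub> y \<otimes>\<^bsub>A\<^esub> (x \<otimes>\<^bsub>A\<^esub> z)"
  using jacobi[of x y z] assms
  by (simp add: bracket_swap[of z x] bracket_swap[of z "x \<otimes>\<^bsub>A\<^esub> y"] bracket_bilinear M.diff_simps M.a_ac)

end

context lie_action begin

lemma act_zero_l [simp]: "m \<in> carrier M \<Longrightarrow> act \<zero>\<^bsub>L\<^esub> m = \<zero>\<^bsub>M\<^esub>"
  using act_smult_l[of "\<zero>\<^bsub>R\<^esub>" "\<zero>\<^bsub>L\<^esub>" m] act_closed[of "\<zero>\<^bsub>L\<^esub>" m] by simp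

lemma act_diff_l:
  assumes "l \<in> carrier L" "l' \<in> carrier L" "m \<in> carrier M"
  shows "act (l \<ominus>\<^bsub>L\<^esub> l') m = act l m \<ominus>\<^bsub>M\<^esub> act l' m"
  using act_add_l[of "l \<ominus>\<^bsub>L\<^esub> l'" l' m] assms act_closed by (simp add: L.M.add_diff_cancel M.M.diff_simps(6))

lemma act_diff_r:
  assumes "l \<in> carrier L" "m' \<in> carrier M" "m \<in> carrier M"
  shows "act l (m \<ominus>\<^bsub>M\<^esub> m') = act l m \<ominus>\<^bsub>M\<^esub> act l m'"
  using act_add_r[of l "m \<ominus>\<^bsub>M\<^esub> m'" m'] assms act_closed by (simp add: M.M.add_diff_cancel M.M.diff_simps(6))

lemmas act_bilinear = act_add_l act_add_r act_diff_l act_diff_r act_smult_l act_smult_r act_zero_l act_zero_r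

lemma semidirect_lie_algebra: "lie_algebra R (lie_semidirect M L act)"
proof -
  let ?S = "lie_semidirect M L act"
  note ops = lie_semidirect_ops
  note [simp] = act_closed act_zero_r
  have ab: "abelian_group ?S"
  proof (rule abelian_groupI)
    fix x assume "x \<in> carrier ?S"
    then show "\<exists>y\<in>carrier ?S. y \<oplus>\<^bsub>?S\<^esub> x = \<zero>\<^bsub>?S\<^esub>"
      by (intro bexI[of _ "(\<ominus>\<^bsub>M\<^esub> fst x, \<ominus>\<^bsub>L\<^esub> snd x)"]) (auto simp: ops M.M.l_neg L.M.l_neg)
  qed (auto simp: ops M.M.a_ac L.M.a_ac)
  have md: "module R ?S"
    by (rule moduleI[OF is_cring ab])
      (auto simp: ops L.smult_l_distr L.smult_r_distr L.smult_assoc1 M.smult_l_distr M.smult_r_distr M.smult_assoc1)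
  show ?thesis
  proof (intro lie_algebra.intro[OF md] lie_algebra_axioms.intro)
    fix x y z assume "x \<in> carrier ?S" "y \<in> carrier ?S" "z \<in> carrier ?S"
    then obtain m l m' l' m'' l'' where [simp]: "x = (m, l)" "y = (m', l')" "z = (m'', l'')"
      and [simp]: "m \<in> carrier M" "m' \<in> carrier M" "m'' \<in> carrier M" "l \<in> carrier L" "l' \<in> carrier L" "l'' \<in> carrier L"
      by (auto simp: ops)
    show "(x \<oplus>\<^bsub>?S\<^esub> y) \<otimes>\<^bsub>?S\<^esub> z = x \<otimes>\<^bsub>?S\<^esub> z \<oplus>\<^bsub>?S\<^esub> y \<otimes>\<^bsub>?S\<^esub> z"
      "x \<otimes>\<^bsub>?S\<^esub> (y \<oplus>\<^bsub>?S\<^esub> z) = x \<otimes>\<^bsub>?S\<^esub> y \<oplus>\<^bsub>?S\<^esub> x \<otimes>\<^bsub>?S\<^esub> z"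
      by (simp_all add: ops act_bilinear M.bracket_bilinear L.bracket_bilinear M.M.diff_simps M.M.a_ac)
    \<comment> \<open>Brackets of an acted element with another element occur in both orders in the
      cyclic sum; moving the acted element to the right lets them cancel.\<close>
    have a: "act u v \<otimes>\<^bsub>M\<^esub> w = \<zero>\<^bsub>M\<^esub> \<ominus>\<^bsub>M\<^esub> w \<otimes>\<^bsub>M\<^esub> act u v"
       if "u \<in> carrier L" "v \<in> carrier M" "w \<in> carrier M" for u v w
      using that by (subst M.bracket_anti) (simp_all add: M.M.diff_simps(7))
    \<comment> \<open>The Jacobi identity of M, solved for one term so that it can serve as a
      rewrite rule.\<close>
    have j: "m \<otimes>\<^bsub>M\<^esub> (m' \<otimes>\<^bsub>M\<^esub> m'') = \<zero>\<^bsub>M\<^esub> \<ominus>\<^bsub>M\<^esub> (m' \<otimes>\<^bsub>M\<^esub> (m'' \<otimes>\<^bsub>M\<^esub> m)) \<ominus>\<^bsub>M\<^esub> (m'' \<otimes>\<^bsub>M\<^esub> (m \<otimes>\<^bsub>M\<^esub> m'))"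
      using M.jacobi[of m m' m''] by (simp add: M.M.diff_simps M.M.a_ac)
    show "x \<otimes>\<^bsub>?S\<^esub> (y \<otimes>\<^bsub>?S\<^esub> z) \<oplus>\<^bsub>?S\<^esub> y \<otimes>\<^bsub>?S\<^esub> (z \<otimes>\<^bsub>?S\<^esub> x) \<oplus>\<^bsub>?S\<^esub> z \<otimes>\<^bsub>?S\<^esub> (x \<otimes>\<^bsub>?S\<^esub> y) = \<zero>\<^bsub>?S\<^esub>"
      by (simp add: a[of l m' m''] a[of l' m'' m] a[of l'' m m'] a[of l m'' m'] a[of l' m m''] a[of l'' m' m]
          ops act_bilinear act_bracket_l act_bracket_r M.bracket_bilinear L.jacobi j M.M.diff_simps M.M.a_ac)
  qed (auto simp: ops act_bilinear M.bracket_bilinear L.bracket_bilinear M.bracket_alternating L.bracket_alternating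
         M.smult_r_distr M.smult_diff M.M.diff_simps(5))
qed

lemma semidirect_minus:
  assumes "m \<in> carrier M" "l \<in> carrier L"
  shows "\<ominus>\<^bsub>lie_semidirect M L act\<^esub> (m, l) = (\<ominus>\<^bsub>M\<^esub> m, \<ominus>\<^bsub>L\<^esub> l)"
    and "\<lbrakk>m' \<in> carrier M; l' \<in> carrier L\<rbrakk> \<Longrightarrow>
      (m', l') \<ominus>\<^bsub>lie_semidirect M L act\<^esub> (m, l) = (m' \<ominus>\<^bsub>M\<^esub> m, l' \<ominus>\<^bsub>L\<^esub> l)"
proof -
  interpret D: lie_algebra R "lie_semidirect M L act" by (rule semidirect_lie_algebra)
  show *: "\<ominus>\<^bsub>lie_semidirect M L act\<^esub> (m, l) = (\<ominus>\<^bsub>M\<^esub> m, \<ominus>\<^bsub>L\<^esub> l)"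
    using assms by (intro D.M.minus_equality) (simp_all add: lie_semidirect_ops M.M.l_neg L.M.l_neg)
  show "\<lbrakk>m' \<in> carrier M; l' \<in> carrier L\<rbrakk> \<Longrightarrow>
      (m', l') \<ominus>\<^bsub>lie_semidirect M L act\<^esub> (m, l) = (m' \<ominus>\<^bsub>M\<^esub> m, l' \<ominus>\<^bsub>L\<^esub> l)"
    unfolding a_minus_def * by (simp add: lie_semidirect_ops)
qed

lemma semidirect_incl_homs:
  "(\<lambda>m. (m, \<zero>\<^bsub>L\<^esub>)) \<in> lie_hom R M (lie_semidirect M L act)"
  "(\<lambda>l. (\<zero>\<^bsub>M\<^esub>, l)) \<in> lie_hom R L (lie_semidirect M L act)"
  by (auto simp: lie_hom_def lie_semidirect_ops act_bilinear M.M.diff_simps(5,6))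

end

section \<open>Ideals and commutators\<close>

lemma lie_hom_closed: "\<lbrakk>h \<in> lie_hom R A B; x \<in> carrier A\<rbrakk> \<Longrightarrow> h x \<in> carrier B"
  by (auto simp: lie_hom_def)

lemma lie_hom_compose:
  "\<lbrakk>h \<in> lie_hom R A B; k \<in> lie_hom R B D\<rbrakk> \<Longrightarrow> (\<lambda>x. k (h x)) \<in> lie_hom R A D"
  by (auto simp: lie_hom_def Pi_iff)

lemma lie_hom_diff:
  assumes "lie_algebra R A" "lie_algebra R B" "h \<in> lie_hom R A B" "x \<in> carrier A" "y \<in> carrier A"
  shows "h (x \<ominus>\<^bsub>A\<^esub> y) = h x \<ominus>\<^bsub>B\<^esub> h y"
proof -
  interpret A: lie_algebra R A by fact
  interpret B: lie_algebra R B by fact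
  note [simp] = lie_hom_closed[OF assms(3)]
  show ?thesis
    using lie_homD(2)[OF assms(3), of "x \<ominus>\<^bsub>A\<^esub> y" y] assms(4,5)
    by (simp add: A.M.add_diff_cancel B.M.diff_simps(6))
qed

text \<open>A morphism out of a semidirect product must turn the action into the bracket of D. Under
  \<open>fg\<close> the mixed terms of the two brackets match, so f and g extend. Morphisms out of
  \<open>ST\<close> and \<open>E\<close> into \<open>P\<close> are built this way.\<close>

lemma (in lie_action) semidirect_copair_hom:
  assumes "lie_algebra R D" and f: "f \<in> lie_hom R M D" and g: "g \<in> lie_hom R L D"
    and fg: "\<And>l m. \<lbrakk>l \<in> carrier L; m \<in> carrier M\<rbrakk> \<Longrightarrow> f (act l m) = g l \<otimes>\<^bsub>D\<^esub> f m"
  shows "(\<lambda>(m, l). f m \<oplus>\<^bsub>D\<^esub> g l) \<in> lie_hom R (lie_semidirect M L act) D"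
proof -
  interpret D: lie_algebra R D by fact
  note [simp] = act_closed lie_hom_closed[OF f] lie_hom_closed[OF g]
  have a: "f m \<otimes>\<^bsub>D\<^esub> g l = \<zero>\<^bsub>D\<^esub> \<ominus>\<^bsub>D\<^esub> g l \<otimes>\<^bsub>D\<^esub> f m" if "m \<in> carrier M" "l \<in> carrier L" for m l
    using that by (subst D.bracket_anti) (simp_all add: D.M.diff_simps(7))
  show ?thesis
    unfolding lie_hom_def
    by (auto simp: lie_semidirect_ops lie_homD[OF f] lie_homD[OF g] lie_hom_diff[OF M.lie_algebra_axioms assms(1) f]
        fg a D.bracket_bilinear D.smult_r_distr D.M.diff_simps D.M.a_ac)
qed

section \<open>Products and subalgebras\<close>

lemma lie_prod_ops:
  "carrier (lie_prod A B) = carrier A \<times> carrier B"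
  "(a, b) \<otimes>\<^bsub>lie_prod A B\<^esub> (a', b') = (a \<otimes>\<^bsub>A\<^esub> a', b \<otimes>\<^bsub>B\<^esub> b')"
  "(a, b) \<oplus>\<^bsub>lie_prod A B\<^esub> (a', b') = (a \<oplus>\<^bsub>A\<^esub> a', b \<oplus>\<^bsub>B\<^esub> b')"
  "r \<odot>\<^bsub>lie_prod A B\<^esub> (a, b) = (r \<odot>\<^bsub>A\<^esub> a, r \<odot>\<^bsub>B\<^esub> b)"
  "\<zero>\<^bsub>lie_prod A B\<^esub> = (\<zero>\<^bsub>A\<^esub>, \<zero>\<^bsub>B\<^esub>)"
  by (auto simp: lie_prod_def)

lemma lie_prod_lie_algebra:
  assumes "lie_algebra R A" "lie_algebra R B"
  shows "lie_algebra R (lie_prod A B)"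
proof -
  interpret A: lie_algebra R A by fact
  interpret B: lie_algebra R B by fact
  let ?P = "lie_prod A B"
  note ops = lie_prod_ops
  have ab: "abelian_group ?P"
  proof (rule abelian_groupI)
    fix x assume "x \<in> carrier ?P"
    then show "\<exists>y\<in>carrier ?P. y \<oplus>\<^bsub>?P\<^esub> x = \<zero>\<^bsub>?P\<^esub>"
      by (intro bexI[of _ "(\<ominus>\<^bsub>A\<^esub> fst x, \<ominus>\<^bsub>B\<^esub> snd x)"]) (auto simp: ops A.M.l_neg B.M.l_neg)
  qed (auto simp: ops A.M.a_ac B.M.a_ac)
  have md: "module R ?P"
    by (rule moduleI[OF A.is_cring ab])
      (auto simp: ops A.smult_l_distr A.smult_r_distr A.smult_assoc1 B.smult_l_distr B.smult_r_distr B.smult_assoc1)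
  show ?thesis
    by (intro lie_algebra.intro[OF md] lie_algebra_axioms.intro)
      (auto simp: ops A.bracket_bilinear B.bracket_bilinear A.bracket_alternating B.bracket_alternating
        A.jacobi B.jacobi)
qed

lemma lie_subalgebra_lie_algebra:
  assumes "lie_algebra R A" "lie_subalgebra S R A"
  shows "lie_algebra R (A\<lparr>carrier := S\<rparr>)"
proof -
  interpret A: lie_algebra R A by fact
  interpret S: submodule S R A using assms(2) by (simp add: lie_subalgebra_def)
  have "module R (A\<lparr>carrier := S\<rparr>)"
    by (rule S.submodule_is_module[OF A.module_axioms])
  then show ?thesis
    using assms(2) S.subset
    by (intro lie_algebra.intro lie_algebra_axioms.intro)
      (auto simp: lie_subalgebra_def A.bracket_bilinear A.bracket_alternating A.jacobi subset_eq)
qed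

lemma lie_subalgebra_subset: "lie_subalgebra S R A \<Longrightarrow> S \<subseteq> carrier A"
  by (auto simp: lie_subalgebra_def submodule_def subgroup_def)

lemma lie_ideal_subalgebra:
  assumes "lie_algebra R A" "lie_ideal I R A"
  shows "lie_subalgebra I R A"
proof -
  interpret S: submodule I R A using assms(2) by (simp add: lie_ideal_def)
  show ?thesis using assms S.subset by (auto simp: lie_ideal_def lie_subalgebra_def subset_eq)
qed

text \<open>The restrictions of u to the two summands have only one extension to the pushout, and
  both u and v are such an extension.\<close>

lemma lie_pushout_hom_ext:
  assumes A: "lie_algebra R A" and B: "lie_algebra R B" and D: "lie_algebra R D"
    and fg: "f \<in> carrier C \<rightarrow> carrier A" "g \<in> carrier C \<rightarrow> carrier B"
    and u: "u \<in> lie_hom R (lie_pushout R C A B f g) D" and v: "v \<in> lie_hom R (lie_pushout R C A B f g) D"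
    and i: "\<And>a. a \<in> carrier A \<Longrightarrow> u (lie_pushout_inl R C A B f g a) = v (lie_pushout_inl R C A B f g a)"
    and j: "\<And>b. b \<in> carrier B \<Longrightarrow> u (lie_pushout_inr R C A B f g b) = v (lie_pushout_inr R C A B f g b)"
    and x: "x \<in> carrier (lie_pushout R C A B f g)"
  shows "u x = v x"
proof -
  note U = lie_pushout_universal[OF A B fg]
  let ?h = "\<lambda>a. u (lie_pushout_inl R C A B f g a)" and ?k = "\<lambda>b. u (lie_pushout_inr R C A B f g b)"
  have "?h (f c) = ?k (g c)" if "c \<in> carrier C" for c
    using U(4)[OF that] by simp
  from U(5)[OF D lie_hom_compose[OF U(2) u] lie_hom_compose[OF U(3) u] this]
  have *: "w x = lie_copair D ?h ?k x" if "w \<in> lie_hom R (lie_pushout R C A B f g) D"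
    "\<forall>a\<in>carrier A. w (lie_pushout_inl R C A B f g a) = ?h a"
    "\<forall>b\<in>carrier B. w (lie_pushout_inr R C A B f g b) = ?k b" for w
    using that x by blast
  show ?thesis using *[OF u] *[OF v] i j by simp
qed

lemma a_kernel_iff: "x \<in> a_kernel A B h \<longleftrightarrow> x \<in> carrier A \<and> h x = \<zero>\<^bsub>B\<^esub>"
  by (auto simp: a_kernel_def kernel_def)

section \<open>Higgins commutators of two subalgebras\<close>

context
  fixes R :: "('r, 'x) ring_scheme" and X :: "('r, 'a, 'y) module_scheme" and S T :: "'a set"
  assumes X: "lie_algebra R X" and S: "lie_subalgebra S R X" and T: "lie_subalgebra T R X"
begin

private abbreviation (input) "XS \<equiv> X\<lparr>carrier := S\<rparr>"
private abbreviation (input) "XT \<equiv> X\<lparr>carrier := T\<rparr>"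
text \<open>Not a Lie algebra: the pushout construction reads only the carrier of its base, and an
  empty carrier imposes no identification. The coproduct thus inherits the universal property of
  pushouts.\<close>

private abbreviation (input) "nul \<equiv> X\<lparr>carrier := {}\<rparr>"
private abbreviation (input) "XST \<equiv> lie_coprod R XS XT"
private abbreviation (input) "inS \<equiv> lie_pushout_inl R nul XS XT (\<lambda>x. x) (\<lambda>x. x)"
private abbreviation (input) "inT \<equiv> lie_pushout_inr R nul XS XT (\<lambda>x. x) (\<lambda>x. x)"

lemma coprod_eq_pushout: "XST = lie_pushout R nul XS XT (\<lambda>x. x) (\<lambda>x. x)"
  by (rule lie_coprod_eq_pushout)

lemma coprod_summands:
  "lie_algebra R XS" "lie_algebra R XT" "(\<lambda>x. x) \<in> carrier nul \<rightarrow> carrier XS" "(\<lambda>x. x) \<in> carrier nul \<rightarrow> carrier XT"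
  using lie_subalgebra_lie_algebra[OF X S] lie_subalgebra_lie_algebra[OF X T] by auto

lemma coprod_facts: "lie_algebra R XST" "inS \<in> lie_hom R XS XST" "inT \<in> lie_hom R XT XST"
  by (rule lie_pushout_universal[OF coprod_summands, folded coprod_eq_pushout])+

lemma coprod_copair:
  assumes "lie_algebra R D" "h \<in> lie_hom R XS D" "k \<in> lie_hom R XT D"
  shows "lie_copair D h k \<in> lie_hom R XST D"
    "a \<in> S \<Longrightarrow> lie_copair D h k (inS a) = h a"
    "b \<in> T \<Longrightarrow> lie_copair D h k (inT b) = k b"
  using lie_pushout_universal(5)[OF coprod_summands, folded coprod_eq_pushout, OF assms] by simp_all

lemma coprod_hom_ext:
  assumes "lie_algebra R D" "u \<in> lie_hom R XST D" "v \<in> lie_hom R XST D"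
    and "\<And>a. a \<in> S \<Longrightarrow> u (inS a) = v (inS a)" "\<And>a. a \<in> T \<Longrightarrow> u (inT a) = v (inT a)"
    and "x \<in> carrier XST"
  shows "u x = v x"
  by (rule lie_pushout_hom_ext[OF coprod_summands(1,2) assms(1) coprod_summands(3,4), folded coprod_eq_pushout, OF assms(2,3)])
    (use assms in auto)

lemma incl_hom: "(\<lambda>x. x) \<in> lie_hom R XS X" "(\<lambda>x. x) \<in> lie_hom R XT X"
  using lie_subalgebra_subset[OF S] lie_subalgebra_subset[OF T] by (auto simp: lie_hom_def)

lemma coprod_to_prod_facts:
  shows "lie_coprod_to_prod XS XT \<in> lie_hom R XST (lie_prod XS XT)"
    and "a \<in> S \<Longrightarrow> lie_coprod_to_prod XS XT (inS a) = (a, \<zero>\<^bsub>X\<^esub>)"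
    and "b \<in> T \<Longrightarrow> lie_coprod_to_prod XS XT (inT b) = (\<zero>\<^bsub>X\<^esub>, b)"
proof -
  interpret X: lie_algebra R X by (rule X)
  note AS = lie_subalgebra_lie_algebra[OF X S] and AT = lie_subalgebra_lie_algebra[OF X T]
  interpret AS: lie_algebra R XS by (rule AS)
  interpret AT: lie_algebra R XT by (rule AT)
  have h: "(\<lambda>a. (a, \<zero>\<^bsub>XT\<^esub>)) \<in> lie_hom R XS (lie_prod XS XT)"
    using AT.M.zero_closed AT.M.l_zero[of "\<zero>\<^bsub>X\<^esub>"] AT.smult_r_null AT.bracket_zero_r[of "\<zero>\<^bsub>X\<^esub>"] lie_subalgebra_subset[OF S]
    by (auto simp: lie_hom_def lie_prod_def S[unfolded lie_subalgebra_def])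
  have k: "(\<lambda>a. (\<zero>\<^bsub>XS\<^esub>, a)) \<in> lie_hom R XT (lie_prod XS XT)"
    using AS.M.zero_closed AS.M.l_zero[of "\<zero>\<^bsub>X\<^esub>"] AS.smult_r_null AS.bracket_zero_r[of "\<zero>\<^bsub>X\<^esub>"] lie_subalgebra_subset[OF T]
    by (auto simp: lie_hom_def lie_prod_def T[unfolded lie_subalgebra_def])
  note F = coprod_copair[OF lie_prod_lie_algebra[OF AS AT] h k, folded lie_coprod_to_prod_def]
  show "lie_coprod_to_prod XS XT \<in> lie_hom R XST (lie_prod XS XT)"
    "a \<in> S \<Longrightarrow> lie_coprod_to_prod XS XT (inS a) = (a, \<zero>\<^bsub>X\<^esub>)"
    "b \<in> T \<Longrightarrow> lie_coprod_to_prod XS XT (inT b) = (\<zero>\<^bsub>X\<^esub>, b)"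
    using F by simp_all
qed

lemma higgins_commutator_subset: "higgins_commutator R X S T \<subseteq> carrier X"
  using coprod_copair[OF X incl_hom]
  by (auto simp: higgins_commutator_def Let_def a_kernel_iff lie_hom_closed)

text \<open>In the product, (s, 0) and (0, t) commute. The bracket of the two generators in the
  coproduct is therefore killed by the comparison map, and its image in X is the bracket of s and
  t.\<close>

lemma bracket_in_higgins_commutator:
  assumes "s \<in> S" "t \<in> T"
  shows "s \<otimes>\<^bsub>X\<^esub> t \<in> higgins_commutator R X S T"
proof -
  interpret X: lie_algebra R X by (rule X)
  interpret C: lie_algebra R XST by (rule coprod_facts(1))
  note r = coprod_copair[OF X incl_hom] and p = coprod_to_prod_facts
  have c: "s \<in> carrier X" "t \<in> carrier X"
    using assms lie_subalgebra_subset[OF S] lie_subalgebra_subset[OF T] by auto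
  have ci: "inS s \<in> carrier XST" "inT t \<in> carrier XST"
    using lie_hom_closed[OF coprod_facts(2)] lie_hom_closed[OF coprod_facts(3)] assms by simp_all
  have "lie_coprod_to_prod XS XT (inS s \<otimes>\<^bsub>XST\<^esub> inT t) = (\<zero>\<^bsub>X\<^esub>, \<zero>\<^bsub>X\<^esub>)"
    using c by (simp add: lie_homD(4)[OF p(1) ci] p(2,3) assms lie_prod_ops)
  moreover have "lie_copair X (\<lambda>a. a) (\<lambda>b. b) (inS s \<otimes>\<^bsub>XST\<^esub> inT t) = s \<otimes>\<^bsub>X\<^esub> t"
    by (simp add: lie_homD(4)[OF r(1) ci] r assms)
  ultimately show ?thesis
    using ci unfolding higgins_commutator_def Let_def
    by (intro image_eqI[of _ _ "inS s \<otimes>\<^bsub>XST\<^esub> inT t"]) (auto simp: a_kernel_iff lie_prod_ops)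
qed

text \<open>The hypothesis says that \<open>h\<close> restricted to \<open>S\<close> and \<open>T\<close> extends to the product \<open>S \<times> T\<close>, so on
  the coproduct \<open>h\<close> factors through the comparison map.\<close>

lemma hom_higgins_commutator:
  assumes E: "lie_algebra R E" and h: "h \<in> lie_hom R X E"
    and z: "\<And>s t. \<lbrakk>s \<in> S; t \<in> T\<rbrakk> \<Longrightarrow> h s \<otimes>\<^bsub>E\<^esub> h t = \<zero>\<^bsub>E\<^esub>"
    and y: "y \<in> higgins_commutator R X S T"
  shows "h y = \<zero>\<^bsub>E\<^esub>"
proof -
  interpret X: lie_algebra R X by (rule X)
  interpret E: lie_algebra R E by (rule E)
  note r = coprod_copair[OF X incl_hom] and p = coprod_to_prod_facts
  have SX: "s \<in> carrier X" if "s \<in> S" for s using that lie_subalgebra_subset[OF S] by auto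
  have TX: "s \<in> carrier X" if "s \<in> T" for s using that lie_subalgebra_subset[OF T] by auto
  note [simp] = lie_hom_closed[OF h] SX TX
  have z': "h t \<otimes>\<^bsub>E\<^esub> h s = \<zero>\<^bsub>E\<^esub>" if "s \<in> S" "t \<in> T" for s t
    using that z[OF that] by (subst E.bracket_anti) simp_all
  define q where "q = (\<lambda>(s, t). h s \<oplus>\<^bsub>E\<^esub> h t)"
  have q: "q \<in> lie_hom R (lie_prod XS XT) E"
    by (auto simp: lie_hom_def lie_prod_ops q_def lie_homD[OF h] E.smult_r_distr E.bracket_bilinear z z' E.M.a_ac)
  obtain x where x: "x \<in> carrier XST" "lie_coprod_to_prod XS XT x = (\<zero>\<^bsub>X\<^esub>, \<zero>\<^bsub>X\<^esub>)"
    "y = lie_copair X (\<lambda>a. a) (\<lambda>b. b) x"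
    using y by (auto simp: higgins_commutator_def Let_def a_kernel_iff lie_prod_ops)
  have h0: "h \<zero>\<^bsub>X\<^esub> = \<zero>\<^bsub>E\<^esub>" by (rule lie_hom_zero[OF X E h])
  have "h (lie_copair X (\<lambda>a. a) (\<lambda>b. b) x) = q (lie_coprod_to_prod XS XT x)"
    by (rule coprod_hom_ext[OF E lie_hom_compose[OF _ h] lie_hom_compose[OF p(1) q]])
      (use r p x h0 in \<open>auto simp: q_def\<close>)
  then show ?thesis using x h0 by (simp add: q_def)
qed

end

section \<open>Ideals, normal closures and joins\<close>

lemma lie_idealI:
  assumes "lie_algebra R A" "I \<subseteq> carrier A" "\<zero>\<^bsub>A\<^esub> \<in> I"
    "\<And>x y. \<lbrakk>x \<in> I; y \<in> I\<rbrakk> \<Longrightarrow> x \<oplus>\<^bsub>A\<^esub> y \<in> I"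
    "\<And>r x. \<lbrakk>r \<in> carrier R; x \<in> I\<rbrakk> \<Longrightarrow> r \<odot>\<^bsub>A\<^esub> x \<in> I"
    "\<And>x y. \<lbrakk>x \<in> carrier A; y \<in> I\<rbrakk> \<Longrightarrow> x \<otimes>\<^bsub>A\<^esub> y \<in> I"
  shows "lie_ideal I R A"
proof -
  interpret A: lie_algebra R A by fact
  have "\<ominus>\<^bsub>A\<^esub> x \<in> I" if "x \<in> I" for x
    using assms(5)[of "\<ominus>\<^bsub>R\<^esub> \<one>\<^bsub>R\<^esub>" x] that assms(2) by (auto simp: A.smult_l_minus)
  then show ?thesis
    using assms by (auto simp: lie_ideal_def intro!: A.submoduleI)
qed

lemma lie_idealD:
  assumes "lie_algebra R A" "lie_ideal I R A"
  shows "x \<in> I \<Longrightarrow> x \<in> carrier A" "\<zero>\<^bsub>A\<^esub> \<in> I"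
    "x \<in> I \<Longrightarrow> y \<in> I \<Longrightarrow> x \<oplus>\<^bsub>A\<^esub> y \<in> I"
    "r \<in> carrier R \<Longrightarrow> x \<in> I \<Longrightarrow> r \<odot>\<^bsub>A\<^esub> x \<in> I"
    "x \<in> carrier A \<Longrightarrow> y \<in> I \<Longrightarrow> x \<otimes>\<^bsub>A\<^esub> y \<in> I"
proof -
  interpret A: lie_algebra R A by fact
  interpret S: submodule I R A using assms(2) by (simp add: lie_ideal_def)
  show "x \<in> I \<Longrightarrow> x \<in> carrier A" "\<zero>\<^bsub>A\<^esub> \<in> I"
    "x \<in> I \<Longrightarrow> y \<in> I \<Longrightarrow> x \<oplus>\<^bsub>A\<^esub> y \<in> I"
    "r \<in> carrier R \<Longrightarrow> x \<in> I \<Longrightarrow> r \<odot>\<^bsub>A\<^esub> x \<in> I"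
    "x \<in> carrier A \<Longrightarrow> y \<in> I \<Longrightarrow> x \<otimes>\<^bsub>A\<^esub> y \<in> I"
    using assms(2) S.subset A.submoduleE[OF S.submodule_axioms] S.one_closed by (auto simp: lie_ideal_def)
qed

lemma lie_normal_closure_ideal:
  assumes A: "lie_algebra R A" and S: "S \<subseteq> carrier A"
  shows "lie_ideal (lie_normal_closure R A S) R A" "S \<subseteq> lie_normal_closure R A S"
proof -
  interpret A: lie_algebra R A by fact
  \<comment> \<open>The whole algebra belongs to the intersected family, which keeps the closure
    inside the carrier.\<close>
  have c: "lie_ideal (carrier A) R A" by (rule lie_idealI[OF A]) auto
  show "lie_ideal (lie_normal_closure R A S) R A"
    unfolding lie_normal_closure_def
  proof (rule lie_idealI[OF A])
    show "\<Inter>{I. lie_ideal I R A \<and> S \<subseteq> I} \<subseteq> carrier A" using c S by blast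
  qed (auto intro: lie_idealD(2-5)[OF A])
  show "S \<subseteq> lie_normal_closure R A S" by (auto simp: lie_normal_closure_def)
qed

text \<open>The join is taken among subalgebras, but for ideals it is the sum I + J, which is again
  an ideal. This makes the quotient by the join of the two commutators a Lie algebra.\<close>

lemma lie_join_ideal:
  assumes A: "lie_algebra R A" and I: "lie_ideal I R A" and J: "lie_ideal J R A"
  shows "lie_ideal (lie_join R A I J) R A" "I \<subseteq> lie_join R A I J" "J \<subseteq> lie_join R A I J"
proof -
  interpret A: lie_algebra R A by fact
  note i = lie_idealD[OF A I] and j = lie_idealD[OF A J]
  let ?K = "{x \<oplus>\<^bsub>A\<^esub> y | x y. x \<in> I \<and> y \<in> J}"
  have "lie_ideal ?K R A"
  proof (rule lie_idealI[OF A])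
    show "?K \<subseteq> carrier A" using i(1) j(1) by auto
    have "\<zero>\<^bsub>A\<^esub> = \<zero>\<^bsub>A\<^esub> \<oplus>\<^bsub>A\<^esub> \<zero>\<^bsub>A\<^esub>" by simp
    then show "\<zero>\<^bsub>A\<^esub> \<in> ?K" using i(2) j(2) by blast
  next
    fix u v assume "u \<in> ?K" "v \<in> ?K"
    then obtain x y x' y' where [simp]: "u = x \<oplus>\<^bsub>A\<^esub> y" "v = x' \<oplus>\<^bsub>A\<^esub> y'"
      and m: "x \<in> I" "x' \<in> I" "y \<in> J" "y' \<in> J" by auto
    have "u \<oplus>\<^bsub>A\<^esub> v = (x \<oplus>\<^bsub>A\<^esub> x') \<oplus>\<^bsub>A\<^esub> (y \<oplus>\<^bsub>A\<^esub> y')"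
      using m i(1) j(1) by (simp add: A.M.a_ac)
    then show "u \<oplus>\<^bsub>A\<^esub> v \<in> ?K" using m i(3) j(3) by blast
  next
    fix r u assume r: "r \<in> carrier R" "u \<in> ?K"
    then obtain x y where [simp]: "u = x \<oplus>\<^bsub>A\<^esub> y" and m: "x \<in> I" "y \<in> J" by auto
    have "r \<odot>\<^bsub>A\<^esub> u = r \<odot>\<^bsub>A\<^esub> x \<oplus>\<^bsub>A\<^esub> r \<odot>\<^bsub>A\<^esub> y"
      using m i(1) j(1) r by (simp add: A.smult_r_distr)
    then show "r \<odot>\<^bsub>A\<^esub> u \<in> ?K" using m i(4) j(4) r by blast
  next
    fix z u assume r: "z \<in> carrier A" "u \<in> ?K"
    then obtain x y where [simp]: "u = x \<oplus>\<^bsub>A\<^esub> y" and m: "x \<in> I" "y \<in> J" by auto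
    have "z \<otimes>\<^bsub>A\<^esub> u = z \<otimes>\<^bsub>A\<^esub> x \<oplus>\<^bsub>A\<^esub> z \<otimes>\<^bsub>A\<^esub> y"
      using m i(1) j(1) r by (simp add: A.bracket_add_r)
    then show "z \<otimes>\<^bsub>A\<^esub> u \<in> ?K" using m i(5) j(5) r by blast
  qed
  moreover have "lie_join R A I J = ?K"
  proof
    have "x \<in> ?K" if "x \<in> I" for x
      using that i(1)[OF that] j(2) by (intro CollectI exI[of _ x] exI[of _ "\<zero>\<^bsub>A\<^esub>"]) simp
    moreover have "x \<in> ?K" if "x \<in> J" for x
      using that j(1)[OF that] i(2) by (intro CollectI exI[of _ x] exI[of _ "\<zero>\<^bsub>A\<^esub>"]) simp
    ultimately show "lie_join R A I J \<subseteq> ?K"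
      using lie_ideal_subalgebra[OF A \<open>lie_ideal ?K R A\<close>] unfolding lie_join_def by blast
    show "?K \<subseteq> lie_join R A I J"
      by (auto simp: lie_join_def lie_subalgebra_def intro!: A.submoduleE(5))
  qed
  ultimately show "lie_ideal (lie_join R A I J) R A" by simp
  show "I \<subseteq> lie_join R A I J" "J \<subseteq> lie_join R A I J" by (auto simp: lie_join_def)
qed

text \<open>Together with \<open>hom_huq_commutator\<close> this is all that the comparison uses of
  the commutators: they contain the brackets, and morphisms that make S and T commute annihilate
  them.\<close>

lemma huq_commutator_ideal:
  assumes "lie_algebra R X" "lie_ideal S R X" "lie_ideal T R X"
  shows "lie_ideal (huq_commutator R X S T) R X"
    and "s \<in> S \<Longrightarrow> t \<in> T \<Longrightarrow> s \<otimes>\<^bsub>X\<^esub> t \<in> huq_commutator R X S T"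
proof -
  note sub = lie_ideal_subalgebra[OF assms(1,2)] lie_ideal_subalgebra[OF assms(1,3)]
  note N = lie_normal_closure_ideal[OF assms(1) higgins_commutator_subset[OF assms(1) sub]]
  show "lie_ideal (huq_commutator R X S T) R X"
    unfolding huq_commutator_def by (rule N)
  show "s \<otimes>\<^bsub>X\<^esub> t \<in> huq_commutator R X S T" if "s \<in> S" "t \<in> T"
    using N(2) bracket_in_higgins_commutator[OF assms(1) sub that] by (auto simp: huq_commutator_def)
qed

text \<open>The kernel of h is an ideal, so it contains the normal closure as soon as it contains
  the Higgins commutator.\<close>

lemma hom_huq_commutator:
  assumes "lie_algebra R X" "lie_ideal S R X" "lie_ideal T R X"
    and "lie_algebra R E" and "h \<in> lie_hom R X E"
    and "\<And>s t. \<lbrakk>s \<in> S; t \<in> T\<rbrakk> \<Longrightarrow> h s \<otimes>\<^bsub>E\<^esub> h t = \<zero>\<^bsub>E\<^esub>"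
  shows "huq_commutator R X S T \<subseteq> a_kernel X E h"
proof -
  note sub = lie_ideal_subalgebra[OF assms(1,2)] lie_ideal_subalgebra[OF assms(1,3)]
  have "higgins_commutator R X S T \<subseteq> a_kernel X E h"
    using higgins_commutator_subset[OF assms(1) sub] hom_higgins_commutator[OF assms(1) sub assms(4-6)]
    by (auto simp: a_kernel_iff)
  then show ?thesis
    using a_kernel_lie_ideal[OF assms(1,4,5)] by (auto simp: huq_commutator_def lie_normal_closure_def)
qed

text \<open>Induction on terms: each class arises from classes of generators by the
  operations.\<close>

lemma lie_pres_generated:
  assumes R: "cring R" and "\<And>g. g \<in> G \<Longrightarrow> lie_class R G E (LGen g) \<in> U" and "\<zero>\<^bsub>lie_pres R G E\<^esub> \<in> U"
    and "\<And>x y. \<lbrakk>x \<in> carrier (lie_pres R G E); y \<in> carrier (lie_pres R G E); x \<in> U; y \<in> U\<rbrakk> \<Longrightarrow> x \<oplus>\<^bsub>lie_pres R G E\<^esub> y \<in> U"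
    and "\<And>r x. \<lbrakk>r \<in> carrier R; x \<in> carrier (lie_pres R G E); x \<in> U\<rbrakk> \<Longrightarrow> r \<odot>\<^bsub>lie_pres R G E\<^esub> x \<in> U"
    and "\<And>x y. \<lbrakk>x \<in> carrier (lie_pres R G E); y \<in> carrier (lie_pres R G E); x \<in> U; y \<in> U\<rbrakk> \<Longrightarrow> x \<otimes>\<^bsub>lie_pres R G E\<^esub> y \<in> U"
    and x: "x \<in> carrier (lie_pres R G E)"
  shows "x \<in> U"
proof -
  have "lie_class R G E t \<in> U" if "lie_wf R G t" for t
    using that
  proof (induction t)
    case LZero
    then show ?case using assms(3) by (simp add: lie_pres_zero[OF R])
  next
    case (LAdd s t)
    then show ?case using assms(4)[of "lie_class R G E s" "lie_class R G E t"]
      by (simp add: lie_pres_add[OF R] lie_pres_carrier[OF R])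
  next
    case (LSmult r t)
    then show ?case using assms(5)[of r "lie_class R G E t"]
      by (simp add: lie_pres_smult[OF R] lie_pres_carrier[OF R])
  next
    case (LBracket s t)
    then show ?case using assms(6)[of "lie_class R G E s" "lie_class R G E t"]
      by (simp add: lie_pres_bracket[OF R] lie_pres_carrier[OF R])
  qed (use assms(2) in simp)
  then show ?thesis using x by (auto simp: lie_pres_carrier[OF R])
qed

section \<open>Ellis' tensor product\<close>

locale lie_crossed_pair =
  M: lie_crossed_module R L M actM \<mu> + N: lie_crossed_module R L N actN \<nu>
  for R :: "('r, 'x) ring_scheme"
    and L :: "('r, 'l, 'w) module_scheme"
    and M :: "('r, 'm, 'y) module_scheme"
    and N :: "('r, 'n, 'z) module_scheme"
    and actM :: "'l \<Rightarrow> 'm \<Rightarrow> 'm" and \<mu> :: "'m \<Rightarrow> 'l"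
    and actN :: "'l \<Rightarrow> 'n \<Rightarrow> 'n" and \<nu> :: "'n \<Rightarrow> 'l"
begin

abbreviation T where "T \<equiv> lie_tensor R M N (\<lambda>m. actN (\<mu> m)) (\<lambda>n. actM (\<nu> n))"
abbreviation rels where "rels \<equiv> lie_tensor_rels R M N (\<lambda>m. actN (\<mu> m)) (\<lambda>n. actM (\<nu> n))"

definition tens where "tens m n = lie_class R (carrier M \<times> carrier N) rels (LGen (m, n))"
definition tlift where "tlift D f = lie_pres_lift D (\<lambda>(m, n). f m n)"

lemma R_cring: "cring R" by (rule M.is_cring)

sublocale T: lie_algebra R T
  unfolding lie_tensor_def by (rule lie_pres_lie_algebra[OF R_cring])

lemma tens_closed: "\<lbrakk>m \<in> carrier M; n \<in> carrier N\<rbrakk> \<Longrightarrow> tens m n \<in> carrier T"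
  by (simp add: tens_def lie_tensor_def lie_pres_carrier[OF R_cring])

lemma mu_closed: "m \<in> carrier M \<Longrightarrow> \<mu> m \<in> carrier L"
  by (rule lie_hom_closed[OF M.boundary_hom])

lemma nu_closed: "n \<in> carrier N \<Longrightarrow> \<nu> n \<in> carrier L"
  by (rule lie_hom_closed[OF N.boundary_hom])

lemmas closed [simp] = tens_closed mu_closed nu_closed M.act_closed N.act_closed

lemmas mu_hom = lie_homD(2-4)[OF M.boundary_hom]
  lie_hom_diff[OF M.M.lie_algebra_axioms M.L.lie_algebra_axioms M.boundary_hom]
  lie_hom_zero[OF M.M.lie_algebra_axioms M.L.lie_algebra_axioms M.boundary_hom]
  M.equivariance M.peiffer
lemmas nu_hom = lie_homD(2-4)[OF N.boundary_hom]
  lie_hom_diff[OF N.M.lie_algebra_axioms M.L.lie_algebra_axioms N.boundary_hom]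
  lie_hom_zero[OF N.M.lie_algebra_axioms M.L.lie_algebra_axioms N.boundary_hom]
  N.equivariance N.peiffer

lemma T_LSmult: "\<lbrakk>r \<in> carrier R; lie_wf R (carrier M \<times> carrier N) t\<rbrakk> \<Longrightarrow>
    lie_class R (carrier M \<times> carrier N) rels (LSmult r t) = r \<odot>\<^bsub>T\<^esub> lie_class R (carrier M \<times> carrier N) rels t"
  by (simp add: lie_tensor_def lie_pres_smult[OF R_cring])

lemma T_LAdd: "\<lbrakk>lie_wf R (carrier M \<times> carrier N) s; lie_wf R (carrier M \<times> carrier N) t\<rbrakk> \<Longrightarrow>
    lie_class R (carrier M \<times> carrier N) rels (LAdd s t) =
    lie_class R (carrier M \<times> carrier N) rels s \<oplus>\<^bsub>T\<^esub> lie_class R (carrier M \<times> carrier N) rels t"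
  by (simp add: lie_tensor_def lie_pres_add[OF R_cring])

lemma T_LBracket: "\<lbrakk>lie_wf R (carrier M \<times> carrier N) s; lie_wf R (carrier M \<times> carrier N) t\<rbrakk> \<Longrightarrow>
    lie_class R (carrier M \<times> carrier N) rels (LBracket s t) =
    lie_class R (carrier M \<times> carrier N) rels s \<otimes>\<^bsub>T\<^esub> lie_class R (carrier M \<times> carrier N) rels t"
  by (simp add: lie_tensor_def lie_pres_bracket[OF R_cring])

lemma tens_rels:
  shows tens_smult_l: "\<lbrakk>r \<in> carrier R; m \<in> carrier M; n \<in> carrier N\<rbrakk> \<Longrightarrow> tens (r \<odot>\<^bsub>M\<^esub> m) n = r \<odot>\<^bsub>T\<^esub> tens m n"
    and tens_smult_r: "\<lbrakk>r \<in> carrier R; m \<in> carrier M; n \<in> carrier N\<rbrakk> \<Longrightarrow> tens m (r \<odot>\<^bsub>N\<^esub> n) = r \<odot>\<^bsub>T\<^esub> tens m n"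
    and tens_add_l: "\<lbrakk>m \<in> carrier M; m' \<in> carrier M; n \<in> carrier N\<rbrakk> \<Longrightarrow>
      tens (m \<oplus>\<^bsub>M\<^esub> m') n = tens m n \<oplus>\<^bsub>T\<^esub> tens m' n"
    and tens_add_r: "\<lbrakk>m \<in> carrier M; n \<in> carrier N; n' \<in> carrier N\<rbrakk> \<Longrightarrow>
      tens m (n \<oplus>\<^bsub>N\<^esub> n') = tens m n \<oplus>\<^bsub>T\<^esub> tens m n'"
    and tens_bracket_l: "\<lbrakk>m \<in> carrier M; m' \<in> carrier M; n \<in> carrier N\<rbrakk> \<Longrightarrow>
      tens (m \<otimes>\<^bsub>M\<^esub> m') n = tens m (actN (\<mu> m') n) \<ominus>\<^bsub>T\<^esub> tens m' (actN (\<mu> m) n)"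
    and tens_bracket_r: "\<lbrakk>m \<in> carrier M; n \<in> carrier N; n' \<in> carrier N\<rbrakk> \<Longrightarrow>
      tens m (n \<otimes>\<^bsub>N\<^esub> n') = tens (actM (\<nu> n') m) n \<ominus>\<^bsub>T\<^esub> tens (actM (\<nu> n) m) n'"
    and bracket_tens: "\<lbrakk>m \<in> carrier M; m' \<in> carrier M; n \<in> carrier N; n' \<in> carrier N\<rbrakk> \<Longrightarrow>
      tens m n \<otimes>\<^bsub>T\<^esub> tens m' n' = \<ominus>\<^bsub>T\<^esub> tens (actM (\<nu> n) m) (actN (\<mu> m') n')"
proof -
  have rel: "lie_class R (carrier M \<times> carrier N) rels s = lie_class R (carrier M \<times> carrier N) rels t"
    if "(s, t) \<in> rels" "lie_wf R (carrier M \<times> carrier N) s" "lie_wf R (carrier M \<times> carrier N) t" for s t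
    using lie_pres_rel[OF R_cring that] .
  note [simp] = T_LSmult T_LAdd T_LBracket LNeg_def LMinus_def tens_def T.smult_l_minus a_minus_def
  note [simp] = tens_closed[unfolded tens_def]
  show "tens (r \<odot>\<^bsub>M\<^esub> m) n = r \<odot>\<^bsub>T\<^esub> tens m n"
    if "r \<in> carrier R" "m \<in> carrier M" "n \<in> carrier N" for r m n
  proof -
    have "(LGen (r \<odot>\<^bsub>M\<^esub> m, n), LSmult r (LGen (m, n))) \<in> rels"
      using that by (auto simp: lie_tensor_rels_def)
    from rel[OF this] that show ?thesis by simp
  qed
  show "tens m (r \<odot>\<^bsub>N\<^esub> n) = r \<odot>\<^bsub>T\<^esub> tens m n"
    if "r \<in> carrier R" "m \<in> carrier M" "n \<in> carrier N" for r m n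
  proof -
    have "(LGen (m, r \<odot>\<^bsub>N\<^esub> n), LSmult r (LGen (m, n))) \<in> rels"
      using that by (auto simp: lie_tensor_rels_def)
    from rel[OF this] that show ?thesis by simp
  qed
  show "tens (m \<oplus>\<^bsub>M\<^esub> m') n = tens m n \<oplus>\<^bsub>T\<^esub> tens m' n"
    if "m \<in> carrier M" "m' \<in> carrier M" "n \<in> carrier N" for m m' n
  proof -
    have "(LGen (m \<oplus>\<^bsub>M\<^esub> m', n), LAdd (LGen (m, n)) (LGen (m', n))) \<in> rels"
      using that by (auto simp: lie_tensor_rels_def)
    from rel[OF this] that show ?thesis by simp
  qed
  show "tens m (n \<oplus>\<^bsub>N\<^esub> n') = tens m n \<oplus>\<^bsub>T\<^esub> tens m n'"
    if "m \<in> carrier M" "n \<in> carrier N" "n' \<in> carrier N" for m n n'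
  proof -
    have "(LGen (m, n \<oplus>\<^bsub>N\<^esub> n'), LAdd (LGen (m, n)) (LGen (m, n'))) \<in> rels"
      using that by (auto simp: lie_tensor_rels_def)
    from rel[OF this] that show ?thesis by simp
  qed
  show "tens (m \<otimes>\<^bsub>M\<^esub> m') n = tens m (actN (\<mu> m') n) \<ominus>\<^bsub>T\<^esub> tens m' (actN (\<mu> m) n)"
    if "m \<in> carrier M" "m' \<in> carrier M" "n \<in> carrier N" for m m' n
  proof -
    have "(LGen (m \<otimes>\<^bsub>M\<^esub> m', n), LMinus R (LGen (m, actN (\<mu> m') n)) (LGen (m', actN (\<mu> m) n))) \<in> rels"
      using that by (auto simp: lie_tensor_rels_def)
    from rel[OF this] that show ?thesis by simp
  qed
  show "tens m (n \<otimes>\<^bsub>N\<^esub> n') = tens (actM (\<nu> n') m) n \<ominus>\<^bsub>T\<^esub> tens (actM (\<nu> n) m) n'"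
    if "m \<in> carrier M" "n \<in> carrier N" "n' \<in> carrier N" for m n n'
  proof -
    have "(LGen (m, n \<otimes>\<^bsub>N\<^esub> n'), LMinus R (LGen (actM (\<nu> n') m, n)) (LGen (actM (\<nu> n) m, n'))) \<in> rels"
      using that by (auto simp: lie_tensor_rels_def)
    from rel[OF this] that show ?thesis by simp
  qed
  show "tens m n \<otimes>\<^bsub>T\<^esub> tens m' n' = \<ominus>\<^bsub>T\<^esub> tens (actM (\<nu> n) m) (actN (\<mu> m') n')"
    if "m \<in> carrier M" "m' \<in> carrier M" "n \<in> carrier N" "n' \<in> carrier N" for m m' n n'
  proof -
    have "(LBracket (LGen (m, n)) (LGen (m', n')), LNeg R (LGen (actM (\<nu> n) m, actN (\<mu> m') n'))) \<in> rels"
      using that by (auto simp: lie_tensor_rels_def)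
    from rel[OF this] that show ?thesis by simp
  qed
qed

lemma tens_diff_l:
  assumes "m \<in> carrier M" "m' \<in> carrier M" "n \<in> carrier N"
  shows "tens (m \<ominus>\<^bsub>M\<^esub> m') n = tens m n \<ominus>\<^bsub>T\<^esub> tens m' n"
  using tens_add_l[of "m \<ominus>\<^bsub>M\<^esub> m'" m' n] assms by (simp add: M.M.M.add_diff_cancel T.M.diff_simps(6))

lemma tens_diff_r:
  assumes "m \<in> carrier M" "n \<in> carrier N" "n' \<in> carrier N"
  shows "tens m (n \<ominus>\<^bsub>N\<^esub> n') = tens m n \<ominus>\<^bsub>T\<^esub> tens m n'"
  using tens_add_r[of m "n \<ominus>\<^bsub>N\<^esub> n'" n'] assms by (simp add: N.M.M.add_diff_cancel T.M.diff_simps(6))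

lemma tens_zero_l: "n \<in> carrier N \<Longrightarrow> tens \<zero>\<^bsub>M\<^esub> n = \<zero>\<^bsub>T\<^esub>"
  using tens_smult_l[of "\<zero>\<^bsub>R\<^esub>" "\<zero>\<^bsub>M\<^esub>" n] by simp

lemma tens_zero_r: "m \<in> carrier M \<Longrightarrow> tens m \<zero>\<^bsub>N\<^esub> = \<zero>\<^bsub>T\<^esub>"
  using tens_smult_r[of "\<zero>\<^bsub>R\<^esub>" m "\<zero>\<^bsub>N\<^esub>"] by simp

lemmas tens_bilinear = tens_smult_l tens_smult_r tens_add_l tens_add_r tens_diff_l tens_diff_r tens_zero_l tens_zero_r

text \<open>Ellis' relations read for a function with values in D; such functions extend to
  morphisms on \<open>T\<close>. The eighth clause, on brackets of generators, is the one that later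
  proofs treat separately.\<close>

definition lie_pairing where
  "lie_pairing D f \<longleftrightarrow>
    (\<forall>m\<in>carrier M. \<forall>n\<in>carrier N. f m n \<in> carrier D) \<and>
    (\<forall>r\<in>carrier R. \<forall>m\<in>carrier M. \<forall>n\<in>carrier N. f (r \<odot>\<^bsub>M\<^esub> m) n = r \<odot>\<^bsub>D\<^esub> f m n) \<and>
    (\<forall>r\<in>carrier R. \<forall>m\<in>carrier M. \<forall>n\<in>carrier N. f m (r \<odot>\<^bsub>N\<^esub> n) = r \<odot>\<^bsub>D\<^esub> f m n) \<and>
    (\<forall>m\<in>carrier M. \<forall>m'\<in>carrier M. \<forall>n\<in>carrier N. f (m \<oplus>\<^bsub>M\<^esub> m') n = f m n \<oplus>\<^bsub>D\<^esub> f m' n) \<and>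
    (\<forall>m\<in>carrier M. \<forall>n\<in>carrier N. \<forall>n'\<in>carrier N. f m (n \<oplus>\<^bsub>N\<^esub> n') = f m n \<oplus>\<^bsub>D\<^esub> f m n') \<and>
    (\<forall>m\<in>carrier M. \<forall>m'\<in>carrier M. \<forall>n\<in>carrier N.
      f (m \<otimes>\<^bsub>M\<^esub> m') n = f m (actN (\<mu> m') n) \<ominus>\<^bsub>D\<^esub> f m' (actN (\<mu> m) n)) \<and>
    (\<forall>m\<in>carrier M. \<forall>n\<in>carrier N. \<forall>n'\<in>carrier N.
      f m (n \<otimes>\<^bsub>N\<^esub> n') = f (actM (\<nu> n') m) n \<ominus>\<^bsub>D\<^esub> f (actM (\<nu> n) m) n') \<and>
    (\<forall>m\<in>carrier M. \<forall>m'\<in>carrier M. \<forall>n\<in>carrier N. \<forall>n'\<in>carrier N.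
      f m n \<otimes>\<^bsub>D\<^esub> f m' n' = \<ominus>\<^bsub>D\<^esub> f (actM (\<nu> n) m) (actN (\<mu> m') n'))"

lemma tlift:
  assumes "lie_algebra R D" and f: "lie_pairing D f"
  shows "tlift D f \<in> lie_hom R T D" "\<lbrakk>m \<in> carrier M; n \<in> carrier N\<rbrakk> \<Longrightarrow> tlift D f (tens m n) = f m n"
proof -
  interpret D: lie_algebra R D by fact
  have gen: "(case x of (m, n) \<Rightarrow> f m n) \<in> carrier D" if "x \<in> carrier M \<times> carrier N" for x
    using that f by (auto simp: lie_pairing_def)
  have rels: "lie_eval D (\<lambda>(m, n). f m n) s = lie_eval D (\<lambda>(m, n). f m n) t"
    if "(s, t) \<in> rels" for s t
    using that f
    by (auto simp: lie_pairing_def lie_tensor_rels_def LMinus_def LNeg_def D.smult_l_minus a_minus_def)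
  show "tlift D f \<in> lie_hom R T D"
    unfolding tlift_def lie_tensor_def by (rule lie_pres_lift_hom[OF R_cring assms(1) gen rels])
  show "\<lbrakk>m \<in> carrier M; n \<in> carrier N\<rbrakk> \<Longrightarrow> tlift D f (tens m n) = f m n"
    unfolding tlift_def tens_def
    using lie_pres_lift_gen[OF R_cring assms(1) gen rels, where g = "(m, n)"] by simp
qed

text \<open>As a module, \<open>T\<close> is spanned by the generators, since brackets of generators are again
  (negatives of) generators.\<close>

lemma tens_induct [consumes 1, case_names zero tens add]:
  assumes x: "x \<in> carrier T" and z: "P \<zero>\<^bsub>T\<^esub>"
    and t: "\<And>m n. \<lbrakk>m \<in> carrier M; n \<in> carrier N\<rbrakk> \<Longrightarrow> P (tens m n)"
    and a: "\<And>x y. \<lbrakk>x \<in> carrier T; y \<in> carrier T; P x; P y\<rbrakk> \<Longrightarrow> P (x \<oplus>\<^bsub>T\<^esub> y)"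
  shows "P x"
proof -
  define S where "S = \<Inter>{U. U \<subseteq> carrier T \<and> \<zero>\<^bsub>T\<^esub> \<in> U \<and> (\<forall>m\<in>carrier M. \<forall>n\<in>carrier N. tens m n \<in> U) \<and>
      (\<forall>x\<in>U. \<forall>y\<in>U. x \<oplus>\<^bsub>T\<^esub> y \<in> U)}"
  have SI: "\<zero>\<^bsub>T\<^esub> \<in> S" "\<And>m n. \<lbrakk>m \<in> carrier M; n \<in> carrier N\<rbrakk> \<Longrightarrow> tens m n \<in> S"
    "\<And>x y. \<lbrakk>x \<in> S; y \<in> S\<rbrakk> \<Longrightarrow> x \<oplus>\<^bsub>T\<^esub> y \<in> S"
    by (auto simp: S_def)
  have SE: "Q x" if "x \<in> S" "Q \<zero>\<^bsub>T\<^esub>" "\<And>m n. \<lbrakk>m \<in> carrier M; n \<in> carrier N\<rbrakk> \<Longrightarrow> Q (tens m n)"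
    "\<And>x y. \<lbrakk>x \<in> carrier T; y \<in> carrier T; Q x; Q y\<rbrakk> \<Longrightarrow> Q (x \<oplus>\<^bsub>T\<^esub> y)" for Q x
  proof -
    have "S \<subseteq> {x \<in> carrier T. Q x}" unfolding S_def using that by (intro Inter_lower) auto
    then show ?thesis using that(1) by auto
  qed
  have Sc: "x \<in> carrier T" if "x \<in> S" for x by (rule SE[OF that]) auto
  \<comment> \<open>Scalars and signs are absorbed into the first factor of a generator, so closure
    under scalars follows from additive closure.\<close>
  have Ss: "r \<odot>\<^bsub>T\<^esub> x \<in> S" if r: "r \<in> carrier R" and "x \<in> S" for r x
    by (rule SE[OF \<open>x \<in> S\<close>]) (use r SI in \<open>auto simp: T.smult_r_distr simp flip: tens_smult_l\<close>)
  have Sn: "\<ominus>\<^bsub>T\<^esub> x \<in> S" if "x \<in> S" for x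
    using Ss[OF _ that, of "\<ominus>\<^bsub>R\<^esub> \<one>\<^bsub>R\<^esub>"] Sc[OF that] by (simp add: T.smult_l_minus)
  have Sb: "x \<otimes>\<^bsub>T\<^esub> y \<in> S" if "x \<in> S" "y \<in> S" for x y
  proof (rule SE[OF \<open>x \<in> S\<close>])
    fix m n assume mn: "m \<in> carrier M" "n \<in> carrier N"
    show "tens m n \<otimes>\<^bsub>T\<^esub> y \<in> S"
      by (rule SE[OF \<open>y \<in> S\<close>]) (use mn SI Sn in \<open>auto simp: bracket_tens T.bracket_bilinear\<close>)
  qed (use Sc[OF that(2)] SI in \<open>auto simp: T.bracket_bilinear\<close>)
  have "x \<in> S"
    by (rule lie_pres_generated[OF R_cring _ _ _ _ _ x[unfolded lie_tensor_def], of S])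
      (use SI Ss Sb in \<open>auto simp: tens_def lie_tensor_def\<close>)
  then show ?thesis using SE[of x P] z t a by blast
qed

text \<open>The generators span \<open>T\<close> additively, and 0 is the generator 0 \<otimes> 0.
  This also compares maps that do not preserve brackets, such as the action of a fixed element or a
  bracket with one argument fixed.\<close>

lemma additive_ext:
  assumes "lie_algebra R D" "x \<in> carrier T"
    and "\<And>m n. \<lbrakk>m \<in> carrier M; n \<in> carrier N\<rbrakk> \<Longrightarrow> u (tens m n) = v (tens m n)"
    and "\<And>x y. \<lbrakk>x \<in> carrier T; y \<in> carrier T\<rbrakk> \<Longrightarrow> u (x \<oplus>\<^bsub>T\<^esub> y) = u x \<oplus>\<^bsub>D\<^esub> u y"
    and "\<And>x y. \<lbrakk>x \<in> carrier T; y \<in> carrier T\<rbrakk> \<Longrightarrow> v (x \<oplus>\<^bsub>T\<^esub> y) = v x \<oplus>\<^bsub>D\<^esub> v y"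
  shows "u x = v x"
  using assms(2)
proof (induction x rule: tens_induct)
  case zero
  then show ?case using assms(3)[of "\<zero>\<^bsub>M\<^esub>" "\<zero>\<^bsub>N\<^esub>"] by (simp add: tens_zero_l)
qed (use assms in auto)

end

section \<open>The diagonal action on the tensor product\<close>

text \<open>A acts by its bracket on its own underlying module, made abelian. The semidirect product
  consists of dual numbers over A: a section a \<mapsto> (d a, a) of its projection is a morphism
  exactly when d is a derivation.\<close>

lemma (in lie_algebra) adjoint_action:
  "lie_action R A (A\<lparr>mult := \<lambda>x y. \<zero>\<^bsub>A\<^esub>\<rparr>) (\<lambda>x y. x \<otimes>\<^bsub>A\<^esub> y)"
proof -
  let ?B = "A\<lparr>mult := \<lambda>x y. \<zero>\<^bsub>A\<^esub>\<rparr>"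
  have ab: "abelian_group ?B"
    by (rule abelian_groupI) (auto simp: M.a_ac intro: bexI[of _ "\<ominus>\<^bsub>A\<^esub> _"] M.l_neg)
  have "module R ?B"
    by (rule moduleI[OF is_cring ab]) (auto simp: smult_l_distr smult_r_distr smult_assoc1)
  then have B: "lie_algebra R ?B"
    by (intro lie_algebra.intro lie_algebra_axioms.intro) auto
  interpret B: lie_algebra R ?B by (rule B)
  have inv: "\<ominus>\<^bsub>?B\<^esub> x = \<ominus>\<^bsub>A\<^esub> x" if "x \<in> carrier A" for x
    using that by (intro B.M.minus_equality) (auto simp: M.l_neg)
  have J: "(x \<otimes>\<^bsub>A\<^esub> y) \<otimes>\<^bsub>A\<^esub> z = x \<otimes>\<^bsub>A\<^esub> (y \<otimes>\<^bsub>A\<^esub> z) \<ominus>\<^bsub>?B\<^esub> y \<otimes>\<^bsub>A\<^esub> (x \<otimes>\<^bsub>A\<^esub> z)"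
    if xyz: "x \<in> carrier A" "y \<in> carrier A" "z \<in> carrier A" for x y z
    using bracket_leibniz[of x y z] xyz
    by (simp add: a_minus_def[of ?B] inv) (simp add: M.diff_simps M.a_ac flip: a_minus_def)
  show ?thesis
    by (intro lie_action.intro lie_action_axioms.intro B lie_algebra_axioms)
      (simp_all add: bracket_bilinear J)
qed

context lie_crossed_pair begin

lemmas T_ext = additive_ext[OF T.lie_algebra_axioms]

abbreviation "dT \<equiv> lie_semidirect (T\<lparr>mult := \<lambda>x y. \<zero>\<^bsub>T\<^esub>\<rparr>) T (\<lambda>x y. x \<otimes>\<^bsub>T\<^esub> y)"

lemmas dT_lie_algebra = lie_action.semidirect_lie_algebra[OF T.adjoint_action]

text \<open>Normalisation of multilinear identities: \<open>expand\<close> distributes over sums,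
  scalars and brackets, and \<open>diffs\<close> with \<open>acs\<close> compares the results. Of
  the relations of \<open>T\<close> only bilinearity is included; the others are added where they
  are wanted.\<close>

lemmas diffs = M.M.M.diff_simps N.M.M.diff_simps M.L.M.diff_simps T.M.diff_simps
lemmas acs = M.M.M.a_ac N.M.M.a_ac M.L.M.a_ac T.M.a_ac
lemmas expand = M.act_bilinear N.act_bilinear M.act_bracket_l N.act_bracket_l M.act_bracket_r N.act_bracket_r
  M.L.bracket_bilinear M.M.bracket_bilinear N.M.bracket_bilinear T.bracket_bilinear tens_bilinear
  M.M.smult_r_distr N.M.smult_r_distr T.smult_r_distr M.L.smult_r_distr
  M.M.smult_diff N.M.smult_diff T.smult_diff M.L.smult_diff

lemma dT_minus: "x \<in> carrier T \<Longrightarrow> \<ominus>\<^bsub>T\<lparr>mult := f\<rparr>\<^esub> x = \<ominus>\<^bsub>T\<^esub> x"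
  by (simp add: a_inv_def)

lemmas dT_semidirect = lie_action.semidirect_minus[OF T.adjoint_action, simplified]

lemma dT_ops: "x \<in> carrier T \<Longrightarrow> y \<in> carrier T \<Longrightarrow> x \<ominus>\<^bsub>T\<lparr>mult := f\<rparr>\<^esub> y = x \<ominus>\<^bsub>T\<^esub> y"
  by (simp add: a_minus_def dT_minus)

text \<open>The derivation of \<open>T\<close> with which \<open>l\<close> acts is the first component of a lift of the generators to
  \<open>dT\<close>, which plays the role of the dual numbers over \<open>T\<close>.\<close>

definition actT where
  "actT l t = fst (tlift dT (\<lambda>m n. (tens (actM l m) n \<oplus>\<^bsub>T\<^esub> tens m (actN l n), tens m n)) t)"

text \<open>In the second component each relation of a pairing is the relation of \<open>T\<close>
  itself; in the first it is the derivative of that relation along l, which follows from the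
  relations of \<open>T\<close> and equivariance.\<close>

lemma actT_lift:
  assumes l: "l \<in> carrier L"
  defines "D \<equiv> tlift dT (\<lambda>m n. (tens (actM l m) n \<oplus>\<^bsub>T\<^esub> tens m (actN l n), tens m n))"
  shows "D \<in> lie_hom R T dT"
    "\<lbrakk>m \<in> carrier M; n \<in> carrier N\<rbrakk> \<Longrightarrow> D (tens m n) = (tens (actM l m) n \<oplus>\<^bsub>T\<^esub> tens m (actN l n), tens m n)"
proof -
  \<comment> \<open>The bracket of \<open>dT\<close> has the derivative of the first factor on the
    right with a minus sign. Swapping restores the Leibniz form, in which
    \<open>bracket_tens\<close> yields the terms of the differentiated relation.\<close>
  have swap: "tens m' n' \<otimes>\<^bsub>T\<^esub> (tens (actM l m) n \<oplus>\<^bsub>T\<^esub> tens m (actN l n)) =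
    \<zero>\<^bsub>T\<^esub> \<ominus>\<^bsub>T\<^esub> (tens (actM l m) n \<oplus>\<^bsub>T\<^esub> tens m (actN l n)) \<otimes>\<^bsub>T\<^esub> tens m' n'"
    if "m \<in> carrier M" "m' \<in> carrier M" "n \<in> carrier N" "n' \<in> carrier N" for m m' n n'
    by (rule T.bracket_swap) (use that l in auto)
  have "lie_pairing dT (\<lambda>m n. (tens (actM l m) n \<oplus>\<^bsub>T\<^esub> tens m (actN l n), tens m n))"
    unfolding lie_pairing_def
  proof (intro conjI ballI, goal_cases)
    case (8 m m' n n')
    then show ?case using l
      by (simp add: dT_semidirect lie_semidirect_ops dT_ops dT_minus swap[OF 8])
        (simp add: expand mu_hom nu_hom bracket_tens diffs acs)
  qed (use l in \<open>simp_all add: dT_semidirect lie_semidirect_ops dT_ops dT_minus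
      expand mu_hom nu_hom tens_bracket_l tens_bracket_r diffs acs\<close>)
  then show "D \<in> lie_hom R T dT"
    "\<lbrakk>m \<in> carrier M; n \<in> carrier N\<rbrakk> \<Longrightarrow> D (tens m n) = (tens (actM l m) n \<oplus>\<^bsub>T\<^esub> tens m (actN l n), tens m n)"
    unfolding D_def by (auto intro: tlift[OF dT_lie_algebra])
qed

lemma actT_tens:
  "\<lbrakk>l \<in> carrier L; m \<in> carrier M; n \<in> carrier N\<rbrakk> \<Longrightarrow> actT l (tens m n) = tens (actM l m) n \<oplus>\<^bsub>T\<^esub> tens m (actN l n)"
  by (simp add: actT_def actT_lift)

text \<open>The second component is additive and fixes the generators, so it is the identity. The
  lift is thus a section of the projection and \<open>actT l\<close> a derivation.\<close>

lemma actT_lift_eq: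
  assumes l: "l \<in> carrier L" and t: "t \<in> carrier T"
  shows "tlift dT (\<lambda>m n. (tens (actM l m) n \<oplus>\<^bsub>T\<^esub> tens m (actN l n), tens m n)) t = (actT l t, t)"
proof -
  let ?D = "tlift dT (\<lambda>m n. (tens (actM l m) n \<oplus>\<^bsub>T\<^esub> tens m (actN l n), tens m n))"
  note D = lie_homD[OF actT_lift(1)[OF l]]
  have snd_add: "snd (x \<oplus>\<^bsub>dT\<^esub> y) = snd x \<oplus>\<^bsub>T\<^esub> snd y" for x y
    by (cases x; cases y) (simp add: lie_semidirect_ops)
  have "snd (?D t) = t"
    by (rule T_ext[OF t]) (simp_all add: actT_lift[OF l] D snd_add)
  then show ?thesis by (simp add: actT_def prod_eq_iff)
qed

lemma actT_facts:
  assumes l: "l \<in> carrier L" and t: "t \<in> carrier T"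
  shows actT_closed: "actT l t \<in> carrier T"
    and actT_add_r: "t' \<in> carrier T \<Longrightarrow> actT l (t \<oplus>\<^bsub>T\<^esub> t') = actT l t \<oplus>\<^bsub>T\<^esub> actT l t'"
    and actT_smult_r: "r \<in> carrier R \<Longrightarrow> actT l (r \<odot>\<^bsub>T\<^esub> t) = r \<odot>\<^bsub>T\<^esub> actT l t"
    and actT_bracket_r: "t' \<in> carrier T \<Longrightarrow> actT l (t \<otimes>\<^bsub>T\<^esub> t') = actT l t \<otimes>\<^bsub>T\<^esub> t' \<oplus>\<^bsub>T\<^esub> t \<otimes>\<^bsub>T\<^esub> actT l t'"
proof -
  note D = lie_homD[OF actT_lift(1)[OF l]] and eq = actT_lift_eq[OF l]
  have c: "actT l t \<in> carrier T" if "t \<in> carrier T" for t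
    using lie_hom_closed[OF actT_lift(1)[OF l] that] eq[OF that] by (simp add: lie_semidirect_ops)
  show "actT l t \<in> carrier T" by (rule c[OF t])
  show "r \<in> carrier R \<Longrightarrow> actT l (r \<odot>\<^bsub>T\<^esub> t) = r \<odot>\<^bsub>T\<^esub> actT l t"
    using D(3)[of r t] t by (simp add: eq lie_semidirect_ops)
  assume t': "t' \<in> carrier T"
  show "actT l (t \<oplus>\<^bsub>T\<^esub> t') = actT l t \<oplus>\<^bsub>T\<^esub> actT l t'"
    using D(2)[of t t'] t t' by (simp add: eq lie_semidirect_ops)
  show "actT l (t \<otimes>\<^bsub>T\<^esub> t') = actT l t \<otimes>\<^bsub>T\<^esub> t' \<oplus>\<^bsub>T\<^esub> t \<otimes>\<^bsub>T\<^esub> actT l t'"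
    using D(4)[of t t'] t t' c
    by (simp add: eq lie_semidirect_ops dT_ops diffs acs T.bracket_swap[of "actT l t" t'])
qed

text \<open>For fixed l the laws are those of a derivation. The laws in l compare additive maps of
  t, so generators suffice.\<close>

sublocale AT: lie_action R L T actT
proof (intro lie_action.intro lie_action_axioms.intro)
  show "lie_algebra R L" "lie_algebra R T" by (rule M.L.lie_algebra_axioms T.lie_algebra_axioms)+
  show "actT (l \<oplus>\<^bsub>L\<^esub> l') t = actT l t \<oplus>\<^bsub>T\<^esub> actT l' t"
    if l: "l \<in> carrier L" "l' \<in> carrier L" and t: "t \<in> carrier T" for l l' t
    by (rule T_ext[OF t]) (use l in \<open>simp_all add: actT_facts actT_tens expand acs\<close>)
  show "actT (r \<odot>\<^bsub>L\<^esub> l) t = r \<odot>\<^bsub>T\<^esub> actT l t"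
    if l: "r \<in> carrier R" "l \<in> carrier L" and t: "t \<in> carrier T" for r l t
    by (rule T_ext[OF t]) (use l in \<open>simp_all add: actT_facts actT_tens expand acs\<close>)
  show "actT (l \<otimes>\<^bsub>L\<^esub> l') t = actT l (actT l' t) \<ominus>\<^bsub>T\<^esub> actT l' (actT l t)"
    if l: "l \<in> carrier L" "l' \<in> carrier L" and t: "t \<in> carrier T" for l l' t
    by (rule T_ext[OF t]) (use l in \<open>simp_all add: actT_facts actT_tens expand acs diffs\<close>)
qed (simp_all add: actT_facts)

lemmas [simp] = actT_closed

text \<open>Ellis' boundary maps to M and N. A generator m \<otimes> n goes to the bracket
  [m, \<nu> n] taken in M \<rtimes> L, which explains the sign, and under \<open>rho\<close> to
  [\<mu> m, n] taken in N \<rtimes> L.\<close>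

definition "kap = tlift M (\<lambda>m n. \<ominus>\<^bsub>M\<^esub> actM (\<nu> n) m)"
definition "rho = tlift N (\<lambda>m n. actN (\<mu> m) n)"

lemma kap: "kap \<in> lie_hom R T M"
  "\<lbrakk>m \<in> carrier M; n \<in> carrier N\<rbrakk> \<Longrightarrow> kap (tens m n) = \<ominus>\<^bsub>M\<^esub> actM (\<nu> n) m"
proof -
  \<comment> \<open>After a swap, the Peiffer identity and equivariance of \<mu> express the bracket
    as the action of [\<mu> m', \<nu> n']; equivariance of \<nu> gives the same for the other
    term.\<close>
  have 1: "actM (\<nu> n) m \<otimes>\<^bsub>M\<^esub> actM (\<nu> n') m' \<ominus>\<^bsub>M\<^esub> actM (\<nu> (actN (\<mu> m') n')) (actM (\<nu> n) m) = \<zero>\<^bsub>M\<^esub>"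
     if "m \<in> carrier M" "m' \<in> carrier M" "n \<in> carrier N" "n' \<in> carrier N" for m m' n n'
  proof -
    have "actM (\<nu> n) m \<otimes>\<^bsub>M\<^esub> actM (\<nu> n') m' = \<ominus>\<^bsub>M\<^esub> (actM (\<nu> n') m' \<otimes>\<^bsub>M\<^esub> actM (\<nu> n) m)"
      using that by (intro M.M.bracket_anti) auto
    moreover have "actM (\<nu> n') m' \<otimes>\<^bsub>M\<^esub> actM (\<nu> n) m = actM (\<mu> (actM (\<nu> n') m')) (actM (\<nu> n) m)"
      by (rule M.peiffer[symmetric]) (use that in auto)
    ultimately show ?thesis using that
      by (simp add: M.equivariance N.equivariance expand diffs acs)
  qed
  have 2: "actM (\<nu> n) m \<otimes>\<^bsub>M\<^esub> m' = \<zero>\<^bsub>M\<^esub> \<ominus>\<^bsub>M\<^esub> m' \<otimes>\<^bsub>M\<^esub> actM (\<nu> n) m"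
     if "m \<in> carrier M" "m' \<in> carrier M" "n \<in> carrier N" for m m' n
    using that by (intro M.M.bracket_swap) auto
  have "lie_pairing M (\<lambda>m n. \<ominus>\<^bsub>M\<^esub> actM (\<nu> n) m)"
    unfolding lie_pairing_def
  proof (intro conjI ballI, goal_cases)
    case (8 m m' n n')
    with 1[OF this] show ?case by (simp add: expand mu_hom nu_hom diffs acs)
  qed (simp_all add: expand mu_hom nu_hom 2 diffs acs)
  from tlift[OF M.M.lie_algebra_axioms this]
  show "kap \<in> lie_hom R T M"
    "\<lbrakk>m \<in> carrier M; n \<in> carrier N\<rbrakk> \<Longrightarrow> kap (tens m n) = \<ominus>\<^bsub>M\<^esub> actM (\<nu> n) m"
    unfolding kap_def by auto
qed

lemma rho: "rho \<in> lie_hom R T N"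
  "\<lbrakk>m \<in> carrier M; n \<in> carrier N\<rbrakk> \<Longrightarrow> rho (tens m n) = actN (\<mu> m) n"
proof -
  \<comment> \<open>By the Peiffer identity of N the first term is the action of [\<mu> m, \<nu> n];
    the second is that of [\<nu> n, \<mu> m].\<close>
  have 1: "actN (\<mu> m) n \<otimes>\<^bsub>N\<^esub> actN (\<mu> m') n' \<oplus>\<^bsub>N\<^esub> actN (\<mu> (actM (\<nu> n) m)) (actN (\<mu> m') n') = \<zero>\<^bsub>N\<^esub>"
     if "m \<in> carrier M" "m' \<in> carrier M" "n \<in> carrier N" "n' \<in> carrier N" for m m' n n'
  proof -
    have "actN (\<mu> m) n \<otimes>\<^bsub>N\<^esub> actN (\<mu> m') n' = actN (\<nu> (actN (\<mu> m) n)) (actN (\<mu> m') n')"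
      by (rule N.peiffer[symmetric]) (use that in auto)
    then show ?thesis using that
      by (simp add: M.equivariance N.equivariance expand diffs acs)
  qed
  have 2: "actN (\<mu> m) n \<otimes>\<^bsub>N\<^esub> n' = \<zero>\<^bsub>N\<^esub> \<ominus>\<^bsub>N\<^esub> n' \<otimes>\<^bsub>N\<^esub> actN (\<mu> m) n"
     if "m \<in> carrier M" "n' \<in> carrier N" "n \<in> carrier N" for m n n'
    using that by (intro N.M.bracket_swap) auto
  have "lie_pairing N (\<lambda>m n. actN (\<mu> m) n)"
    unfolding lie_pairing_def
  proof (intro conjI ballI, goal_cases)
    case (8 m m' n n')
    with 1[OF this] show ?case by (simp add: expand mu_hom nu_hom diffs acs)
  qed (simp_all add: expand mu_hom nu_hom 2 diffs acs)
  from tlift[OF N.M.lie_algebra_axioms this]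
  show "rho \<in> lie_hom R T N"
    "\<lbrakk>m \<in> carrier M; n \<in> carrier N\<rbrakk> \<Longrightarrow> rho (tens m n) = actN (\<mu> m) n"
    unfolding rho_def by auto
qed

end

section \<open>The model of the quotient\<close>

context lie_crossed_pair begin

lemmas kap_hom = lie_homD(2-4)[OF kap(1)] kap(2)
  lie_hom_diff[OF T.lie_algebra_axioms M.M.lie_algebra_axioms kap(1)]
  lie_hom_zero[OF T.lie_algebra_axioms M.M.lie_algebra_axioms kap(1)]
lemmas rho_hom = lie_homD(2-4)[OF rho(1)] rho(2)
  lie_hom_diff[OF T.lie_algebra_axioms N.M.lie_algebra_axioms rho(1)]
  lie_hom_zero[OF T.lie_algebra_axioms N.M.lie_algebra_axioms rho(1)]

lemmas [simp] = lie_hom_closed[OF kap(1)] lie_hom_closed[OF rho(1)]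

section \<open>Brackets in \<open>T\<close> as actions through L\<close>

lemma kap_act: "\<lbrakk>l \<in> carrier L; t \<in> carrier T\<rbrakk> \<Longrightarrow> kap (actT l t) = actM l (kap t)"
  by (rule additive_ext[OF M.M.lie_algebra_axioms])
    (simp_all add: AT.act_bilinear kap_hom actT_tens expand nu_hom diffs acs)

lemma rho_act: "\<lbrakk>l \<in> carrier L; t \<in> carrier T\<rbrakk> \<Longrightarrow> rho (actT l t) = actN l (rho t)"
  by (rule additive_ext[OF N.M.lie_algebra_axioms])
    (simp_all add: AT.act_bilinear rho_hom actT_tens expand mu_hom diffs acs)

text \<open>With a = (\<nu> n) m, the relation for [a, m'] \<otimes> n' and the Peiffer identity
  turn a \<otimes> (\<mu> m') n' into the diagonal action of \<mu> a = [\<nu> n, \<mu> m] on m'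
  \<otimes> n'. The sign in \<open>bracket_tens\<close> reverses that bracket.\<close>

lemma tens_bracket:
  assumes "m \<in> carrier M" "n \<in> carrier N" "t \<in> carrier T"
  shows "tens m n \<otimes>\<^bsub>T\<^esub> t = actT (\<mu> m \<otimes>\<^bsub>L\<^esub> \<nu> n) t"
proof (rule T_ext[OF assms(3)])
  fix m' n' assume c: "m' \<in> carrier M" "n' \<in> carrier N"
  have 1: "tens (actM (\<nu> n) m) (actN (\<mu> m') n') =
     tens (actM (\<nu> n) m \<otimes>\<^bsub>M\<^esub> m') n' \<oplus>\<^bsub>T\<^esub> tens m' (actN (\<mu> (actM (\<nu> n) m)) n')"
    using c assms by (simp add: tens_bracket_l diffs acs)
  have 2: "actM (\<nu> n) m \<otimes>\<^bsub>M\<^esub> m' = actM (\<nu> n \<otimes>\<^bsub>L\<^esub> \<mu> m) m'"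
    using c assms by (simp flip: M.peiffer add: M.equivariance)
  show "tens m n \<otimes>\<^bsub>T\<^esub> tens m' n' = actT (\<mu> m \<otimes>\<^bsub>L\<^esub> \<nu> n) (tens m' n')"
    using c assms by (simp add: bracket_tens 1 2 M.equivariance actT_tens expand diffs acs)
qed (use assms in \<open>simp_all add: expand AT.act_bilinear\<close>)

text \<open>For s = m \<otimes> n both \<open>\<mu> (kap s)\<close> and \<open>\<nu> (rho s)\<close>
  equal [\<mu> m, \<nu> n], so here and in the next lemma the claim reduces to
  \<open>tens_bracket\<close>.\<close>

lemma T_peiffer_kap:
  assumes "s \<in> carrier T" "t \<in> carrier T"
  shows "s \<otimes>\<^bsub>T\<^esub> t = actT (\<mu> (kap s)) t"
  by (rule T_ext[OF assms(1)])
    (use assms in \<open>simp_all add: expand tens_bracket kap_hom mu_hom AT.act_bilinear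
      M.L.bracket_swap[of "\<mu> _" "\<nu> _"] diffs acs\<close>)

lemma T_peiffer_rho:
  assumes "s \<in> carrier T" "t \<in> carrier T"
  shows "s \<otimes>\<^bsub>T\<^esub> t = actT (\<nu> (rho s)) t"
  by (rule T_ext[OF assms(1)])
    (use assms in \<open>simp_all add: expand tens_bracket rho_hom nu_hom AT.act_bilinear diffs acs\<close>)

text \<open>For t = m \<otimes> n' the relation for m \<otimes> [n, n'] cancels the term (\<nu> n) m
  \<otimes> n' of the diagonal action and leaves (\<nu> n') m \<otimes> n. This and its mirror image
  \<open>actT_mu\<close> make the kernels in \<open>E\<close> commute.\<close>

lemma actT_nu:
  assumes "n \<in> carrier N" "t \<in> carrier T"
  shows "actT (\<nu> n) t = \<zero>\<^bsub>T\<^esub> \<ominus>\<^bsub>T\<^esub> tens (kap t) n"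
  by (rule T_ext[OF assms(2)])
    (use assms in \<open>simp_all add: expand actT_tens kap_hom nu_hom tens_bracket_r AT.act_bilinear diffs acs\<close>)

lemma actT_mu:
  assumes "m \<in> carrier M" "t \<in> carrier T"
  shows "actT (\<mu> m) t = tens m (rho t)"
  by (rule T_ext[OF assms(2)])
    (use assms in \<open>simp_all add: expand actT_tens rho_hom mu_hom tens_bracket_l AT.act_bilinear diffs acs\<close>)

section \<open>The semidirect product \<open>E\<close> and its structure maps\<close>

abbreviation "SM \<equiv> lie_semidirect M L actM"
abbreviation "SN \<equiv> lie_semidirect N L actN"
abbreviation "ST \<equiv> lie_semidirect T N (\<lambda>n. actT (\<nu> n))"

text \<open>In the sum \<open>E\<close> of \<open>T\<close>, \<open>N\<close>, \<open>M\<close> and \<open>L\<close>, the bracket of \<open>m\<close> and \<open>n\<close> is the generator \<open>m \<otimes> n\<close>.\<close>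

definition "actE = (\<lambda>(m, l) (t, n). (actT (\<mu> m \<oplus>\<^bsub>L\<^esub> l) t \<oplus>\<^bsub>T\<^esub> tens m n, actN l n))"

abbreviation "E \<equiv> lie_semidirect ST SM actE"

sublocale NT: lie_action R N T "\<lambda>n. actT (\<nu> n)"
  by (intro lie_action.intro lie_action_axioms.intro N.M.lie_algebra_axioms T.lie_algebra_axioms)
    (simp_all add: AT.act_bilinear AT.act_bracket_l AT.act_bracket_r nu_hom(1-5))

sublocale EA: lie_action R SM ST actE
proof (intro lie_action.intro lie_action_axioms.intro M.semidirect_lie_algebra NT.semidirect_lie_algebra, goal_cases)
  case (7 x u v)
  then obtain m l t n t' n' where [simp]: "x = (m, l)" "u = (t, n)" "v = (t', n')"
    and c: "m \<in> carrier M" "l \<in> carrier L" "t \<in> carrier T" "t' \<in> carrier T" "n \<in> carrier N" "n' \<in> carrier N"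
    by (auto simp: lie_semidirect_ops)
  \<comment> \<open>Moving \<mu> m past \<nu> n' in the action on t costs the action of
    [\<mu> m, \<nu> n']; the bracket of t with the generator m \<otimes> n' supplies this
    term.\<close>
  have 1: "t \<otimes>\<^bsub>T\<^esub> tens m n' = \<zero>\<^bsub>T\<^esub> \<ominus>\<^bsub>T\<^esub> actT (\<mu> m \<otimes>\<^bsub>L\<^esub> \<nu> n') t"
    using c by (subst T.bracket_swap) (simp_all add: tens_bracket)
  show ?case using c
    by (simp add: lie_semidirect_ops actE_def expand AT.act_bilinear AT.act_bracket_l AT.act_bracket_r nu_hom mu_hom
      actT_tens 1 tens_bracket tens_bracket_r diffs acs)
next
  case (6 x y u)
  then obtain m l m' l' t n where [simp]: "x = (m, l)" "y = (m', l')" "u = (t, n)"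
    and c: "m \<in> carrier M" "l \<in> carrier L" "m' \<in> carrier M" "l' \<in> carrier L" "t \<in> carrier T" "n \<in> carrier N"
    by (auto simp: lie_semidirect_ops)
  have 1: "\<mu> m \<otimes>\<^bsub>L\<^esub> l' = \<zero>\<^bsub>L\<^esub> \<ominus>\<^bsub>L\<^esub> l' \<otimes>\<^bsub>L\<^esub> \<mu> m"
    using c by (intro M.L.bracket_swap) auto
  show ?case using c
    by (simp add: lie_semidirect_ops actE_def NT.semidirect_minus expand AT.act_bilinear AT.act_bracket_l mu_hom 1
      actT_tens tens_bracket_l diffs acs)
qed (auto simp: lie_semidirect_ops actE_def expand AT.act_bilinear mu_hom nu_hom acs)

lemma E_facts: "lie_algebra R E" "lie_algebra R SM" "lie_algebra R SN" "lie_algebra R ST"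
  by (rule EA.semidirect_lie_algebra M.semidirect_lie_algebra N.semidirect_lie_algebra NT.semidirect_lie_algebra)+

lemmas E_ops = lie_semidirect_ops actE_def NT.semidirect_minus expand AT.act_bilinear mu_hom nu_hom kap_hom rho_hom

text \<open>These four maps are forced by those of \<open>Q\<close>, since m \<otimes> n stands for
  the bracket of m and n. The domain maps annihilate one of the two factors and hence
  \<open>T\<close>; the codomain maps send m \<otimes> n to [m, \<nu> n] and [\<mu> m, n], so they
  restrict to \<open>kap\<close> and \<open>rho\<close>.\<close>

definition "dUE = (\<lambda>((t, n), (m, l)). (m, l))"
definition "dLE = (\<lambda>((t, n), (m, l)). (n, l))"
definition "cUE = (\<lambda>((t, n), (m, l)). (kap t \<oplus>\<^bsub>M\<^esub> m, \<nu> n \<oplus>\<^bsub>L\<^esub> l))"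
definition "cLE = (\<lambda>((t, n), (m, l)). (rho t \<oplus>\<^bsub>N\<^esub> n, \<mu> m \<oplus>\<^bsub>L\<^esub> l))"

lemma dUE_hom: "dUE \<in> lie_hom R E SM"
  by (auto simp: lie_hom_def dUE_def E_ops)

lemma dLE_hom: "dLE \<in> lie_hom R E SN"
  by (auto simp: lie_hom_def dLE_def E_ops diffs acs)

lemma cUE_hom: "cUE \<in> lie_hom R E SM"
proof -
  show ?thesis
    unfolding lie_hom_def
  proof (intro CollectI conjI ballI, goal_cases)
    case (4 x y)
    then obtain t n m l t' n' m' l' where [simp]: "x = ((t, n), (m, l))" "y = ((t', n'), (m', l'))"
      and c: "t \<in> carrier T" "n \<in> carrier N" "m \<in> carrier M" "l \<in> carrier L"
       "t' \<in> carrier T" "n' \<in> carrier N" "m' \<in> carrier M" "l' \<in> carrier L"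
      by (auto simp: lie_semidirect_ops)
    have 1: "kap t \<otimes>\<^bsub>M\<^esub> m' = \<zero>\<^bsub>M\<^esub> \<ominus>\<^bsub>M\<^esub> m' \<otimes>\<^bsub>M\<^esub> kap t" using c by (intro M.M.bracket_swap) auto
    have 2: "\<nu> n \<otimes>\<^bsub>L\<^esub> l' = \<zero>\<^bsub>L\<^esub> \<ominus>\<^bsub>L\<^esub> l' \<otimes>\<^bsub>L\<^esub> \<nu> n" using c by (intro M.L.bracket_swap) auto
    show ?case using c
      by (simp add: cUE_def E_ops kap_act 1 2 diffs acs)
  qed (auto simp: cUE_def E_ops acs)
qed

lemma cLE_hom: "cLE \<in> lie_hom R E SN"
  unfolding lie_hom_def
proof (intro CollectI conjI ballI, goal_cases)
  case (4 x y)
  then obtain t n m l t' n' m' l' where [simp]: "x = ((t, n), (m, l))" "y = ((t', n'), (m', l'))"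
    and c: "t \<in> carrier T" "n \<in> carrier N" "m \<in> carrier M" "l \<in> carrier L"
     "t' \<in> carrier T" "n' \<in> carrier N" "m' \<in> carrier M" "l' \<in> carrier L"
    by (auto simp: lie_semidirect_ops)
  have 1: "rho t \<otimes>\<^bsub>N\<^esub> n' = \<zero>\<^bsub>N\<^esub> \<ominus>\<^bsub>N\<^esub> n' \<otimes>\<^bsub>N\<^esub> rho t" using c by (intro N.M.bracket_swap) auto
  have 2: "\<mu> m \<otimes>\<^bsub>L\<^esub> l' = \<zero>\<^bsub>L\<^esub> \<ominus>\<^bsub>L\<^esub> l' \<otimes>\<^bsub>L\<^esub> \<mu> m" using c by (intro M.L.bracket_swap) auto
  show ?case using c
    by (simp add: cLE_def E_ops rho_act 1 2 diffs acs)
qed (auto simp: cLE_def E_ops acs)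

text \<open>Here y = ((t', n'), (-kap t', -\<nu> n')). In the bracket with (t, n) the terms in t, t'
  cancel by \<open>T_peiffer_kap\<close>, those in n, t' by \<open>actT_nu\<close>, and those in n,
  n' by the Peiffer identity of N.\<close>

lemma E_commute_U:
  assumes "x \<in> carrier E" "y \<in> carrier E" "dUE x = \<zero>\<^bsub>SM\<^esub>" "cUE y = \<zero>\<^bsub>SM\<^esub>"
  shows "x \<otimes>\<^bsub>E\<^esub> y = \<zero>\<^bsub>E\<^esub>"
proof -
  obtain t n where [simp]: "x = ((t, n), (\<zero>\<^bsub>M\<^esub>, \<zero>\<^bsub>L\<^esub>))" and c: "t \<in> carrier T" "n \<in> carrier N"
    using assms by (auto simp: dUE_def lie_semidirect_ops)
  obtain t' n' m' l' where [simp]: "y = ((t', n'), (m', l'))"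
    and c': "t' \<in> carrier T" "n' \<in> carrier N" "m' \<in> carrier M" "l' \<in> carrier L"
    and z: "kap t' \<oplus>\<^bsub>M\<^esub> m' = \<zero>\<^bsub>M\<^esub>" "\<nu> n' \<oplus>\<^bsub>L\<^esub> l' = \<zero>\<^bsub>L\<^esub>"
    using assms by (auto simp: cUE_def lie_semidirect_ops)
  have m': "m' = \<zero>\<^bsub>M\<^esub> \<ominus>\<^bsub>M\<^esub> kap t'" using z c' by (simp add: diffs acs)
  have l': "l' = \<zero>\<^bsub>L\<^esub> \<ominus>\<^bsub>L\<^esub> \<nu> n'" using z c' by (simp add: diffs acs)
  have "t \<otimes>\<^bsub>T\<^esub> t' = \<zero>\<^bsub>T\<^esub> \<ominus>\<^bsub>T\<^esub> actT (\<mu> (kap t')) t"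
    using c c' by (subst T.bracket_swap) (simp_all add: T_peiffer_kap)
  moreover have "actN (\<nu> n') n = n' \<otimes>\<^bsub>N\<^esub> n" "n \<otimes>\<^bsub>N\<^esub> n' = \<zero>\<^bsub>N\<^esub> \<ominus>\<^bsub>N\<^esub> n' \<otimes>\<^bsub>N\<^esub> n"
    using c c' by (simp_all add: N.peiffer N.M.bracket_swap[of n n'])
  ultimately show ?thesis
    using c c' actT_nu[OF c(2) c'(1)]
    by (simp add: lie_semidirect_ops actE_def NT.semidirect_minus M.semidirect_minus m' l'
        expand AT.act_bilinear mu_hom(1-5) diffs acs)
qed

text \<open>Here y = ((t', -rho t'), (m', -\<mu> m')), so its part in M \<rtimes> L annihilates (t,
  0). The rest cancels by \<open>T_peiffer_rho\<close>, \<open>actT_mu\<close> and the Peiffer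
  identity of M.\<close>

lemma E_commute_L:
  assumes "x \<in> carrier E" "y \<in> carrier E" "dLE x = \<zero>\<^bsub>SN\<^esub>" "cLE y = \<zero>\<^bsub>SN\<^esub>"
  shows "x \<otimes>\<^bsub>E\<^esub> y = \<zero>\<^bsub>E\<^esub>"
proof -
  obtain t m where [simp]: "x = ((t, \<zero>\<^bsub>N\<^esub>), (m, \<zero>\<^bsub>L\<^esub>))" and c: "t \<in> carrier T" "m \<in> carrier M"
    using assms by (auto simp: dLE_def lie_semidirect_ops)
  obtain t' n' m' l' where [simp]: "y = ((t', n'), (m', l'))"
    and c': "t' \<in> carrier T" "n' \<in> carrier N" "m' \<in> carrier M" "l' \<in> carrier L"
    and z: "rho t' \<oplus>\<^bsub>N\<^esub> n' = \<zero>\<^bsub>N\<^esub>" "\<mu> m' \<oplus>\<^bsub>L\<^esub> l' = \<zero>\<^bsub>L\<^esub>"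
    using assms by (auto simp: cLE_def lie_semidirect_ops)
  have n': "n' = \<zero>\<^bsub>N\<^esub> \<ominus>\<^bsub>N\<^esub> rho t'" using z c' by (simp add: diffs acs)
  have l': "l' = \<zero>\<^bsub>L\<^esub> \<ominus>\<^bsub>L\<^esub> \<mu> m'" using z c' by (simp add: diffs acs)
  have "t \<otimes>\<^bsub>T\<^esub> t' = \<zero>\<^bsub>T\<^esub> \<ominus>\<^bsub>T\<^esub> actT (\<nu> (rho t')) t"
    using c c' by (subst T.bracket_swap) (simp_all add: T_peiffer_rho)
  moreover have "actM (\<mu> m') m = m' \<otimes>\<^bsub>M\<^esub> m" "m \<otimes>\<^bsub>M\<^esub> m' = \<zero>\<^bsub>M\<^esub> \<ominus>\<^bsub>M\<^esub> m' \<otimes>\<^bsub>M\<^esub> m"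
    using c c' by (simp_all add: M.peiffer M.M.bracket_swap[of m m'])
  ultimately show ?thesis
    using c c' actT_mu[OF c(2) c'(1)]
    by (simp add: lie_semidirect_ops actE_def NT.semidirect_minus M.semidirect_minus n' l'
        expand AT.act_bilinear nu_hom(1-5) diffs acs)
qed

end

section \<open>Comparison with the pushout\<close>

context lie_crossed_pair begin

abbreviation "Q \<equiv> tensor_Q R L M actM N actN"
abbreviation "iU \<equiv> lie_pushout_inl R L SM SN (gpd_id M) (gpd_id N)"
abbreviation "iL \<equiv> lie_pushout_inr R L SM SN (gpd_id M) (gpd_id N)"
abbreviation "dU \<equiv> tensor_dU L M actM"
abbreviation "cU \<equiv> tensor_cU L M actM \<nu>"
abbreviation "dL \<equiv> tensor_dL L N actN"
abbreviation "cL \<equiv> tensor_cL L N actN \<mu>"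

lemma gpd_id_funcset: "gpd_id M \<in> carrier L \<rightarrow> carrier SM" "gpd_id N \<in> carrier L \<rightarrow> carrier SN"
  by (auto simp: gpd_id_def lie_semidirect_ops)

lemmas Q_universal = lie_pushout_universal[OF E_facts(2,3) gpd_id_funcset, folded tensor_Q_def]
lemmas Q_hom_ext = lie_pushout_hom_ext[OF E_facts(2,3) _ gpd_id_funcset, folded tensor_Q_def]

sublocale Q: lie_algebra R Q by (rule Q_universal(1))

lemma iU_iL: "l \<in> carrier L \<Longrightarrow> iU (\<zero>\<^bsub>M\<^esub>, l) = iL (\<zero>\<^bsub>N\<^esub>, l)"
  using Q_universal(4) by (simp add: gpd_id_def)

lemma i_closed: "u \<in> carrier SM \<Longrightarrow> iU u \<in> carrier Q" "v \<in> carrier SN \<Longrightarrow> iL v \<in> carrier Q"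
  by (rule lie_hom_closed[OF Q_universal(2)] lie_hom_closed[OF Q_universal(3)]; simp)+

lemma id_lie_hom: "(\<lambda>x. x) \<in> lie_hom R A A"
  by (auto simp: lie_hom_def)

lemma Q_copair:
  assumes "lie_algebra R D" "f \<in> lie_hom R SM D" "g \<in> lie_hom R SN D"
    "\<And>l. l \<in> carrier L \<Longrightarrow> f (\<zero>\<^bsub>M\<^esub>, l) = g (\<zero>\<^bsub>N\<^esub>, l)"
  shows "lie_copair D f g \<in> lie_hom R Q D"
    "u \<in> carrier SM \<Longrightarrow> lie_copair D f g (iU u) = f u"
    "v \<in> carrier SN \<Longrightarrow> lie_copair D f g (iL v) = g v"
  using Q_universal(5)[OF assms(1-3)] assms(4) by (simp_all add: gpd_id_def)

lemma Q_structure_maps: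
  shows "dU \<in> lie_hom R Q SM" "u \<in> carrier SM \<Longrightarrow> dU (iU u) = u"
      "v \<in> carrier SN \<Longrightarrow> dU (iL v) = (\<zero>\<^bsub>M\<^esub>, snd v)"
    and "cU \<in> lie_hom R Q SM" "u \<in> carrier SM \<Longrightarrow> cU (iU u) = u"
      "v \<in> carrier SN \<Longrightarrow> cU (iL v) = (\<zero>\<^bsub>M\<^esub>, \<nu> (fst v) \<oplus>\<^bsub>L\<^esub> snd v)"
    and "dL \<in> lie_hom R Q SN" "v \<in> carrier SN \<Longrightarrow> dL (iL v) = v"
      "u \<in> carrier SM \<Longrightarrow> dL (iU u) = (\<zero>\<^bsub>N\<^esub>, snd u)"
    and "cL \<in> lie_hom R Q SN" "v \<in> carrier SN \<Longrightarrow> cL (iL v) = v"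
      "u \<in> carrier SM \<Longrightarrow> cL (iU u) = (\<zero>\<^bsub>N\<^esub>, \<mu> (fst u) \<oplus>\<^bsub>L\<^esub> snd u)"
proof -
  note hM = lie_hom_compose[OF M.groupoid_homs(1) N.groupoid_homs(3)]
    lie_hom_compose[OF M.groupoid_homs(2) N.groupoid_homs(3)]
  note hN = lie_hom_compose[OF N.groupoid_homs(1) M.groupoid_homs(3)]
    lie_hom_compose[OF N.groupoid_homs(2) M.groupoid_homs(3)]
  note s = gpd_id_def gpd_dom_def gpd_cod_def split_beta mu_hom(5) nu_hom(5)
  note c = Q_copair[OF E_facts(2) id_lie_hom hN(1), folded tensor_dU_def]
    Q_copair[OF E_facts(2) id_lie_hom hN(2), folded tensor_cU_def]
    Q_copair[OF E_facts(3) hM(1) id_lie_hom, folded tensor_dL_def]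
    Q_copair[OF E_facts(3) hM(2) id_lie_hom, folded tensor_cL_def]
  show "dU \<in> lie_hom R Q SM" "u \<in> carrier SM \<Longrightarrow> dU (iU u) = u"
      "v \<in> carrier SN \<Longrightarrow> dU (iL v) = (\<zero>\<^bsub>M\<^esub>, snd v)"
      "cU \<in> lie_hom R Q SM" "u \<in> carrier SM \<Longrightarrow> cU (iU u) = u"
      "v \<in> carrier SN \<Longrightarrow> cU (iL v) = (\<zero>\<^bsub>M\<^esub>, \<nu> (fst v) \<oplus>\<^bsub>L\<^esub> snd v)"
      "dL \<in> lie_hom R Q SN" "v \<in> carrier SN \<Longrightarrow> dL (iL v) = v"
      "u \<in> carrier SM \<Longrightarrow> dL (iU u) = (\<zero>\<^bsub>N\<^esub>, snd u)"
      "cL \<in> lie_hom R Q SN" "v \<in> carrier SN \<Longrightarrow> cL (iL v) = v"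
      "u \<in> carrier SM \<Longrightarrow> cL (iU u) = (\<zero>\<^bsub>N\<^esub>, \<mu> (fst u) \<oplus>\<^bsub>L\<^esub> snd u)"
    using c by (simp_all add: s)
qed

text \<open>The inclusions of the two summands agree on L. The part \<open>T\<close> of
  \<open>E\<close> is reached only through brackets of M with N.\<close>

definition "hE = lie_copair E (\<lambda>u. (\<zero>\<^bsub>ST\<^esub>, u)) (\<lambda>(n, l). ((\<zero>\<^bsub>T\<^esub>, n), (\<zero>\<^bsub>M\<^esub>, l)))"

lemma hE: "hE \<in> lie_hom R Q E" "u \<in> carrier SM \<Longrightarrow> hE (iU u) = (\<zero>\<^bsub>ST\<^esub>, u)"
  "v \<in> carrier SN \<Longrightarrow> hE (iL v) = ((\<zero>\<^bsub>T\<^esub>, fst v), (\<zero>\<^bsub>M\<^esub>, snd v))"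
proof -
  have "(\<lambda>(n, l). ((\<zero>\<^bsub>T\<^esub>, n), (\<zero>\<^bsub>M\<^esub>, l))) \<in> lie_hom R SN E"
    by (auto simp: lie_hom_def E_ops diffs acs)
  from Q_copair[OF E_facts(1) EA.semidirect_incl_homs(2) this]
  show "hE \<in> lie_hom R Q E" "u \<in> carrier SM \<Longrightarrow> hE (iU u) = (\<zero>\<^bsub>ST\<^esub>, u)"
    "v \<in> carrier SN \<Longrightarrow> hE (iL v) = ((\<zero>\<^bsub>T\<^esub>, fst v), (\<zero>\<^bsub>M\<^esub>, snd v))"
    by (simp_all add: hE_def lie_semidirect_ops split_beta)
qed

text \<open>Morphisms on the pushout are compared on its two summands. Kernel conditions in
  \<open>Q\<close> thereby become conditions in \<open>E\<close>.\<close>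

lemma hE_structure_maps:
  assumes x: "x \<in> carrier Q"
  shows "dU x = dUE (hE x)" "cU x = cUE (hE x)" "dL x = dLE (hE x)" "cL x = cLE (hE x)"
proof -
  note s = lie_semidirect_ops hE Q_structure_maps
  show "dU x = dUE (hE x)"
    by (rule Q_hom_ext[OF E_facts(2) Q_structure_maps(1) lie_hom_compose[OF hE(1) dUE_hom] _ _ x])
      (auto simp: s dUE_def)
  show "cU x = cUE (hE x)"
    by (rule Q_hom_ext[OF E_facts(2) Q_structure_maps(4) lie_hom_compose[OF hE(1) cUE_hom] _ _ x])
      (auto simp: s cUE_def kap_hom nu_hom)
  show "dL x = dLE (hE x)"
    by (rule Q_hom_ext[OF E_facts(3) Q_structure_maps(7) lie_hom_compose[OF hE(1) dLE_hom] _ _ x])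
      (auto simp: s dLE_def)
  show "cL x = cLE (hE x)"
    by (rule Q_hom_ext[OF E_facts(3) Q_structure_maps(10) lie_hom_compose[OF hE(1) cLE_hom] _ _ x])
      (auto simp: s cLE_def rho_hom mu_hom)
qed

section \<open>The quotient \<open>P\<close> and its map to \<open>E\<close>\<close>

abbreviation "Com \<equiv> tensor_commutator R L M actM \<mu> N actN \<nu>"
abbreviation "P \<equiv> tensor_QMN R L M actM \<mu> N actN \<nu>"
abbreviation "pr \<equiv> (+>\<^bsub>Q\<^esub>) Com"

lemmas kernel_ideals =
  a_kernel_lie_ideal[OF Q.lie_algebra_axioms E_facts(3) Q_structure_maps(7)]
  a_kernel_lie_ideal[OF Q.lie_algebra_axioms E_facts(3) Q_structure_maps(10)]
  a_kernel_lie_ideal[OF Q.lie_algebra_axioms E_facts(2) Q_structure_maps(1)]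
  a_kernel_lie_ideal[OF Q.lie_algebra_axioms E_facts(2) Q_structure_maps(4)]

lemma Com:
  shows "lie_ideal Com R Q"
    and "\<lbrakk>x \<in> carrier Q; y \<in> carrier Q; dU x = \<zero>\<^bsub>SM\<^esub>; cU y = \<zero>\<^bsub>SM\<^esub>\<rbrakk> \<Longrightarrow> x \<otimes>\<^bsub>Q\<^esub> y \<in> Com"
    and "\<lbrakk>x \<in> carrier Q; y \<in> carrier Q; dL x = \<zero>\<^bsub>SN\<^esub>; cL y = \<zero>\<^bsub>SN\<^esub>\<rbrakk> \<Longrightarrow> x \<otimes>\<^bsub>Q\<^esub> y \<in> Com"
proof -
  note HL = huq_commutator_ideal[OF Q.lie_algebra_axioms kernel_ideals(1,2)]
  note HU = huq_commutator_ideal[OF Q.lie_algebra_axioms kernel_ideals(3,4)]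
  note J = lie_join_ideal[OF Q.lie_algebra_axioms HL(1) HU(1)]
  show "lie_ideal Com R Q"
    using J(1) by (simp add: tensor_commutator_def Let_def)
  show "\<lbrakk>x \<in> carrier Q; y \<in> carrier Q; dU x = \<zero>\<^bsub>SM\<^esub>; cU y = \<zero>\<^bsub>SM\<^esub>\<rbrakk> \<Longrightarrow> x \<otimes>\<^bsub>Q\<^esub> y \<in> Com"
    using J(3) HU(2)[of x y] by (auto simp: tensor_commutator_def Let_def a_kernel_iff)
  show "\<lbrakk>x \<in> carrier Q; y \<in> carrier Q; dL x = \<zero>\<^bsub>SN\<^esub>; cL y = \<zero>\<^bsub>SN\<^esub>\<rbrakk> \<Longrightarrow> x \<otimes>\<^bsub>Q\<^esub> y \<in> Com"
    using J(2) HL(2)[of x y] by (auto simp: tensor_commutator_def Let_def a_kernel_iff)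
qed

text \<open>By \<open>E_commute_L\<close> and \<open>E_commute_U\<close> the images of the kernels
  commute in \<open>E\<close>. The kernel of \<open>hE\<close> therefore contains both commutators
  and, being a subalgebra, their join.\<close>

lemma hE_Com: "x \<in> Com \<Longrightarrow> hE x = \<zero>\<^bsub>E\<^esub>"
proof -
  have L: "huq_commutator R Q (a_kernel Q SN dL) (a_kernel Q SN cL) \<subseteq> a_kernel Q E hE"
    by (rule hom_huq_commutator[OF Q.lie_algebra_axioms kernel_ideals(1,2) E_facts(1) hE(1)])
      (auto simp: a_kernel_iff hE_structure_maps lie_hom_closed[OF hE(1)] intro!: E_commute_L)
  have U: "huq_commutator R Q (a_kernel Q SM dU) (a_kernel Q SM cU) \<subseteq> a_kernel Q E hE"
    by (rule hom_huq_commutator[OF Q.lie_algebra_axioms kernel_ideals(3,4) E_facts(1) hE(1)])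
      (auto simp: a_kernel_iff hE_structure_maps lie_hom_closed[OF hE(1)] intro!: E_commute_U)
  have "lie_subalgebra (a_kernel Q E hE) R Q"
    by (rule lie_ideal_subalgebra[OF Q.lie_algebra_axioms a_kernel_lie_ideal[OF Q.lie_algebra_axioms E_facts(1) hE(1)]])
  with L U have "Com \<subseteq> a_kernel Q E hE"
    by (auto simp: tensor_commutator_def Let_def lie_join_def)
  then show "x \<in> Com \<Longrightarrow> hE x = \<zero>\<^bsub>E\<^esub>" by (auto simp: a_kernel_iff)
qed

lemmas P_facts = lie_ideal_quot[OF Q.lie_algebra_axioms Com(1), folded tensor_QMN_def]

sublocale P: lie_algebra R P by (rule P_facts(1))

abbreviation "hP \<equiv> lie_quot_lift hE"

lemma hP: "hP \<in> lie_hom R P E" "x \<in> carrier Q \<Longrightarrow> hP (pr x) = hE x"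
  using P_facts(4)[OF E_facts(1) hE(1) hE_Com] by simp_all

lemma pr_surj: assumes "z \<in> carrier P" obtains x where "x \<in> carrier Q" "z = pr x"
  using assms by (auto simp: tensor_QMN_def lie_quot_def A_RCOSETS_def RCOSETS_def a_r_coset_def)

text \<open>The domain maps of \<open>Q\<close> factor through \<open>hE\<close>, so they vanish on
  \<open>Com\<close> and their lifts factor through \<open>hP\<close>. The general tensor product
  can thus be read off in \<open>E\<close>.\<close>

lemma P_structure_maps:
  assumes z: "z \<in> carrier P"
  shows "lie_quot_lift dU z = dUE (hP z)" "lie_quot_lift dL z = dLE (hP z)"
proof -
  obtain x where x: "x \<in> carrier Q" "z = pr x" using pr_surj[OF z] .
  have Cc: "y \<in> carrier Q" if "y \<in> Com" for y by (rule lie_idealD(1)[OF Q.lie_algebra_axioms Com(1) that])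
  have "dU y = \<zero>\<^bsub>SM\<^esub>" "dL y = \<zero>\<^bsub>SN\<^esub>" if "y \<in> Com" for y
    using that by (simp_all add: Cc hE_structure_maps hE_Com dUE_def dLE_def lie_semidirect_ops)
  note dz = this
  show "lie_quot_lift dU z = dUE (hP z)"
    using P_facts(4)[OF E_facts(2) Q_structure_maps(1) dz(1)] x by (simp add: hP hE_structure_maps)
  show "lie_quot_lift dL z = dLE (hP z)"
    using P_facts(4)[OF E_facts(3) Q_structure_maps(7) dz(2)] x by (simp add: hP hE_structure_maps)
qed

lemma pr_commute:
  assumes "x \<in> carrier Q" "y \<in> carrier Q"
    and "dU x = \<zero>\<^bsub>SM\<^esub> \<and> cU y = \<zero>\<^bsub>SM\<^esub> \<or> dL x = \<zero>\<^bsub>SN\<^esub> \<and> cL y = \<zero>\<^bsub>SN\<^esub>"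
  shows "pr x \<otimes>\<^bsub>P\<^esub> pr y = \<zero>\<^bsub>P\<^esub>"
proof -
  have "x \<otimes>\<^bsub>Q\<^esub> y \<in> Com" using assms Com(2,3) by blast
  then have "x \<otimes>\<^bsub>Q\<^esub> y \<in> a_kernel Q P pr" by (simp add: P_facts(3))
  then show ?thesis using lie_homD(4)[OF P_facts(2) assms(1,2)] by (simp add: a_kernel_iff)
qed

section \<open>The images of M, N and L in the quotient\<close>

definition "qM m = iU (m, \<zero>\<^bsub>L\<^esub>)"
definition "qN n = iL (n, \<zero>\<^bsub>L\<^esub>)"
definition "qL l = iU (\<zero>\<^bsub>M\<^esub>, l)"
definition "pM m = pr (qM m)"
definition "pN n = pr (qN n)"
definition "pL l = pr (qL l)"

lemma q_homs: "qM \<in> lie_hom R M Q" "qN \<in> lie_hom R N Q" "qL \<in> lie_hom R L Q"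
  using lie_hom_compose[OF M.semidirect_incl_homs(1) Q_universal(2)]
    lie_hom_compose[OF N.semidirect_incl_homs(1) Q_universal(3)]
    lie_hom_compose[OF M.semidirect_incl_homs(2) Q_universal(2)]
  by (simp_all add: qM_def[abs_def] qN_def[abs_def] qL_def[abs_def])

lemmas q_closed [simp] = lie_hom_closed[OF q_homs(1)] lie_hom_closed[OF q_homs(2)] lie_hom_closed[OF q_homs(3)]
lemmas pr_closed [simp] = lie_hom_closed[OF P_facts(2)]

lemma p_homs: "pM \<in> lie_hom R M P" "pN \<in> lie_hom R N P" "pL \<in> lie_hom R L P"
  using lie_hom_compose[OF q_homs(1) P_facts(2)] lie_hom_compose[OF q_homs(2) P_facts(2)]
    lie_hom_compose[OF q_homs(3) P_facts(2)]
  by (simp_all add: pM_def[abs_def] pN_def[abs_def] pL_def[abs_def])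

lemmas p_closed [simp] = lie_hom_closed[OF p_homs(1)] lie_hom_closed[OF p_homs(2)] lie_hom_closed[OF p_homs(3)]

lemmas p_hom = lie_homD(2-4)[OF p_homs(1)] lie_homD(2-4)[OF p_homs(2)] lie_homD(2-4)[OF p_homs(3)]
  lie_hom_diff[OF M.M.lie_algebra_axioms P.lie_algebra_axioms p_homs(1)]
  lie_hom_diff[OF N.M.lie_algebra_axioms P.lie_algebra_axioms p_homs(2)]
  lie_hom_diff[OF M.L.lie_algebra_axioms P.lie_algebra_axioms p_homs(3)]
  lie_hom_zero[OF M.M.lie_algebra_axioms P.lie_algebra_axioms p_homs(1)]
  lie_hom_zero[OF N.M.lie_algebra_axioms P.lie_algebra_axioms p_homs(2)]
  lie_hom_zero[OF M.L.lie_algebra_axioms P.lie_algebra_axioms p_homs(3)]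

lemma pL_act:
  assumes "l \<in> carrier L"
  shows "m \<in> carrier M \<Longrightarrow> pL l \<otimes>\<^bsub>P\<^esub> pM m = pM (actM l m)"
    and "n \<in> carrier N \<Longrightarrow> pL l \<otimes>\<^bsub>P\<^esub> pN n = pN (actN l n)"
proof -
  note pr = lie_homD(4)[OF P_facts(2)]
  show "pL l \<otimes>\<^bsub>P\<^esub> pM m = pM (actM l m)" if "m \<in> carrier M"
    using assms that lie_homD(4)[OF Q_universal(2), of "(\<zero>\<^bsub>M\<^esub>, l)" "(m, \<zero>\<^bsub>L\<^esub>)"]
    by (simp add: pL_def pM_def pr[symmetric] qL_def qM_def i_closed lie_semidirect_ops expand M.M.M.diff_zero)
  show "pL l \<otimes>\<^bsub>P\<^esub> pN n = pN (actN l n)" if "n \<in> carrier N"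
    using assms that lie_homD(4)[OF Q_universal(3), of "(\<zero>\<^bsub>N\<^esub>, l)" "(n, \<zero>\<^bsub>L\<^esub>)"]
    by (simp add: pL_def pN_def pr[symmetric] qL_def qN_def i_closed iU_iL lie_semidirect_ops expand N.M.M.diff_zero)
qed

text \<open>The differences n - \<nu> n and m - \<mu> m are the material from which all elements of
  codomain kernels used below are built.\<close>

lemma q_structure_maps:
  "m \<in> carrier M \<Longrightarrow> dU (qM m) = (m, \<zero>\<^bsub>L\<^esub>)" "n \<in> carrier N \<Longrightarrow> dU (qN n) = \<zero>\<^bsub>SM\<^esub>"
  "m \<in> carrier M \<Longrightarrow> dL (qM m) = \<zero>\<^bsub>SN\<^esub>" "n \<in> carrier N \<Longrightarrow> dL (qN n) = (n, \<zero>\<^bsub>L\<^esub>)"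
  "n \<in> carrier N \<Longrightarrow> cU (qN n \<ominus>\<^bsub>Q\<^esub> qL (\<nu> n)) = \<zero>\<^bsub>SM\<^esub>"
  "m \<in> carrier M \<Longrightarrow> cL (qM m \<ominus>\<^bsub>Q\<^esub> qL (\<mu> m)) = \<zero>\<^bsub>SN\<^esub>"
  by (simp_all add: qM_def qN_def qL_def Q_structure_maps lie_semidirect_ops i_closed
      lie_hom_diff[OF Q.lie_algebra_axioms E_facts(2) Q_structure_maps(4)]
      lie_hom_diff[OF Q.lie_algebra_axioms E_facts(3) Q_structure_maps(10)]
      M.semidirect_minus N.semidirect_minus mu_hom(5) nu_hom(5) diffs)

lemmas SM_interp = lie_algebra.bracket_zero_l[OF E_facts(2)] lie_algebra.bracket_zero_r[OF E_facts(2)]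
lemmas SN_interp = lie_algebra.bracket_zero_l[OF E_facts(3)] lie_algebra.bracket_zero_r[OF E_facts(3)]

lemma pr_diff: "\<lbrakk>x \<in> carrier Q; y \<in> carrier Q\<rbrakk> \<Longrightarrow> pr (x \<ominus>\<^bsub>Q\<^esub> y) = pr x \<ominus>\<^bsub>P\<^esub> pr y"
  by (rule lie_hom_diff[OF Q.lie_algebra_axioms P.lie_algebra_axioms P_facts(2)])

text \<open>Every preimage of z lies in the kernel of \<open>dU\<close>, and n - \<nu> n lies in
  that of \<open>cU\<close>; their bracket dies in \<open>P\<close>.\<close>

lemma pN_bracket:
  assumes z: "z \<in> carrier P" "dUE (hP z) = \<zero>\<^bsub>SM\<^esub>" and n: "n \<in> carrier N"
  shows "pN n \<otimes>\<^bsub>P\<^esub> z = pL (\<nu> n) \<otimes>\<^bsub>P\<^esub> z"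
proof -
  obtain x where x: "x \<in> carrier Q" "z = pr x" using pr_surj[OF z(1)] .
  have "pr x \<otimes>\<^bsub>P\<^esub> pr (qN n \<ominus>\<^bsub>Q\<^esub> qL (\<nu> n)) = \<zero>\<^bsub>P\<^esub>"
    using x z n hE_structure_maps(1)[OF x(1)] by (intro pr_commute) (simp_all add: q_structure_maps hP)
  then show ?thesis
    using x n by (simp add: pr_diff pN_def pL_def P.bracket_bilinear P.bracket_swap[of _ "pr x"] P.M.diff_simps)
qed

lemma pM_bracket:
  assumes z: "z \<in> carrier P" "dLE (hP z) = \<zero>\<^bsub>SN\<^esub>" and m: "m \<in> carrier M"
  shows "pM m \<otimes>\<^bsub>P\<^esub> z = pL (\<mu> m) \<otimes>\<^bsub>P\<^esub> z"
proof -
  obtain x where x: "x \<in> carrier Q" "z = pr x" using pr_surj[OF z(1)] .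
  have "pr x \<otimes>\<^bsub>P\<^esub> pr (qM m \<ominus>\<^bsub>Q\<^esub> qL (\<mu> m)) = \<zero>\<^bsub>P\<^esub>"
    using x z m hE_structure_maps(3)[OF x(1)] by (intro pr_commute) (simp_all add: q_structure_maps hP)
  then show ?thesis
    using x m by (simp add: pr_diff pM_def pL_def P.bracket_bilinear P.bracket_swap[of _ "pr x"] P.M.diff_simps)
qed

lemma hP_gens:
  "m \<in> carrier M \<Longrightarrow> hP (pM m) = (\<zero>\<^bsub>ST\<^esub>, (m, \<zero>\<^bsub>L\<^esub>))"
  "n \<in> carrier N \<Longrightarrow> hP (pN n) = ((\<zero>\<^bsub>T\<^esub>, n), \<zero>\<^bsub>SM\<^esub>)"
  by (simp_all add: pM_def pN_def hP) (simp_all add: qM_def qN_def hE lie_semidirect_ops)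

text \<open>In particular the bracket lies in both domain kernels, so \<open>pM_bracket\<close> and
  \<open>pN_bracket\<close> apply to it.\<close>

lemma hP_bracket:
  "\<lbrakk>m \<in> carrier M; n \<in> carrier N\<rbrakk> \<Longrightarrow> hP (pM m \<otimes>\<^bsub>P\<^esub> pN n) = ((tens m n, \<zero>\<^bsub>N\<^esub>), (\<zero>\<^bsub>M\<^esub>, \<zero>\<^bsub>L\<^esub>))"
  by (simp add: lie_homD(4)[OF hP(1)] hP_gens E_ops diffs)

lemma bracket_pairing: "lie_pairing P (\<lambda>m n. pM m \<otimes>\<^bsub>P\<^esub> pN n)"
proof -
  \<comment> \<open>On a bracket [m, n] the element m' acts as \<mu> m' does, and L acts on it by
    the Leibniz rule.\<close>
  have K: "pM m' \<otimes>\<^bsub>P\<^esub> (pM m \<otimes>\<^bsub>P\<^esub> pN n) = pM (actM (\<mu> m') m) \<otimes>\<^bsub>P\<^esub> pN n \<oplus>\<^bsub>P\<^esub> pM m \<otimes>\<^bsub>P\<^esub> pN (actN (\<mu> m') n)"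
    if "m \<in> carrier M" "m' \<in> carrier M" "n \<in> carrier N" for m m' n
    using that by (simp add: pM_bracket hP_bracket dLE_def lie_semidirect_ops P.bracket_leibniz[of "pL _"] pL_act)
  have K': "pN n' \<otimes>\<^bsub>P\<^esub> (pM m \<otimes>\<^bsub>P\<^esub> pN n) = pM (actM (\<nu> n') m) \<otimes>\<^bsub>P\<^esub> pN n \<oplus>\<^bsub>P\<^esub> pM m \<otimes>\<^bsub>P\<^esub> pN (actN (\<nu> n') n)"
    if "m \<in> carrier M" "n' \<in> carrier N" "n \<in> carrier N" for m n' n
    using that by (simp add: pN_bracket hP_bracket dUE_def lie_semidirect_ops P.bracket_leibniz[of "pL _"] pL_act)
  have 6: "pM (m \<otimes>\<^bsub>M\<^esub> m') \<otimes>\<^bsub>P\<^esub> pN n = pM m \<otimes>\<^bsub>P\<^esub> pN (actN (\<mu> m') n) \<ominus>\<^bsub>P\<^esub> pM m' \<otimes>\<^bsub>P\<^esub> pN (actN (\<mu> m) n)"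
    if c: "m \<in> carrier M" "m' \<in> carrier M" "n \<in> carrier N" for m m' n
  proof -
    have "pM m \<otimes>\<^bsub>P\<^esub> (pM m' \<otimes>\<^bsub>P\<^esub> pN n) = pM (m \<otimes>\<^bsub>M\<^esub> m') \<otimes>\<^bsub>P\<^esub> pN n \<oplus>\<^bsub>P\<^esub> pM m' \<otimes>\<^bsub>P\<^esub> (pM m \<otimes>\<^bsub>P\<^esub> pN n)"
      using c by (simp add: P.bracket_leibniz[of "pM m"] p_hom)
    \<comment> \<open>Evaluating the iterated brackets by \<open>K\<close> leaves a spare copy of
      [[m, m'], n] on both sides. It is kept as the last summand in order to be cancelled.\<close>
    then have "(pM m' \<otimes>\<^bsub>P\<^esub> pN (actN (\<mu> m) n) \<oplus>\<^bsub>P\<^esub> pM (m \<otimes>\<^bsub>M\<^esub> m') \<otimes>\<^bsub>P\<^esub> pN n) \<oplus>\<^bsub>P\<^esub> pM (m \<otimes>\<^bsub>M\<^esub> m') \<otimes>\<^bsub>P\<^esub> pN n =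
        pM m \<otimes>\<^bsub>P\<^esub> pN (actN (\<mu> m') n) \<oplus>\<^bsub>P\<^esub> pM (m \<otimes>\<^bsub>M\<^esub> m') \<otimes>\<^bsub>P\<^esub> pN n"
      using c by (simp add: K M.peiffer M.M.bracket_swap[of m' m] p_hom P.bracket_bilinear P.M.diff_simps P.M.a_ac)
    then show ?thesis
      using c by (subst (asm) P.M.add.right_cancel) (simp_all add: P.M.diff_simps P.M.a_ac)
  qed
  have 7: "pM m \<otimes>\<^bsub>P\<^esub> pN (n \<otimes>\<^bsub>N\<^esub> n') = pM (actM (\<nu> n') m) \<otimes>\<^bsub>P\<^esub> pN n \<ominus>\<^bsub>P\<^esub> pM (actM (\<nu> n) m) \<otimes>\<^bsub>P\<^esub> pN n'"
    if c: "m \<in> carrier M" "n \<in> carrier N" "n' \<in> carrier N" for m n n'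
  proof -
    have "pM m \<otimes>\<^bsub>P\<^esub> (pN n \<otimes>\<^bsub>P\<^esub> pN n') = \<zero>\<^bsub>P\<^esub> \<ominus>\<^bsub>P\<^esub> pN n' \<otimes>\<^bsub>P\<^esub> (pM m \<otimes>\<^bsub>P\<^esub> pN n) \<oplus>\<^bsub>P\<^esub> pN n \<otimes>\<^bsub>P\<^esub> (pM m \<otimes>\<^bsub>P\<^esub> pN n')"
      using c by (simp add: P.bracket_leibniz[of "pM m"] P.bracket_swap[of "pM m \<otimes>\<^bsub>P\<^esub> pN n" "pN n'"])
    then have "(pM (actM (\<nu> n') m) \<otimes>\<^bsub>P\<^esub> pN n) \<oplus>\<^bsub>P\<^esub> pM m \<otimes>\<^bsub>P\<^esub> pN (n \<otimes>\<^bsub>N\<^esub> n') =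
        (pM m \<otimes>\<^bsub>P\<^esub> pN (n \<otimes>\<^bsub>N\<^esub> n') \<oplus>\<^bsub>P\<^esub> pM (actM (\<nu> n) m) \<otimes>\<^bsub>P\<^esub> pN n') \<oplus>\<^bsub>P\<^esub> pM m \<otimes>\<^bsub>P\<^esub> pN (n \<otimes>\<^bsub>N\<^esub> n')"
      using c by (simp add: K' N.peiffer N.M.bracket_swap[of n' n] p_hom P.bracket_bilinear P.M.diff_simps P.M.a_ac)
    then show ?thesis
      using c by (subst (asm) P.M.add.right_cancel) (simp_all add: P.M.diff_simps P.M.a_ac)
  qed
  have 8: "(pM m \<otimes>\<^bsub>P\<^esub> pN n) \<otimes>\<^bsub>P\<^esub> (pM m' \<otimes>\<^bsub>P\<^esub> pN n') = \<ominus>\<^bsub>P\<^esub> (pM (actM (\<nu> n) m) \<otimes>\<^bsub>P\<^esub> pN (actN (\<mu> m') n'))"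
    if c: "m \<in> carrier M" "m' \<in> carrier M" "n \<in> carrier N" "n' \<in> carrier N" for m m' n n'
  proof -
    note h = lie_homD(4)[OF Q_structure_maps(1)] lie_homD(4)[OF Q_structure_maps(4)]
      lie_homD(4)[OF Q_structure_maps(7)] lie_homD(4)[OF Q_structure_maps(10)]
    note z = SM_interp SN_interp lie_hom_closed[OF Q_structure_maps(1)] lie_hom_closed[OF Q_structure_maps(4)]
      lie_hom_closed[OF Q_structure_maps(7)] lie_hom_closed[OF Q_structure_maps(10)]
    note pr = lie_homD(4)[OF P_facts(2)] pr_diff
    \<comment> \<open>First exchange: [m', n'] lies in the kernel of \<open>dU\<close> and
      [m, n - \<nu> n] in that of \<open>cU\<close>, so n may be replaced by \<nu> n.\<close>
    have "pr (qM m' \<otimes>\<^bsub>Q\<^esub> qN n') \<otimes>\<^bsub>P\<^esub> pr (qM m \<otimes>\<^bsub>Q\<^esub> (qN n \<ominus>\<^bsub>Q\<^esub> qL (\<nu> n))) = \<zero>\<^bsub>P\<^esub>"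
      using c by (intro pr_commute disjI1) (simp_all add: h z q_structure_maps(2,5))
    then have 1: "(pM m' \<otimes>\<^bsub>P\<^esub> pN n') \<otimes>\<^bsub>P\<^esub> (pM m \<otimes>\<^bsub>P\<^esub> (pN n \<ominus>\<^bsub>P\<^esub> pL (\<nu> n))) = \<zero>\<^bsub>P\<^esub>"
      using c by (simp add: pr pM_def pN_def pL_def)
    \<comment> \<open>Second exchange: [m, \<nu> n] lies in the kernel of \<open>dL\<close> and
      [m' - \<mu> m', n'] in that of \<open>cL\<close>, so m' may be replaced by \<mu> m'. Both
      inner brackets are then actions.\<close>
    have "pr (qM m \<otimes>\<^bsub>Q\<^esub> qL (\<nu> n)) \<otimes>\<^bsub>P\<^esub> pr ((qM m' \<ominus>\<^bsub>Q\<^esub> qL (\<mu> m')) \<otimes>\<^bsub>Q\<^esub> qN n') = \<zero>\<^bsub>P\<^esub>"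
      using c by (intro pr_commute disjI2) (simp_all add: h z q_structure_maps(3,6))
    then have 2: "(pM m \<otimes>\<^bsub>P\<^esub> pL (\<nu> n)) \<otimes>\<^bsub>P\<^esub> ((pM m' \<ominus>\<^bsub>P\<^esub> pL (\<mu> m')) \<otimes>\<^bsub>P\<^esub> pN n') = \<zero>\<^bsub>P\<^esub>"
      using c by (simp add: pr pM_def pN_def pL_def)
    have 3: "pM m \<otimes>\<^bsub>P\<^esub> pL (\<nu> n) = \<zero>\<^bsub>P\<^esub> \<ominus>\<^bsub>P\<^esub> pM (actM (\<nu> n) m)"
      using c by (subst P.bracket_swap) (simp_all add: pL_act)
    let ?x = "pM m' \<otimes>\<^bsub>P\<^esub> pN n'"
    have "(pM m \<otimes>\<^bsub>P\<^esub> pN n) \<otimes>\<^bsub>P\<^esub> ?x = \<ominus>\<^bsub>P\<^esub> (pM (actM (\<nu> n) m) \<otimes>\<^bsub>P\<^esub> ?x)"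
      using c 1 by (simp add: 3 P.bracket_bilinear P.bracket_swap[of ?x] P.M.diff_simps P.M.a_ac)
    moreover have "pM (actM (\<nu> n) m) \<otimes>\<^bsub>P\<^esub> ?x = pM (actM (\<nu> n) m) \<otimes>\<^bsub>P\<^esub> pN (actN (\<mu> m') n')"
      using c 2 by (simp add: 3 pL_act P.bracket_bilinear P.M.diff_simps P.M.a_ac)
    ultimately show ?thesis by simp
  qed
  show ?thesis
    unfolding lie_pairing_def using 6 7 8 by (simp add: p_hom P.bracket_bilinear)
qed

section \<open>The morphism from \<open>T\<close> to \<open>P\<close> and its inverse\<close>

definition "phi = tlift P (\<lambda>m n. pM m \<otimes>\<^bsub>P\<^esub> pN n)"

lemma phi: "phi \<in> lie_hom R T P"
  "\<lbrakk>m \<in> carrier M; n \<in> carrier N\<rbrakk> \<Longrightarrow> phi (tens m n) = pM m \<otimes>\<^bsub>P\<^esub> pN n"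
  using tlift[OF P.lie_algebra_axioms bracket_pairing] by (simp_all add: phi_def)

lemmas [simp] = lie_hom_closed[OF phi(1)]
lemmas phi_hom = lie_homD(2-4)[OF phi(1)] phi(2)

text \<open>Both sides are additive and agree on generators by \<open>hP_bracket\<close>. It follows
  that \<open>phi\<close> is injective and takes values in both domain kernels.\<close>

lemma hP_phi: "t \<in> carrier T \<Longrightarrow> hP (phi t) = ((t, \<zero>\<^bsub>N\<^esub>), (\<zero>\<^bsub>M\<^esub>, \<zero>\<^bsub>L\<^esub>))"
  by (rule additive_ext[OF E_facts(1)])
    (simp_all add: phi_hom hP_bracket lie_homD(2)[OF hP(1)] lie_semidirect_ops)

lemma phi_act:
  assumes l: "l \<in> carrier L" and t: "t \<in> carrier T"
  shows "phi (actT l t) = pL l \<otimes>\<^bsub>P\<^esub> phi t"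
  by (rule additive_ext[OF P.lie_algebra_axioms t])
    (use l in \<open>simp_all add: AT.act_bilinear phi_hom actT_tens P.bracket_bilinear P.bracket_leibniz[of "pL l"] pL_act\<close>)

text \<open>A morphism \<psi> from \<open>E\<close> to \<open>P\<close> is built with \<psi> after
  \<open>hP\<close> the identity. On the two domain kernels \<open>hP z\<close> has only a component
  in \<open>T\<close>, where \<psi> is \<open>phi\<close>.\<close>

lemma phi_hP:
  assumes z: "z \<in> carrier P" "dUE (hP z) = \<zero>\<^bsub>SM\<^esub>" "dLE (hP z) = \<zero>\<^bsub>SN\<^esub>"
  shows "phi (fst (fst (hP z))) = z"
proof -
  define \<psi>' where "\<psi>' = (\<lambda>(t, n). phi t \<oplus>\<^bsub>P\<^esub> pN n)"
  define \<psi> where "\<psi> = (\<lambda>(s, u). \<psi>' s \<oplus>\<^bsub>P\<^esub> pr (iU u))"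
  \<comment> \<open>N acts on \<open>T\<close> through \<nu>, while in \<open>P\<close> it acts on
    \<open>phi t\<close> by the bracket with n; \<open>pN_bracket\<close> identifies the
    two.\<close>
  have \<psi>': "\<psi>' \<in> lie_hom R ST P"
    unfolding \<psi>'_def
    by (rule NT.semidirect_copair_hom[OF P.lie_algebra_axioms phi(1) p_homs(2)])
      (simp add: phi_act pN_bracket hP_phi dUE_def lie_semidirect_ops)
  have iU: "pr (iU (m, l)) = pM m \<oplus>\<^bsub>P\<^esub> pL l" if "m \<in> carrier M" "l \<in> carrier L" for m l
  proof -
    have "iU (m, l) = qM m \<oplus>\<^bsub>Q\<^esub> qL l"
      using that lie_homD(2)[OF Q_universal(2), of "(m, \<zero>\<^bsub>L\<^esub>)" "(\<zero>\<^bsub>M\<^esub>, l)"]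
      by (simp add: qM_def qL_def lie_semidirect_ops)
    then show ?thesis using that by (simp add: lie_homD(2)[OF P_facts(2)] pM_def pL_def)
  qed
  have iL: "pr (iL (n, l)) = pN n \<oplus>\<^bsub>P\<^esub> pL l" if "n \<in> carrier N" "l \<in> carrier L" for n l
  proof -
    have "iL (n, l) = qN n \<oplus>\<^bsub>Q\<^esub> qL l"
      using that lie_homD(2)[OF Q_universal(3), of "(n, \<zero>\<^bsub>L\<^esub>)" "(\<zero>\<^bsub>N\<^esub>, l)"]
      by (simp add: qN_def qL_def iU_iL lie_semidirect_ops)
    then show ?thesis using that by (simp add: lie_homD(2)[OF P_facts(2)] pN_def pL_def)
  qed
  \<comment> \<open>In [m, phi t + n] the first part is the action of \<mu> m by
    \<open>pM_bracket\<close> and the second is phi (m \<otimes> n), exactly as in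
    \<open>actE\<close>.\<close>
  have \<psi>: "\<psi> \<in> lie_hom R E P"
    unfolding \<psi>_def
    by (rule EA.semidirect_copair_hom[OF P.lie_algebra_axioms \<psi>' lie_hom_compose[OF Q_universal(2) P_facts(2)]])
      (auto simp: lie_semidirect_ops \<psi>'_def actE_def iU phi_hom phi_act AT.act_bilinear p_hom
         P.bracket_bilinear pM_bracket hP_phi dLE_def pL_act P.M.a_ac)
  obtain x where x: "x \<in> carrier Q" "z = pr x" using pr_surj[OF z(1)] .
  have phi0: "phi \<zero>\<^bsub>T\<^esub> = \<zero>\<^bsub>P\<^esub>" by (rule lie_hom_zero[OF T.lie_algebra_axioms P.lie_algebra_axioms phi(1)])
  \<comment> \<open>Compared on the two summands of the pushout, this gives that \<psi> inverts
    \<open>hP\<close> on the left, since \<open>pr\<close> is surjective.\<close>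
  have "\<psi> (hE x) = pr x"
    by (rule Q_hom_ext[OF P.lie_algebra_axioms lie_hom_compose[OF hE(1) \<psi>] P_facts(2) _ _ x(1)])
      (auto simp: lie_semidirect_ops hE \<psi>_def \<psi>'_def iU iL p_hom phi0)
  moreover obtain t where t: "t \<in> carrier T" "hE x = ((t, \<zero>\<^bsub>N\<^esub>), (\<zero>\<^bsub>M\<^esub>, \<zero>\<^bsub>L\<^esub>))"
    using z x lie_hom_closed[OF hE(1) x(1)] by (auto simp: hP dUE_def dLE_def lie_semidirect_ops)
  ultimately show ?thesis
    using t x by (simp add: hP \<psi>_def \<psi>'_def iU p_hom)
qed

text \<open>On the intersection of the domain kernels the component of \<open>hP\<close> in
  \<open>T\<close> is a morphism; \<open>hP_phi\<close> and \<open>phi_hP\<close> make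
  \<open>phi\<close> its two-sided inverse.\<close>

lemma general_tensor_isomorphic: "lie_isomorphic R (general_tensor R L M actM \<mu> N actN \<nu>) T"
proof -
  let ?K = "{z \<in> carrier P. dUE (hP z) = \<zero>\<^bsub>SM\<^esub> \<and> dLE (hP z) = \<zero>\<^bsub>SN\<^esub>}"
  let ?F = "\<lambda>z. fst (fst (hP z))"
  have G: "general_tensor R L M actM \<mu> N actN \<nu> = P\<lparr>carrier := ?K\<rparr>"
  proof -
    have "a_kernel P SM (lie_quot_lift dU) \<inter> a_kernel P SN (lie_quot_lift dL) = ?K"
      using P_structure_maps by (auto simp: a_kernel_iff)
    then show ?thesis by (simp add: general_tensor_def Let_def)
  qed
  have F: "hP z = ((?F z, \<zero>\<^bsub>N\<^esub>), (\<zero>\<^bsub>M\<^esub>, \<zero>\<^bsub>L\<^esub>)) \<and> ?F z \<in> carrier T" if "z \<in> ?K" for z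
    using that lie_hom_closed[OF hP(1), of z] by (auto simp: dUE_def dLE_def lie_semidirect_ops)
  note h = lie_homD(2-4)[OF hP(1)]
  have "?F \<in> lie_hom R (P\<lparr>carrier := ?K\<rparr>) T"
    unfolding lie_hom_def
  proof (intro CollectI conjI ballI funcsetI, goal_cases)
    case (1 x)
    then show ?case using F by auto
  next
    case (2 x y)
    then have "?F (x \<oplus>\<^bsub>P\<^esub> y) = fst (fst (((?F x, \<zero>\<^bsub>N\<^esub>), (\<zero>\<^bsub>M\<^esub>, \<zero>\<^bsub>L\<^esub>)) \<oplus>\<^bsub>E\<^esub> ((?F y, \<zero>\<^bsub>N\<^esub>), (\<zero>\<^bsub>M\<^esub>, \<zero>\<^bsub>L\<^esub>))))"
      using F[of x] F[of y] h(1)[of x y] by auto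
    then show ?case by (simp add: lie_semidirect_ops)
  next
    case (3 r x)
    then have "?F (r \<odot>\<^bsub>P\<^esub> x) = fst (fst (r \<odot>\<^bsub>E\<^esub> ((?F x, \<zero>\<^bsub>N\<^esub>), (\<zero>\<^bsub>M\<^esub>, \<zero>\<^bsub>L\<^esub>))))"
      using F[of x] h(2)[of r x] by auto
    then show ?case by (simp add: lie_semidirect_ops)
  next
    case (4 x y)
    then have "?F (x \<otimes>\<^bsub>P\<^esub> y) = fst (fst (((?F x, \<zero>\<^bsub>N\<^esub>), (\<zero>\<^bsub>M\<^esub>, \<zero>\<^bsub>L\<^esub>)) \<otimes>\<^bsub>E\<^esub> ((?F y, \<zero>\<^bsub>N\<^esub>), (\<zero>\<^bsub>M\<^esub>, \<zero>\<^bsub>L\<^esub>))))"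
      using F[of x] F[of y] h(3)[of x y] by auto
    then show ?case using 4 F[of x] F[of y] by (simp add: E_ops diffs)
  qed
  moreover have "bij_betw ?F ?K (carrier T)"
    by (rule bij_betw_byWitness[where f' = phi])
      (use F in \<open>auto simp: phi_hP hP_phi dUE_def dLE_def lie_semidirect_ops\<close>)
  ultimately show ?thesis by (auto simp: G lie_isomorphic_def)
qed

end

theorem proposition7p12:
  fixes R :: "('r, 'x) ring_scheme"
    and L :: "('r, 'l, 'w) module_scheme"
    and M :: "('r, 'm, 'y) module_scheme"
    and N :: "('r, 'n, 'z) module_scheme"
    and actM :: "'l \<Rightarrow> 'm \<Rightarrow> 'm" and \<mu> :: "'m \<Rightarrow> 'l"
    and actN :: "'l \<Rightarrow> 'n \<Rightarrow> 'n" and \<nu> :: "'n \<Rightarrow> 'l"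
  assumes "lie_crossed_module R L M actM \<mu>"
    and "lie_crossed_module R L N actN \<nu>"
  shows "lie_isomorphic R
    (general_tensor R L M actM \<mu> N actN \<nu>)
    (lie_tensor R M N (\<lambda>m. actN (\<mu> m)) (\<lambda>n. actM (\<nu> n)))"
proof -
  interpret lie_crossed_pair R L M N actM \<mu> actN \<nu>
    using assms by (rule lie_crossed_pair.intro)
  show ?thesis by (rule general_tensor_isomorphic)
qed

end
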